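(* Let $q\ge 4$ be real and let $n\ge 1$ be an integer. Let $V(n)_{\mathbb{R}}$ be the real skein space of the Tutte polynomial (Potts model with parameter $q$) on $n$ vertices. Then the edge operators $A_{j,y}$ and $B_{j,x}$ on $V(n)_{\mathbb{R}}$, using all real $x,y\ne 1$ for which the operators are invertible, projectively generate $\mathrm{PSL}(V(n)_{\mathbb{R}})$; that is, the subgroup of $\mathrm{PGL}(V(n)_{\mathbb{R}})$ generated by their classes contains $\mathrm{PSL}(V(n)_{\mathbb{R}})$.
   Context: $V(n)_{\mathbb{R}}$ is the real vector space of formal linear combinations of weighted planar graphs in a half-plane with $n$ marked boundary vertices $1,\dots,n$ in order (other vertices being interior), modulo the Potts skein relations: a graph containing an edge of Potts weight $y$ equals the graph with the edge deleted plus $(y-1)$ times the graph with the edge contracted, and an isolated interior vertex is replaced by the scalar $q$. It has as basis the non-crossing partitions of $\{1,\dots,n\}$ (the vertices in each block being identified). Equivalently, doubling each edge at each vertex into two arcs identifies it, for $q=t+2+t^{-1}$, with the Kauffman bracket skein space of planar matchings of $2n$ points. Edge operators. For $1\le j\le n-1$, $A_{j,y}$ adjoins an edge of Potts weight $y$ between boundary vertices $j$ and $j+1$; thus $A_{j,y}=\mathrm{Id}+(y-1)J_j$, where $J_j$ merges the blocks of $j$ and $j+1$. For $1\le j\le n$, $B_{j,x}$ makes the old boundary vertex $j$ interior and joins it to a new boundary vertex $j$ by an edge of dual weight $x$, i.e. of Potts weight $y$ with $(x-1)(y-1)=q$; thus $B_{j,x}=(y-1)\mathrm{Id}+D_j$,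 where $D_j$ makes $j$ a singleton block, multiplying by $q$ if $\{j\}$ was already a block. $\mathrm{PSL}(V)$ denotes the image of $\mathrm{SL}(V)$ in $\mathrm{PGL}(V)$. *)

theory Defs
  imports
    "HOL-Analysis.Analysis"
    "HOL-Library.Poly_Mapping"
    "HOL-Algebra.Module"
    "HOL-Algebra.Generated_Groups"
begin

section \<open>Formal real linear combinations\<close>

instantiation poly_mapping :: (type, real_vector) real_vector
begin

lift_definition scaleR_poly_mapping :: "real \<Rightarrow> ('a \<Rightarrow>\<^sub>0 'b) \<Rightarrow> 'a \<Rightarrow>\<^sub>0 'b"
  is "\<lambda>c f x. c *\<^sub>R f x"
  by (rule finite_subset) auto

instance
  by standard (transfer, simp add: algebra_simps fun_eq_iff)+

end

abbreviation formal :: "'a \<Rightarrow> 'a \<Rightarrow>\<^sub>0 real" where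
  "formal g \<equiv> Poly_Mapping.single g 1"

definition linear_extension :: "('a \<Rightarrow> 'b) \<Rightarrow> ('a \<Rightarrow>\<^sub>0 real) \<Rightarrow> ('b \<Rightarrow>\<^sub>0 real)" where
  "linear_extension f x = (\<Sum>g\<in>Poly_Mapping.keys x. Poly_Mapping.lookup x g *\<^sub>R formal (f g))"


section \<open>Quotient spaces and their projective linear groups\<close>

text \<open>
  The vector space \<open>W / U\<close>, for \<open>U\<close> a subspace of \<open>W\<close>, as a HOL-Algebra module over the reals.
  Its vectors are the cosets \<open>x + U\<close>. The fields \<open>mult\<close> and \<open>one\<close>, which a \<open>module\<close> record
  inherits from \<open>ring\<close>, play no role.
\<close>

definition quotient_space :: "'a::real_vector set \<Rightarrow> 'a set \<Rightarrow> (real, 'a set) module" where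
  "quotient_space W U =
     \<lparr>carrier = (\<lambda>x. (+) x ` U) ` W,
      mult = undefined,
      one = undefined,
      zero = U,
      add = (\<lambda>X Y. {x + y |x y. x \<in> X \<and> y \<in> Y}),
      smult = (\<lambda>c X. {c *\<^sub>R x + u |x u. x \<in> X \<and> u \<in> U})\<rparr>"

definition GL :: "(real, 'v, 'm) module_scheme \<Rightarrow> ('v \<Rightarrow> 'v) monoid" where
  "GL V =
     \<lparr>carrier = {f \<in> carrier V \<rightarrow>\<^sub>E carrier V. bij_betw f (carrier V) (carrier V) \<and>
        (\<forall>v\<in>carrier V. \<forall>w\<in>carrier V. f (v \<oplus>\<^bsub>V\<^esub> w) = f v \<oplus>\<^bsub>V\<^esub> f w) \<and>
        (\<forall>c. \<forall>v\<in>carrier V. f (c \<odot>\<^bsub>V\<^esub> v) = c \<odot>\<^bsub>V\<^esub> f v)},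
      mult = (\<lambda>f g. compose (carrier V) f g),
      one = restrict id (carrier V)\<rparr>"

definition is_basis :: "(real, 'v, 'm) module_scheme \<Rightarrow> 'v set \<Rightarrow> bool" where
  "is_basis V B \<longleftrightarrow> finite B \<and> B \<subseteq> carrier V \<and>
     (\<forall>v\<in>carrier V. \<exists>!a. a \<in> extensional B \<and> v = (\<Oplus>\<^bsub>V\<^esub>b\<in>B. a b \<odot>\<^bsub>V\<^esub> b))"

definition coordinates :: "(real, 'v, 'm) module_scheme \<Rightarrow> 'v set \<Rightarrow> 'v \<Rightarrow> 'v \<Rightarrow> real" where
  "coordinates V B v = (THE a. a \<in> extensional B \<and> v = (\<Oplus>\<^bsub>V\<^esub>b\<in>B. a b \<odot>\<^bsub>V\<^esub> b))"

text \<open>The Leibniz formula in a basis; the value does not depend on the chosen basis.\<close>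

definition endo_det :: "(real, 'v, 'm) module_scheme \<Rightarrow> ('v \<Rightarrow> 'v) \<Rightarrow> real" where
  "endo_det V f = (let B = (SOME B. is_basis V B) in
     \<Sum>p | p permutes B. of_int (sign p) * (\<Prod>b\<in>B. coordinates V B (f b) (p b)))"

definition SL :: "(real, 'v, 'm) module_scheme \<Rightarrow> ('v \<Rightarrow> 'v) set" where
  "SL V = {f \<in> carrier (GL V). endo_det V f = 1}"

definition scalar_maps :: "(real, 'v, 'm) module_scheme \<Rightarrow> ('v \<Rightarrow> 'v) set" where
  "scalar_maps V = {restrict (\<lambda>v. c \<odot>\<^bsub>V\<^esub> v) (carrier V) |c. c \<noteq> 0}"

definition PGL :: "(real, 'v, 'm) module_scheme \<Rightarrow> ('v \<Rightarrow> 'v) set monoid" where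
  "PGL V = GL V Mod scalar_maps V"

definition proj_class :: "(real, 'v, 'm) module_scheme \<Rightarrow> ('v \<Rightarrow> 'v) \<Rightarrow> ('v \<Rightarrow> 'v) set" where
  "proj_class V f = scalar_maps V #>\<^bsub>GL V\<^esub> f"

definition PSL :: "(real, 'v, 'm) module_scheme \<Rightarrow> ('v \<Rightarrow> 'v) set set" where
  "PSL V = proj_class V ` SL V"


section \<open>Weighted planar graphs in a half-plane\<close>

text \<open>
  A weighted multigraph with marked boundary vertices. Boundary vertex \<open>j\<close> (counted from 1) is
  \<open>marks ! (j - 1)\<close>; a repeated entry of \<open>marks\<close> means that boundary vertices have been identified
  with each other, as happens under contraction. All other vertices are interior.
  An edge is the set of its end points (a singleton for a loop) together with its Potts weight.
\<close>

datatype wgraph =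
  WGraph (verts: "nat set") (marks: "nat list") (edges: "(nat set \<times> real) multiset")

definition map_vertices :: "(nat \<Rightarrow> nat) \<Rightarrow> wgraph \<Rightarrow> wgraph" where
  "map_vertices f G =
     WGraph (f ` verts G) (map f (marks G)) (image_mset (map_prod (image f) id) (edges G))"

definition identify :: "nat \<Rightarrow> nat \<Rightarrow> wgraph \<Rightarrow> wgraph" where
  "identify u v = map_vertices (id(v := u))"

text \<open>
  A graph is drawn in the closed upper half-plane with its boundary vertices on the real line, in
  increasing order, and its interior vertices above it. The edges, enumerated by \<open>es\<close>, are
  represented by simple arcs (simple closed curves for loops) \<open>\<gamma> i\<close> that meet each other and the
  vertices only at their end points.
\<close>

definition drawable_in_half_plane :: "nat \<Rightarrow> wgraph \<Rightarrow> bool" where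
  "drawable_in_half_plane n G \<longleftrightarrow>
     finite (verts G) \<and> length (marks G) = n \<and> distinct (marks G) \<and> set (marks G) \<subseteq> verts G \<and>
     (\<exists>(pos :: nat \<Rightarrow> complex) es \<gamma>.
        inj_on pos (verts G) \<and>
        (\<forall>i<n. Im (pos (marks G ! i)) = 0) \<and>
        (\<forall>i j. i < j \<and> j < n \<longrightarrow> Re (pos (marks G ! i)) < Re (pos (marks G ! j))) \<and>
        (\<forall>v \<in> verts G - set (marks G). Im (pos v) > 0) \<and>
        mset es = edges G \<and>
        (\<forall>i < length es.
           simple_path (\<gamma> i) \<and> path_image (\<gamma> i) \<subseteq> {z. Im z \<ge> 0} \<and>
           (\<exists>u\<in>verts G. \<exists>v\<in>verts G.
              fst (es ! i) = {u, v} \<and> pathstart (\<gamma> i) = pos u \<and> pathfinish (\<gamma> i) = pos v) \<and>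
           \<gamma> i ` {0<..<1} \<inter> pos ` verts G = {}) \<and>
        (\<forall>i < length es. \<forall>k < length es. i \<noteq> k \<longrightarrow>
           \<gamma> i ` {0<..<1} \<inter> \<gamma> k ` {0<..<1} = {}))"

text \<open>
  Contracting an edge between two boundary vertices identifies them, so the class of graphs on which
  the skein relations operate consists of the drawable graphs and their contractions.
\<close>

inductive half_plane_graph :: "nat \<Rightarrow> wgraph \<Rightarrow> bool" for n where
  drawn: "drawable_in_half_plane n G \<Longrightarrow> half_plane_graph n G"
| contraction: "half_plane_graph n (WGraph V m (add_mset ({u, v}, y) E))
    \<Longrightarrow> half_plane_graph n (identify u v (WGraph V m E))"


section \<open>The Potts skein space and the edge operators\<close>

text \<open>
  The first clause is the usual convention that only the graph, and not the names of its vertices,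
  matters; isotopic drawings in particular have isomorphic graphs.
\<close>

inductive_set skein_relators :: "real \<Rightarrow> nat \<Rightarrow> (wgraph \<Rightarrow>\<^sub>0 real) set" for q n where
  relabel: "half_plane_graph n G \<Longrightarrow> inj_on f (verts G)
    \<Longrightarrow> formal G - formal (map_vertices f G) \<in> skein_relators q n"
| edge: "half_plane_graph n (WGraph V m (add_mset ({u, v}, y) E))
    \<Longrightarrow> formal (WGraph V m (add_mset ({u, v}, y) E))
        - (formal (WGraph V m E) + (y - 1) *\<^sub>R formal (identify u v (WGraph V m E)))
        \<in> skein_relators q n"
| isolated: "half_plane_graph n (WGraph (insert v V) m E)
    \<Longrightarrow> v \<notin> V \<Longrightarrow> v \<notin> set m \<Longrightarrow> \<forall>e\<in>#E. v \<notin> fst e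
    \<Longrightarrow> formal (WGraph (insert v V) m E) - q *\<^sub>R formal (WGraph V m E) \<in> skein_relators q n"

definition skein_space :: "real \<Rightarrow> nat \<Rightarrow> (real, (wgraph \<Rightarrow>\<^sub>0 real) set) module" where
  "skein_space q n =
     quotient_space (span (formal ` {G. half_plane_graph n G})) (span (skein_relators q n))"

text \<open>The operator on the skein space induced by an operation on graphs.\<close>

definition induced_operator ::
    "real \<Rightarrow> nat \<Rightarrow> (wgraph \<Rightarrow> wgraph) \<Rightarrow> (wgraph \<Rightarrow>\<^sub>0 real) set \<Rightarrow> (wgraph \<Rightarrow>\<^sub>0 real) set" where
  "induced_operator q n f =
     (\<lambda>X \<in> carrier (skein_space q n).
        {linear_extension f x + r |x r. x \<in> X \<and> r \<in> span (skein_relators q n)})"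

definition adjoin_edge :: "nat \<Rightarrow> real \<Rightarrow> wgraph \<Rightarrow> wgraph" where
  "adjoin_edge j y G = WGraph (verts G) (marks G)
     (add_mset ({marks G ! (j - 1), marks G ! j}, y) (edges G))"

definition adjoin_boundary_vertex :: "nat \<Rightarrow> real \<Rightarrow> wgraph \<Rightarrow> wgraph" where
  "adjoin_boundary_vertex j y G = (let w = (LEAST w. w \<notin> verts G) in
     WGraph (insert w (verts G)) ((marks G)[j - 1 := w])
       (add_mset ({marks G ! (j - 1), w}, y) (edges G)))"

definition A_op ::
    "real \<Rightarrow> nat \<Rightarrow> nat \<Rightarrow> real \<Rightarrow> (wgraph \<Rightarrow>\<^sub>0 real) set \<Rightarrow> (wgraph \<Rightarrow>\<^sub>0 real) set" where
  "A_op q n j y = induced_operator q n (adjoin_edge j y)"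

text \<open>The Potts weight \<open>y\<close> dual to \<open>x\<close> is the solution of \<open>(x - 1) * (y - 1) = q\<close>.\<close>

definition B_op ::
    "real \<Rightarrow> nat \<Rightarrow> nat \<Rightarrow> real \<Rightarrow> (wgraph \<Rightarrow>\<^sub>0 real) set \<Rightarrow> (wgraph \<Rightarrow>\<^sub>0 real) set" where
  "B_op q n j x = induced_operator q n (adjoin_boundary_vertex j (1 + q / (x - 1)))"

definition edge_operators ::
    "real \<Rightarrow> nat \<Rightarrow> ((wgraph \<Rightarrow>\<^sub>0 real) set \<Rightarrow> (wgraph \<Rightarrow>\<^sub>0 real) set) set" where
  "edge_operators q n =
     {A_op q n j y |j y. 1 \<le> j \<and> j \<le> n - 1 \<and> y \<noteq> 1 \<and> A_op q n j y \<in> carrier (GL (skein_space q n))} \<union>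
     {B_op q n j x |j x. 1 \<le> j \<and> j \<le> n \<and> x \<noteq> 1 \<and> B_op q n j x \<in> carrier (GL (skein_space q n))}"

end

theory Submission
  imports Defs "Jordan_Normal_Form.Determinant" "HOL-Algebra.Bij"
begin

text \<open>
  Why the edge operators generate. On the skein space let \<open>D\<^sub>j\<close> detach the boundary vertex \<open>j\<close> and let
  \<open>J\<^sub>j\<close> merge \<open>j\<close> and \<open>j + 1\<close>. In the order \<open>D\<^sub>1 / q, J\<^sub>1, D\<^sub>2 / q, J\<^sub>2, \<dots>, D\<^sub>n / q\<close> these are
  \<open>2 n - 1\<close> projections \<open>P i\<close> that satisfy the Temperley-Lieb relations
  \<open>P i P (i \<plusminus> 1) P i = P i / q\<close>, distant ones commuting. Every edge operator is a scalar multiple of some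
  \<open>1 + t P i\<close>, and every \<open>1 + t P i\<close> with \<open>t \<noteq> - 1\<close> and \<open>t \<noteq> 0\<close> occurs. It is therefore enough that the group \<open>\<Gamma>\<close>
  generated by the elements \<open>1 + t P i\<close> acts on the skein space as a group that contains all
  transvections \<open>x \<mapsto> x + \<phi> x \<cdot> y\<close>, \<open>\<phi> y = 0\<close>: Gaussian elimination then gives all of \<open>SL\<close>.

  Since \<open>q \<ge> 4\<close>, the Jones-Wenzl recursion never divides by zero and yields projections \<open>F k\<close> that kill
  \<open>P 0, \<dots>, P (k - 1)\<close>. The differences \<open>F k - F (k + 1)\<close> and \<open>P k\<close> give rise to blocks of 2-by-2 matrices, and
  explicit words in \<open>1 + t P k\<close> and in diagonal elements found at the previous stages give,
  by induction on \<open>k\<close>, all elementary matrices of these blocks (\<open>tl_unit_group.unipotents_mem\<close>).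

  The projection \<open>F (n - 1)\<close> has rank at most one on the skein space and \<open>F n\<close> vanishes there. The reason is
  planarity: the blocks of a graph in the half-plane do not cross (two crossing paths would meet), the skein
  relations reduce every graph to a noncrossing partition, and every such partition is fixed by one of
  \<open>P 0, \<dots>, P (n - 2)\<close>, hence killed by \<open>F (n - 1)\<close>, except for the rainbow partition, which is
  fixed by \<open>P (n - 1)\<close>. The elementary matrices of the block of index \<open>n - 1\<close> are thus transvections.

  These spread to all vectors and functionals because the two-sided ideal generated by any \<open>F k\<close> with
  \<open>2 k \<le> 2 n - 1\<close> contains \<open>1\<close> (\<open>tl_ideal.one_mem_ideal\<close>). The proof shifts \<open>F k\<close> along the chain by
  conjugating with the elements \<open>1 + \<sigma> P i\<close>, where \<open>1 + \<sigma> + \<sigma>\<^sup>2 / q = 0\<close>, the braid generators; such a real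
  \<open>\<sigma>\<close> exists because \<open>q \<ge> 4\<close>. Applied to the functionals and to the vectors reached so far, this gives all
  transvections (\<open>tl_representation.transvection_mem\<close>).
\<close>

section \<open>Blocks of two-by-two matrices in an algebra\<close>

text \<open>
  Matrix units, up to the factor \<open>c\<close>: \<open>e\<close> and \<open>e'\<close> are the diagonal ones, \<open>u\<close> is the upper and \<open>v\<close> the
  lower off-diagonal one. The unit of the algebra may be larger than \<open>e + e'\<close>.
\<close>

locale matrix_block =
  fixes e e' u v :: "'a::real_algebra_1" and c :: real
  assumes c_nonzero: "c \<noteq> 0"
    and e_e: "e * e = e" and e'_e': "e' * e' = e'" and e_e': "e * e' = 0" and e'_e: "e' * e = 0"
    and e_u: "e * u = u" and u_e': "u * e' = u" and e'_v: "e' * v = v" and v_e: "v * e = v"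
    and u_v: "u * v = c *\<^sub>R e" and v_u: "v * u = c *\<^sub>R e'"
begin

lemma u_e: "u * e = 0"
  by (metis e'_e mult.assoc mult_zero_right u_e')

lemma e'_u: "e' * u = 0"
  by (metis e'_e e_u mult.assoc mult_zero_left)

lemma v_e': "v * e' = 0"
  by (metis e_e' mult.assoc mult_zero_right v_e)

lemma e_v: "e * v = 0"
  by (metis e_e' e'_v mult.assoc mult_zero_left)

lemma u_u: "u * u = 0"
  by (metis e'_u mult.assoc mult_zero_right u_e')

lemma v_v: "v * v = 0"
  by (metis e_v mult.assoc mult_zero_right v_e)

lemmas products = e_e e'_e' e_e' e'_e e_u u_e' e'_v v_e u_v v_u u_e e'_u v_e' e_v u_u v_v

text \<open>
  The matrix with off-diagonal entries \<open>a\<close> and \<open>- 1 / a\<close> (after rescaling \<open>v\<close>), extended by the identity;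
  it exchanges \<open>e\<close> and \<open>e'\<close> by conjugation, while \<open>torus a\<close> below is the diagonal matrix with entries \<open>a, 1 / a\<close>.
\<close>

definition weyl :: "real \<Rightarrow> 'a" where
  "weyl a = 1 - e - e' + a *\<^sub>R u - (1 / (a * c)) *\<^sub>R v"

definition torus :: "real \<Rightarrow> 'a" where
  "torus a = 1 + (a - 1) *\<^sub>R e + (1 / a - 1) *\<^sub>R e'"

lemma weyl_factors:
  assumes "a \<noteq> 0"
  shows "(1 + a *\<^sub>R u) * (1 + (- 1 / (a * c)) *\<^sub>R v) * (1 + a *\<^sub>R u) = weyl a"
  using assms c_nonzero by (simp add: weyl_def algebra_simps products)

lemma torus_factors: "a \<noteq> 0 \<Longrightarrow> weyl a * weyl (- 1) = torus a"
  using c_nonzero by (simp add: weyl_def torus_def algebra_simps products)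

lemma weyl_inverse: "weyl 1 * weyl (- 1) = 1" "weyl (- 1) * weyl 1 = 1"
  using c_nonzero by (simp_all add: weyl_def algebra_simps products)

lemma weyl_conj: "weyl 1 * e * weyl (- 1) = e'"
  using c_nonzero by (simp add: weyl_def algebra_simps products)

end

locale unit_group =
  fixes \<Gamma> :: "'a::real_algebra_1 set"
  assumes one_mem: "1 \<in> \<Gamma>"
    and mult_mem: "g \<in> \<Gamma> \<Longrightarrow> h \<in> \<Gamma> \<Longrightarrow> g * h \<in> \<Gamma>"
    and inverse_mem: "g \<in> \<Gamma> \<Longrightarrow> \<exists>h\<in>\<Gamma>. g * h = 1 \<and> h * g = 1"
begin

end

section \<open>Jones-Wenzl projections\<close>

text \<open>
  In quantum integers with \<open>[2]\<^sup>2 = q\<close> this is \<open>[k + 2] / ([2] [k + 1])\<close>. As \<open>q \<ge> 4\<close>, the map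
  \<open>x \<mapsto> 1 - 1 / (q x)\<close> preserves the interval from \<open>1 / 2\<close> to \<open>1\<close>, so no ratio vanishes.
\<close>

primrec jw_ratio :: "real \<Rightarrow> nat \<Rightarrow> real" where
  "jw_ratio q 0 = 1"
| "jw_ratio q (Suc k) = 1 - 1 / (q * jw_ratio q k)"

lemma jw_ratio_bounds:
  assumes "q \<ge> 4"
  shows "1 / 2 < jw_ratio q k" "jw_ratio q k \<le> 1" "jw_ratio q (Suc k) < 1"
proof -
  have *: "1 / 2 < jw_ratio q k \<and> jw_ratio q k \<le> 1" for k
  proof (induction k)
    case (Suc k)
    then have "q * jw_ratio q k > 2"
      using assms mult_le_less_imp_less[of 4 q "1/2" "jw_ratio q k"] by linarith
    then have "0 < 1 / (q * jw_ratio q k)" "1 / (q * jw_ratio q k) < 1 / 2"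
      by (simp_all add: field_simps)
    then show ?case by simp
  qed simp
  show "1 / 2 < jw_ratio q k" "jw_ratio q k \<le> 1" using * by auto
  show "jw_ratio q (Suc k) < 1" using *[of k] assms by simp
qed

primrec jones_wenzl :: "real \<Rightarrow> (nat \<Rightarrow> 'a::real_algebra_1) \<Rightarrow> nat \<Rightarrow> 'a" where
  "jones_wenzl q P 0 = 1"
| "jones_wenzl q P (Suc k) = jones_wenzl q P k
     - (1 / jw_ratio q k) *\<^sub>R (jones_wenzl q P k * P k * jones_wenzl q P k)"

lemma jones_wenzl_intertwine:
  "(\<And>i. i < k \<Longrightarrow> x * P i = P' i * x) \<Longrightarrow> x * jones_wenzl q P k = jones_wenzl q P' k * x"
proof (induction k)
  case (Suc k)
  define F where "F = jones_wenzl q P k"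
  define F' where "F' = jones_wenzl q P' k"
  have F: "x * F = F' * x" unfolding F_def F'_def using Suc by simp
  have "x * (F * P k * F) = F' * P' k * F' * x"
    by (metis F Suc.prems lessI mult.assoc)
  then show ?case
    by (simp add: distrib_left distrib_right left_diff_distrib right_diff_distrib F
        F_def[symmetric] F'_def[symmetric] mult.assoc[symmetric])
qed simp

locale temperley_lieb =
  fixes P :: "nat \<Rightarrow> 'a::real_algebra_1" and q :: real and M :: nat
  assumes q4: "q \<ge> 4"
    and idem: "i < M \<Longrightarrow> P i * P i = P i"
    and braid_up: "Suc i < M \<Longrightarrow> P i * P (Suc i) * P i = (1 / q) *\<^sub>R P i"
    and braid_down: "Suc i < M \<Longrightarrow> P (Suc i) * P i * P (Suc i) = (1 / q) *\<^sub>R P (Suc i)"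
    and far: "Suc i < j \<Longrightarrow> j < M \<Longrightarrow> P i * P j = P j * P i"
begin

abbreviation F where "F \<equiv> jones_wenzl q P"
abbreviation l where "l \<equiv> jw_ratio q"

lemma l_nz: "l k \<noteq> 0"
  using jw_ratio_bounds(1)[OF q4, of k] by auto

lemma P_F_commute: "k < j \<Longrightarrow> j < M \<Longrightarrow> P j * F k = F k * P j"
  by (rule jones_wenzl_intertwine) (metis Suc_lessI far le_less_trans less_imp_le not_less_eq)

lemma F_properties:
  "k \<le> M \<Longrightarrow> F k * F k = F k \<and> (\<forall>i<k. P i * F k = 0 \<and> F k * P i = 0) \<and>
     F (k - 1) * F k = F k \<and> F k * F (k - 1) = F k \<and>
     (k < M \<longrightarrow> P k * F k * P k = l k *\<^sub>R (P k * F (k - 1)))"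
proof (induction k)
  case 0
  then show ?case using idem by simp
next
  case (Suc k)
  let ?F = "F k" and ?P = "P k" and ?c = "1 / l k"
  have FF: "?F * ?F = ?F" and kill: "\<And>i. i < k \<Longrightarrow> P i * ?F = 0" "\<And>i. i < k \<Longrightarrow> ?F * P i = 0"
    and F1: "F (k - 1) * ?F = ?F" and PFP: "?P * ?F * ?P = l k *\<^sub>R (?P * F (k - 1))"
    using Suc by auto
  note nz = l_nz[of k]
  have FF': "?F * (?F * x) = ?F * x" for x by (simp add: FF mult.assoc[symmetric])
  have G: "F (Suc k) = ?F - ?c *\<^sub>R (?F * ?P * ?F)" by simp
  have PFPF: "?P * ?F * ?P * ?F = l k *\<^sub>R (?P * ?F)"
  proof -
    have "?P * ?F * ?P * ?F = l k *\<^sub>R (?P * F (k - 1)) * ?F" by (simp only: PFP)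
    then show ?thesis by (simp only: mult_scaleR_left mult.assoc F1)
  qed
  have FPFP: "?F * ?P * ?F * ?P = l k *\<^sub>R (?F * ?P)"
  proof (cases k)
    case (Suc j)
    have "?P * F (k - 1) = F (k - 1) * ?P"
      using P_F_commute[of "k - 1" k] Suc \<open>Suc k \<le> M\<close> by (simp del: jones_wenzl.simps)
    then have "?F * (?P * ?F * ?P) = l k *\<^sub>R (?F * (F (k - 1) * ?P))"
      by (simp only: PFP mult_scaleR_right)
    moreover have "?F * F (k - 1) = ?F" using Suc.IH Suc.prems by simp
    ultimately show ?thesis by (metis mult.assoc)
  qed (use idem Suc.prems in simp)
  have GF: "F (Suc k) * ?F = F (Suc k)" "?F * F (Suc k) = F (Suc k)"
    unfolding G by (simp_all add: algebra_simps FF FF')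
  have top: "?P * F (Suc k) = 0" "F (Suc k) * ?P = 0"
    unfolding G using nz PFPF FPFP by (simp_all add: algebra_simps)
  have low: "P i * F (Suc k) = 0 \<and> F (Suc k) * P i = 0" if "i < k" for i
    unfolding G using kill[OF that] 
    by (simp add: left_diff_distrib right_diff_distrib mult.assoc[symmetric])
      (simp add: mult.assoc)
  have idemG: "F (Suc k) * F (Suc k) = F (Suc k)"
  proof -
    have "F (Suc k) * F (Suc k) = F (Suc k) * ?F - ?c *\<^sub>R (F (Suc k) * ?F * ?P * ?F)"
      by (subst (2) G) (simp add: algebra_simps)
    also have "\<dots> = F (Suc k)" by (simp only: GF top) simp
    finally show ?thesis .
  qed
  have PFP': "P (Suc k) * F (Suc k) * P (Suc k) = l (Suc k) *\<^sub>R (P (Suc k) * ?F)"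
    if "Suc k < M"
  proof -
    let ?R = "P (Suc k)"
    have c: "?R * ?F = ?F * ?R" using P_F_commute[of k "Suc k"] that by simp
    have "?R * (?F * ?P * ?F) * ?R = ?F * (?R * ?P * ?R) * ?F"
      by (metis c mult.assoc)
    also have "\<dots> = (1 / q) *\<^sub>R (?F * ?R * ?F)" by (simp add: braid_down that)
    also have "?F * ?R * ?F = ?R * ?F" by (metis c FF mult.assoc)
    finally have 1: "?R * (?F * ?P * ?F) * ?R = (1 / q) *\<^sub>R (?R * ?F)" .
    have 2: "?R * ?F * ?R = ?R * ?F" by (metis c idem mult.assoc that)
    have "?R * F (Suc k) * ?R = ?R * ?F * ?R - ?c *\<^sub>R (?R * (?F * ?P * ?F) * ?R)"
      unfolding G by (simp add: algebra_simps)
    also have "\<dots> = l (Suc k) *\<^sub>R (?R * ?F)"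
      unfolding 1 2 by (simp add: algebra_simps)
    finally show ?thesis .
  qed
  show ?case
    using idemG top low GF PFP' by (auto simp: less_Suc_eq simp del: jones_wenzl.simps jw_ratio.simps)
qed

lemma F_idem: "k \<le> M \<Longrightarrow> F k * F k = F k"
  and P_F: "i < k \<Longrightarrow> k \<le> M \<Longrightarrow> P i * F k = 0"
  and F_P: "i < k \<Longrightarrow> k \<le> M \<Longrightarrow> F k * P i = 0"
  and PFP: "k < M \<Longrightarrow> P k * F k * P k = l k *\<^sub>R (P k * F (k - 1))"
  using F_properties[of k] by auto

lemma FPF: "F k * P k * F k = l k *\<^sub>R (F k - F (Suc k))"
  using l_nz[of k] by simp

lemma F_F: "j \<le> k \<Longrightarrow> k \<le> M \<Longrightarrow> F j * F k = F k \<and> F k * F j = F k"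
proof (induction k)
  case (Suc k)
  show ?case
  proof (cases "j = Suc k")
    case False
    then have "F j * F k = F k \<and> F k * F j = F k" using Suc by simp
    moreover have "F k * F (Suc k) = F (Suc k) \<and> F (Suc k) * F k = F (Suc k)"
      using F_properties[of "Suc k"] Suc.prems by (simp del: jones_wenzl.simps)
    ultimately show ?thesis by (metis mult.assoc)
  qed (use F_idem Suc.prems in \<open>simp del: jones_wenzl.simps\<close>)
qed simp

lemmas F_Suc [simp del] = jones_wenzl.simps(2)

text \<open>
  Compression by \<open>F k\<close> turns \<open>P k\<close> into \<open>l k\<close> times the projection \<open>p k\<close>. Together with the complementary
  compression of \<open>P k\<close> this gives the block of 2-by-2 matrices in which \<open>P k\<close>, restricted to the range of
  \<open>F (k - 1)\<close>, is the rank one projection with diagonal \<open>l k\<close>, \<open>1 - l k\<close> (\<open>P_decomp\<close>).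
\<close>

definition p where "p k = F k - F (Suc k)"
definition u where "u k = F k * P k * (1 - F k)"
definition v where "v k = (1 - F k) * P k * F k"
definition c where "c k = l k * (1 - l k)"
definition p' where "p' k = (1 / c k) *\<^sub>R (v k * u k)"

lemma FPF_p: "F k * P k * F k = l k *\<^sub>R p k"
  by (simp add: FPF p_def)

lemma c_nz: "1 \<le> k \<Longrightarrow> c k \<noteq> 0"
  using jw_ratio_bounds(3)[OF q4, of "k - 1"] l_nz[of k] by (cases k) (auto simp: c_def simp del: jw_ratio.simps)

lemma F_p: "k < M \<Longrightarrow> F k * p k = p k" and p_F: "k < M \<Longrightarrow> p k * F k = p k"
  using F_F[of k "Suc k"] F_idem[of k] by (simp_all add: p_def algebra_simps)

lemma p_p: "k < M \<Longrightarrow> p k * p k = p k"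
  using F_F[of k "Suc k"] F_idem[of k] F_idem[of "Suc k"] by (simp add: p_def algebra_simps)

lemma p_P: "k < M \<Longrightarrow> p k * P k = F k * P k" and P_p: "k < M \<Longrightarrow> P k * p k = P k * F k"
  using F_P[of k "Suc k"] P_F[of k "Suc k"] by (simp_all add: p_def algebra_simps)

lemma u_alt: "u k = F k * P k - l k *\<^sub>R p k" and v_alt: "v k = P k * F k - l k *\<^sub>R p k"
  unfolding u_def v_def FPF_p[symmetric] by (simp_all add: algebra_simps)

lemma u_v_p: "k < M \<Longrightarrow> u k * v k = c k *\<^sub>R p k"
proof -
  assume k: "k < M"
  have "(F k * P k) * (P k * F k) = l k *\<^sub>R p k"
    using idem[OF k] FPF_p[of k] by (metis mult.assoc)
  moreover have "F k * P k * p k = l k *\<^sub>R p k" using FPF_p P_p[OF k] by (metis mult.assoc)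
  moreover have "p k * (P k * F k) = l k *\<^sub>R p k" using FPF_p p_P[OF k] by (metis mult.assoc)
  ultimately show ?thesis
    unfolding u_alt v_alt c_def using p_p[OF k]
    by (simp add: left_diff_distrib right_diff_distrib scaleR_diff_left)
qed

lemma block: "1 \<le> k \<Longrightarrow> k < M \<Longrightarrow> matrix_block (p k) (p' k) (u k) (v k) (c k)"
proof -
  assume k: "1 \<le> k" "k < M"
  note FF = F_idem[OF less_imp_le[OF k(2)]] and c = c_nz[OF k(1)]
  have pu: "p k * u k = u k"
    unfolding u_def using k p_F p_P by (metis mult.assoc)
  have vp: "v k * p k = v k"
    unfolding v_def using k F_p P_p by (metis mult.assoc)
  have "p k * (1 - F k) = 0" "(1 - F k) * p k = 0"
    using p_F[OF k(2)] F_p[OF k(2)] by (simp_all add: algebra_simps)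
  then have pv: "p k * v k = 0" and up: "u k * p k = 0"
    unfolding v_def u_def by (simp_all add: mult.assoc) (simp add: mult.assoc[symmetric])
  note uv = u_v_p[OF k(2)]
  have uv': "u k * (v k * x) = c k *\<^sub>R (p k * x)" for x
    by (simp add: mult.assoc[symmetric] uv)
  have pv': "p k * (v k * x) = 0" for x
    by (simp add: mult.assoc[symmetric] pv)
  show ?thesis
    by unfold_locales (use c p_p[OF k(2)] in \<open>simp_all add: p'_def mult.assoc pu vp pv up uv uv' pv'\<close>)
qed

lemma F_v: "k < M \<Longrightarrow> F k * v k = 0" and u_F: "k < M \<Longrightarrow> u k * F k = 0"
  using F_idem[of k] unfolding v_def u_def 
  by (simp_all add: mult.assoc[symmetric] right_diff_distrib) (simp add: mult.assoc left_diff_distrib)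

lemma F_p': "k < M \<Longrightarrow> F k * p' k = 0" and p'_F: "k < M \<Longrightarrow> p' k * F k = 0"
  using F_v[of k] u_F[of k] unfolding p'_def
  by (simp_all add: mult.assoc[symmetric]) (simp add: mult.assoc)

lemma u_F': assumes "1 \<le> k" "k < M" shows "u k * F (k - 1) = u k" "F (k - 1) * u k = u k"
  "v k * F (k - 1) = v k" "F (k - 1) * v k = v k"
proof -
  have c: "P k * F (k - 1) = F (k - 1) * P k" using P_F_commute[of "k - 1" k] assms by simp
  have F: "F (k - 1) * F k = F k" "F k * F (k - 1) = F k" using F_F[of "k - 1" k] assms by auto
  have F': "F k * (F (k - 1) * x) = F k * x" "F (k - 1) * (F k * x) = F k * x" for x
    by (simp_all only: mult.assoc[symmetric] F)
  have c': "P k * (F (k - 1) * x) = F (k - 1) * (P k * x)" for x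
    by (simp only: mult.assoc[symmetric] c)
  have c'': "F (k - 1) * (P k * F k) = P k * F k" by (metis c F(1) mult.assoc)
  show "u k * F (k - 1) = u k" "F (k - 1) * u k = u k"
    "v k * F (k - 1) = v k" "F (k - 1) * v k = v k"
    unfolding u_def v_def 
    by (simp_all add: algebra_simps F F' c c' c'' del: One_nat_def)
qed

lemma p'_F': assumes "1 \<le> k" "k < M" shows "p' k * F (k - 1) = p' k" "F (k - 1) * p' k = p' k"
  using u_F'[OF assms] unfolding p'_def
  by (simp_all add: mult.assoc) (simp add: mult.assoc[symmetric])

lemma P_decomp: assumes "1 \<le> k" "k < M"
  shows "P k * F (k - 1) = l k *\<^sub>R p k + u k + v k + (1 - l k) *\<^sub>R p' k"
proof -
  define z where "z = F (k - 1)"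
  have c: "P k * z = z * P k" unfolding z_def using P_F_commute[of "k - 1" k] assms by simp
  have F: "z * F k = F k" "F k * z = F k" using F_F[of "k - 1" k] assms unfolding z_def by auto
  have "c k *\<^sub>R p' k = v k * u k" using c_nz[OF assms(1)] by (simp add: p'_def)
  also have "\<dots> = (1 - F k) * (P k * (F k * F k) * P k) * (1 - F k)"
    unfolding u_def v_def by (simp add: mult.assoc)
  also have "\<dots> = l k *\<^sub>R ((1 - F k) * (P k * z) * (1 - F k))"
    using PFP[OF assms(2)] F_idem[of k] assms z_def by simp
  finally have "c k *\<^sub>R p' k = l k *\<^sub>R ((1 - F k) * (P k * z) * (1 - F k))" .
  then have "(1 / l k) *\<^sub>R (c k *\<^sub>R p' k) = (1 / l k) *\<^sub>R (l k *\<^sub>R ((1 - F k) * (P k * z) * (1 - F k)))"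
    by simp
  then have 1: "(1 - l k) *\<^sub>R p' k = (1 - F k) * (P k * z) * (1 - F k)"
    using l_nz[of k] by (simp add: c_def)
  have 2: "F k * (z * x) = F k * x" "z * (F k * x) = F k * x" for x
    by (simp_all add: mult.assoc[symmetric] F)
  have 3: "P k * (z * x) = z * (P k * x)" for x
    by (simp add: mult.assoc[symmetric] c)
  have "z * (P k * F k) = P k * F k" by (metis c F(1) mult.assoc)
  moreover have "F k * (P k * F k) = l k *\<^sub>R p k" using FPF_p by (simp add: mult.assoc)
  ultimately show ?thesis
    unfolding 1 u_def v_def z_def[symmetric]
    by (simp add: algebra_simps F 2 c 3)
qed

lemma p'_commute: assumes "Suc k < j" "j < M"
  shows "P j * u k = u k * P j" "P j * v k = v k * P j" "P j * p' k = p' k * P j"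
proof -
  have c: "P j * F k = F k * P j" "P j * P k = P k * P j"
    using P_F_commute[of k j] far[of k j] assms by auto
  have c': "P j * (F k * x) = F k * (P j * x)" "P j * (P k * x) = P k * (P j * x)" for x
    by (simp_all add: mult.assoc[symmetric] c)
  show 1: "P j * u k = u k * P j" "P j * v k = v k * P j"
    unfolding u_def v_def by (simp_all add: algebra_simps c c')
  show "P j * p' k = p' k * P j"
    unfolding p'_def using 1 by (simp add: mult.assoc[symmetric]) (simp add: mult.assoc)
qed

section \<open>The ideal generated by a Jones-Wenzl projection\<close>

text \<open>
  A real root of \<open>1 + x + x\<^sup>2 / q\<close>, whose discriminant \<open>1 - 4 / q\<close> is nonnegative. With it the
  elements \<open>s i\<close> behave like the generators of a braid group acting on the Temperley-Lieb algebra.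
\<close>

definition sig :: real where "sig = (- 1 + sqrt (1 - 4 / q)) * q / 2"

lemma sig_eq: "1 + sig + sig * sig / q = 0" and sig_nz: "1 + sig \<noteq> 0"
proof -
  have "sqrt (1 - 4 / q) * sqrt (1 - 4 / q) = 1 - 4 / q" using q4 by simp
  then show 1: "1 + sig + sig * sig / q = 0" unfolding sig_def using q4
    by (simp add: field_simps)
  show "1 + sig \<noteq> 0"
  proof
    assume 2: "1 + sig = 0"
    then have "sig * sig / q = 0" using 1 by simp
    then show False using q4 2 by auto
  qed
qed

definition s where "s i = 1 + sig *\<^sub>R P i"
definition s' where "s' i = 1 - (sig / (1 + sig)) *\<^sub>R P i"

lemma s_s': "i < M \<Longrightarrow> s i * s' i = 1"
proof -
  assume "i < M"
  then have "s i * s' i = 1 + (sig - sig / (1 + sig) - sig * (sig / (1 + sig))) *\<^sub>R P i"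
    unfolding s_def s'_def by (simp add: algebra_simps idem)
  moreover have "sig - sig / (1 + sig) - sig * (sig / (1 + sig)) = 0"
    using sig_nz by (simp add: divide_simps) (simp add: algebra_simps)
  ultimately show ?thesis by simp
qed

text \<open>
  The coefficient of \<open>P i\<close> on the left is exactly the polynomial that \<open>sig\<close> annihilates.
\<close>

lemma s_s_P: assumes "Suc i < M" shows "s i * s (Suc i) * P i = P (Suc i) * (s i * s (Suc i))"
proof -
  have b: "P i * (P (Suc i) * P i) = (1 / q) *\<^sub>R P i"
    "P (Suc i) * (P i * P (Suc i)) = (1 / q) *\<^sub>R P (Suc i)"
    using braid_up[OF assms] braid_down[OF assms] by (simp_all add: mult.assoc)
  have "s i * s (Suc i) * P i
     = (1 + sig + sig * sig / q) *\<^sub>R P i + sig *\<^sub>R (P (Suc i) * P i)"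
    unfolding s_def using b(1) idem[of i] assms by (simp add: algebra_simps)
  also have "\<dots> = (1 + sig + sig * sig / q) *\<^sub>R P (Suc i) + sig *\<^sub>R (P (Suc i) * P i)"
    by (simp add: sig_eq)
  also have "\<dots> = P (Suc i) * (s i * s (Suc i))"
    unfolding s_def using b(2) idem[of "Suc i"] assms by (simp add: algebra_simps)
  finally show ?thesis .
qed

text \<open>
  The braid moving one strand across \<open>k\<close> others; conjugation by it shifts the generators by one place.
\<close>

primrec sweep :: "nat \<Rightarrow> nat \<Rightarrow> 'a" where
  "sweep a 0 = 1"
| "sweep a (Suc k) = sweep a k * s (a + k)"

lemma P_sweep_commute: "a + k < j \<Longrightarrow> j < M \<Longrightarrow> P j * sweep a k = sweep a k * P j"
proof (induction k)
  case (Suc k)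
  then have "P j * s (a + k) = s (a + k) * P j"
    using far[of "a + k" j] by (simp add: s_def algebra_simps)
  then show ?case using Suc by (simp add: mult.assoc[symmetric]) (simp add: mult.assoc)
qed simp

lemma sweep_shift: "Suc i < k \<Longrightarrow> a + k \<le> M \<Longrightarrow> sweep a k * P (a + i) = P (Suc (a + i)) * sweep a k"
proof (induction k)
  case (Suc k)
  show ?case
  proof (cases "Suc i = k")
    case False
    then have "s (a + k) * P (a + i) = P (a + i) * s (a + k)"
      using far[of "a + i" "a + k"] Suc.prems by (simp add: s_def algebra_simps)
    then show ?thesis using Suc False by (simp add: mult.assoc) (simp add: mult.assoc[symmetric])
  next
    case True
    then have "sweep a (Suc k) * P (a + i) = sweep a i * (s (a + i) * s (Suc (a + i)) * P (a + i))"
      by (auto simp: mult.assoc)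
    also have "\<dots> = sweep a i * P (Suc (a + i)) * (s (a + i) * s (Suc (a + i)))"
      using s_s_P[of "a + i"] Suc.prems True by (simp add: mult.assoc)
    also have "\<dots> = P (Suc (a + i)) * sweep a (Suc k)"
      using P_sweep_commute[of a i "Suc (a + i)"] Suc.prems True by (auto simp: mult.assoc[symmetric])
    finally show ?thesis .
  qed
qed simp

end

locale tl_ideal = temperley_lieb +
  fixes I :: "'a set"
  assumes I_add: "x \<in> I \<Longrightarrow> y \<in> I \<Longrightarrow> x + y \<in> I"
    and I_scale: "x \<in> I \<Longrightarrow> r *\<^sub>R x \<in> I"
    and I_left: "x \<in> I \<Longrightarrow> i < M \<Longrightarrow> P i * x \<in> I"
    and I_right: "x \<in> I \<Longrightarrow> i < M \<Longrightarrow> x * P i \<in> I"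
begin

lemma I_diff: "x \<in> I \<Longrightarrow> y \<in> I \<Longrightarrow> x - y \<in> I"
  using I_add[of x "(-1) *\<^sub>R y"] I_scale[of y "-1"] by simp

lemma JW_mult_mem: "\<forall>i<k. a + i < M \<Longrightarrow> x \<in> I \<Longrightarrow>
    jones_wenzl q (\<lambda>i. P (a + i)) k * x \<in> I \<and> x * jones_wenzl q (\<lambda>i. P (a + i)) k \<in> I"
proof (induction k arbitrary: x)
  case (Suc k)
  then have m: "y \<in> I \<Longrightarrow> jones_wenzl q (\<lambda>i. P (a + i)) k * y \<in> I"
      "y \<in> I \<Longrightarrow> y * jones_wenzl q (\<lambda>i. P (a + i)) k \<in> I" for y
    by simp_all
  have "a + k < M" using Suc.prems by simp
  then show ?case
    using Suc.prems(2)
    by (auto simp: F_Suc left_diff_distrib right_diff_distrib mult.assoc[symmetric]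
        intro!: I_diff I_scale m I_left I_right)
      (auto simp: mult.assoc intro!: I_diff I_scale m I_left I_right)
qed simp

lemma shift_mem:
  assumes x: "jones_wenzl q (\<lambda>i. P (a + i)) k \<in> I" and b: "a + Suc k \<le> M"
  shows "jones_wenzl q (\<lambda>i. P (Suc a + i)) k \<in> I"
proof -
  let ?S = "sweep a (Suc k)"
  have sI: "y \<in> I \<Longrightarrow> i < M \<Longrightarrow> s i * y \<in> I" "y \<in> I \<Longrightarrow> i < M \<Longrightarrow> y * s' i \<in> I" for y i
    by (auto simp: s_def s'_def algebra_simps intro!: I_add I_diff I_scale I_left I_right)
  have S: "\<exists>T. sweep a j * T = 1 \<and> (\<forall>y\<in>I. sweep a j * y \<in> I \<and> y * T \<in> I)" if "a + j \<le> M" for j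
    using that
  proof (induction j)
    case (Suc j)
    then obtain T where T: "sweep a j * T = 1" "\<forall>y\<in>I. sweep a j * y \<in> I \<and> y * T \<in> I" by auto
    have "sweep a j * s (a + j) * (s' (a + j) * T) = 1"
      using s_s'[of "a + j"] Suc.prems T by (metis add_Suc_right less_eq_Suc_le mult.assoc mult.right_neutral)
    moreover have "\<forall>y\<in>I. sweep a j * s (a + j) * y \<in> I \<and> y * (s' (a + j) * T) \<in> I"
      using T sI Suc.prems by (auto simp: mult.assoc) (metis less_eq_Suc_le mult.assoc)
    ultimately show ?case by auto
  qed (auto intro: exI[of _ 1])
  then obtain T where T: "?S * T = 1" "\<forall>y\<in>I. ?S * y \<in> I \<and> y * T \<in> I" using b by blast
  have "?S * jones_wenzl q (\<lambda>i. P (a + i)) k = jones_wenzl q (\<lambda>i. P (Suc a + i)) k * ?S"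
    by (rule jones_wenzl_intertwine) (use sweep_shift[of _ "Suc k" a] b in \<open>simp del: sweep.simps\<close>)
  then have "?S * jones_wenzl q (\<lambda>i. P (a + i)) k * T = jones_wenzl q (\<lambda>i. P (Suc a + i)) k"
    using T(1) by (metis mult.assoc mult.right_neutral)
  then show ?thesis using T(2) x by metis
qed

lemma jw_shift_mem:
  assumes "F k \<in> I" "a + k \<le> M"
  shows "jones_wenzl q (\<lambda>i. P (a + i)) k \<in> I"
  using assms(2) by (induction a) (use assms(1) shift_mem in auto)

text \<open>
  Expanding the Jones-Wenzl projection, every term but the first contains some \<open>P (a + i)\<close>.
\<close>

lemma jw_minus_1:
  assumes "\<forall>i<k. a + i < M" "\<forall>i<k. P (a + i) * y \<in> I" "0 \<in> I"
  shows "jones_wenzl q (\<lambda>i. P (a + i)) k * y - y \<in> I"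
  using assms
proof (induction k)
  case 0
  then show ?case by simp
next
  case (Suc k)
  let ?F = "jones_wenzl q (\<lambda>i. P (a + i)) k"
  have 1: "?F * y - y \<in> I" using Suc by simp
  have "P (a + k) * (?F * y - y) + P (a + k) * y \<in> I"
    using I_add[OF I_left[OF 1]] Suc.prems by simp
  then have "P (a + k) * (?F * y) \<in> I" by (simp add: algebra_simps)
  then have "?F * (P (a + k) * (?F * y)) \<in> I"
    using JW_mult_mem[of k a] Suc.prems by simp
  then have "(?F * y - y) - (1 / l k) *\<^sub>R (?F * (P (a + k) * (?F * y))) \<in> I"
    by (rule I_diff[OF 1 I_scale])
  then show ?case by (simp add: F_Suc algebra_simps)
qed

text \<open>
  From \<open>F (k + 1)\<close> in the ideal, sandwiching with \<open>P (k + 1)\<close> gives \<open>P (k + 1) * F k\<close>, and then the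
  Temperley-Lieb relations give \<open>P i * F k\<close> for every \<open>i > k\<close>. The shift of \<open>F (k + 1)\<close> to the places
  \<open>k + 1, \<dots>, 2 k + 1\<close> lies in the ideal too, and modulo the products just found it acts on \<open>F k\<close> as the identity.
  The bound on \<open>k\<close> makes room for this shift.
\<close>

lemma F_pred_mem:
  assumes "F (Suc k) \<in> I" "2 * Suc k \<le> M"
  shows "F k \<in> I"
proof -
  have i: "P (Suc (k + d)) * F k \<in> I" if "Suc (k + d) < M" for d
    using that
  proof (induction d)
    case 0
    have "P (Suc k) * F (Suc k) * P (Suc k) \<in> I"
      using assms 0 by (intro I_left I_right) auto
    then have "l (Suc k) *\<^sub>R (P (Suc k) * F k) \<in> I"
      using PFP[of "Suc k"] 0 by (simp del: jw_ratio.simps)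
    then have "(1 / l (Suc k)) *\<^sub>R (l (Suc k) *\<^sub>R (P (Suc k) * F k)) \<in> I" by (rule I_scale)
    then show ?case using l_nz[of "Suc k"] by (simp del: jw_ratio.simps)
  next
    case (Suc d)
    let ?i = "Suc (k + d)"
    have "P (Suc ?i) * (P ?i * F k) * P (Suc ?i) \<in> I" 
      using I_right[OF I_left[OF Suc.IH]] Suc.prems by simp
    also have "P (Suc ?i) * (P ?i * F k) * P (Suc ?i) = P (Suc ?i) * P ?i * P (Suc ?i) * F k"
      using P_F_commute[of k "Suc ?i"] Suc.prems by (simp add: mult.assoc)
    also have "\<dots> = (1 / q) *\<^sub>R (P (Suc ?i) * F k)"
      using braid_down[of ?i] Suc.prems by simp
    finally have "q *\<^sub>R ((1 / q) *\<^sub>R (P (Suc ?i) * F k)) \<in> I" by (rule I_scale)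
    then show ?case using q4 by simp
  qed
  let ?G = "jones_wenzl q (\<lambda>i. P (Suc k + i)) (Suc k)"
  have "?G \<in> I" using jw_shift_mem[OF assms(1), of "Suc k"] assms(2) by simp
  then have "?G * F k \<in> I"
    using JW_mult_mem[of k 0 ?G] assms(2) by simp
  moreover have "?G * F k - F k \<in> I"
    by (rule jw_minus_1) (use i assms(2) I_scale[OF assms(1), of 0] in auto)
  ultimately have "?G * F k - (?G * F k - F k) \<in> I" by (rule I_diff)
  then show ?thesis by simp
qed

lemma one_mem_ideal: "F k \<in> I \<Longrightarrow> 2 * k \<le> M \<Longrightarrow> 1 \<in> I"
proof (induction k)
  case (Suc k)
  then show ?case using F_pred_mem[of k] by simp
qed simp

end

section \<open>Unipotent elements in the group generated by the projections\<close>

text \<open>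
  A matrix block with two further orthogonal idempotents, on which the elements used below act by scalars.
\<close>

locale matrix_block_sum = matrix_block +
  fixes f h :: 'a
  assumes f_f: "f * f = f" and h_h: "h * h = h" and f_h: "f * h = 0" and h_f: "h * f = 0"
    and f_e: "f * e = 0" and e_f: "e * f = 0" and f_e': "f * e' = 0" and e'_f: "e' * f = 0"
    and h_e: "h * e = 0" and e_h: "e * h = 0" and h_e': "h * e' = 0" and e'_h: "e' * h = 0"
begin

lemma f_u: "f * u = 0" and u_f: "u * f = 0" and f_v: "f * v = 0" and v_f: "v * f = 0"
  and h_u: "h * u = 0" and u_h: "u * h = 0" and h_v: "h * v = 0" and v_h: "v * h = 0"
  by (metis e_u u_e' e'_v v_e f_e e_f f_e' e'_f h_e e_h h_e' e'_h mult.assoc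
      mult_zero_left mult_zero_right)+

text \<open>
  The 2-by-2 matrix with rows \<open>(\<alpha>, \<beta>)\<close> and \<open>(\<gamma>, \<delta>)\<close> in the block, next to the scalars \<open>r\<close> and \<open>s\<close> on
  \<open>f\<close> and \<open>h\<close>.
\<close>

definition el :: "real \<Rightarrow> real \<Rightarrow> real \<Rightarrow> real \<Rightarrow> real \<Rightarrow> real \<Rightarrow> 'a" where
  "el \<alpha> \<beta> \<gamma> \<delta> r s = \<alpha> *\<^sub>R e + \<beta> *\<^sub>R u + \<gamma> *\<^sub>R v + \<delta> *\<^sub>R e' + r *\<^sub>R f + s *\<^sub>R h"

lemma el_mult:
  "el \<alpha> \<beta> \<gamma> \<delta> r s * el \<alpha>' \<beta>' \<gamma>' \<delta>' r' s' =
   el (\<alpha> * \<alpha>' + c * \<beta> * \<gamma>') (\<alpha> * \<beta>' + \<beta> * \<delta>') (\<gamma> * \<alpha>' + \<delta> * \<gamma>') (c * \<gamma> * \<beta>' + \<delta> * \<delta>') (r * r') (s * s')"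
  by (simp add: el_def algebra_simps products f_f h_h f_h h_f f_e e_f f_e' e'_f h_e e_h h_e' e'_h
      f_u u_f f_v v_f h_u u_h h_v v_h)

lemma el_add: "el \<alpha> \<beta> \<gamma> \<delta> r s + el \<alpha>' \<beta>' \<gamma>' \<delta>' r' s' =
  el (\<alpha> + \<alpha>') (\<beta> + \<beta>') (\<gamma> + \<gamma>') (\<delta> + \<delta>') (r + r') (s + s')"
  by (simp add: el_def algebra_simps)

lemma el_scale: "t *\<^sub>R el \<alpha> \<beta> \<gamma> \<delta> r s = el (t * \<alpha>) (t * \<beta>) (t * \<gamma>) (t * \<delta>) (t * r) (t * s)"
  by (simp add: el_def algebra_simps)

lemma el_u: "u = el 0 1 0 0 0 0" and el_v: "v = el 0 0 1 0 0 0"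
  by (simp_all add: el_def)

end

context unit_group
begin

text \<open>
  The element \<open>U\<close> is the commutator of \<open>x\<close> and \<open>g\<close>; the hypothesis on \<open>N\<close> computes it on the corner \<open>z\<close> without
  inverting anything, and on a summand \<open>E\<close> where \<open>x\<close> is a scalar the commutator is trivial.
\<close>

lemma commutator_on_corner:
  assumes g: "g \<in> \<Gamma>" "g * z = z * g" and x: "x \<in> \<Gamma>" "x * z = z * x" and z: "z * z = z"
    and N: "N * (g * z) * (x * z) = (x * z) * (g * z)" "N * z = N"
  obtains U where "U \<in> \<Gamma>" "U * z = N" "z * U = U * z"
    "\<And>E r. g * E = E * g \<Longrightarrow> x * E = r *\<^sub>R E \<Longrightarrow> E * x = r *\<^sub>R E \<Longrightarrow> U * E = E \<and> E * U = E"
proof -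
  obtain K where K: "K \<in> \<Gamma>" "g * x * K = 1" "K * (g * x) = 1"
    using inverse_mem[OF mult_mem[OF g(1) x(1)]] by blast
  have K_comm: "K * w = w * K" if "g * w = w * g" "x * w = w * x" for w
  proof -
    have "K * w = K * w * (g * x * K)" by (simp add: K)
    also have "\<dots> = K * (g * x) * w * K" using that by (metis mult.assoc)
    finally show ?thesis by (simp add: K)
  qed
  let ?U = "x * g * K"
  have 1: "?U * z = N"
  proof -
    have "N * (g * z) * (x * z) = N * (g * x)"
      using g(2) x(2) z N(2) by (metis mult.assoc)
    moreover have "(x * z) * (g * z) = x * g * z"
      using g(2) x(2) z by (metis mult.assoc)
    ultimately have "N * (g * x) * K = x * g * z * K" using N(1) by simp
    then have "N = x * g * (z * K)" using K by (simp add: mult.assoc)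
    then show ?thesis using K_comm[OF g(2) x(2)] by (simp add: mult.assoc)
  qed
  have 2: "z * ?U = ?U * z" using K_comm[OF g(2) x(2)] g(2) x(2) by (metis mult.assoc)
  have 3: "?U * E = E \<and> E * ?U = E" if h: "g * E = E * g" "x * E = r *\<^sub>R E" "E * x = r *\<^sub>R E" for E r
  proof -
    have xE: "x * E = E * x" using h by simp
    note KE = K_comm[OF h(1) xE]
    have "?U * E = x * E * (g * K)" using KE h(1) by (metis mult.assoc)
    also have "\<dots> = g * (x * E) * K" using h(1,2) by (simp add: mult.assoc[symmetric])
    also have "\<dots> = g * x * K * E" using KE by (simp add: mult.assoc)
    finally have "?U * E = E" by (simp add: K)
    moreover have "E * ?U = ?U * E" using KE h(1) xE by (metis mult.assoc)
    ultimately show ?thesis by simp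
  qed
  show thesis
    by (rule that[of ?U]) (use 1 2 3 mult_mem g x K in auto)
qed

text \<open>
  \<open>U\<close> is known only on \<open>z\<close> and \<open>E\<close>. Its commutator with an \<open>x\<close> that is the identity on the remaining summand
  \<open>1 - z - E\<close> is trivial there whatever \<open>U\<close> does, and is trivial on \<open>E\<close>, where \<open>U\<close> is the identity; so it is a
  unipotent element supported on the corner.
\<close>

lemma isolate_corner:
  assumes U: "U \<in> \<Gamma>" "U * z = z + \<tau> *\<^sub>R s" "z * U = U * z" "U * E = E" "E * U = E"
    and z: "z * E = 0" "E * z = 0" "s * z = s" "z * s = s" "z * z = z" "E * E = E"
    and x: "x \<in> \<Gamma>" "x * z = z * x" "x * E = E * x" "x * (1 - z - E) = 1 - z - E" 
    and eq: "(z + \<rho> *\<^sub>R s) * (x * z) * (z + \<tau> *\<^sub>R s) = (z + \<tau> *\<^sub>R s) * (x * z)"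
  shows "1 + \<rho> *\<^sub>R s \<in> \<Gamma>"
proof -
  obtain K where K: "K \<in> \<Gamma>" "x * U * K = 1"
    using inverse_mem[OF mult_mem[OF x(1) U(1)]] by blast
  let ?f = "1 - z - E" and ?R = "1 + \<rho> *\<^sub>R s"
  have sE: "s * E = 0" using z by (metis mult.assoc mult_zero_right)
  have Rz: "?R * z = z + \<rho> *\<^sub>R s" using z by (simp add: algebra_simps)
  have RE: "?R * E = E" using sE by (simp add: algebra_simps)
  have Rf: "?R * ?f = ?f" using sE z by (simp add: algebra_simps)
  have Uf: "U * ?f = ?f * U" using U by (simp add: algebra_simps)
  have "?R * (x * U) * z = U * x * z"
  proof -
    have "?R * (x * U) * z = (?R * z) * (x * z) * (U * z)"
      using U(3) x(2) z(5) by (metis mult.assoc)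
    also have "\<dots> = (U * z) * (x * z)" using eq Rz U(2) by simp
    also have "\<dots> = U * x * z" using x(2) z(5) by (metis mult.assoc)
    finally show ?thesis .
  qed
  moreover have "?R * (x * U) * E = U * x * E"
    using U(4) x(3) RE by (metis mult.assoc)
  moreover have "?R * (x * U) * ?f = U * x * ?f"
    using Uf x(4) Rf by (metis mult.assoc)
  ultimately have "?R * (x * U) * z + ?R * (x * U) * E + ?R * (x * U) * ?f
     = U * x * z + U * x * E + U * x * ?f" by simp
  then have "?R * (x * U) = U * x" by (simp add: algebra_simps)
  then have "?R = U * x * K" using K by (metis mult.assoc mult.right_neutral)
  then show ?thesis using mult_mem U x K by auto
qed

text \<open>
  The single missing value \<open>t = \<tau>\<close> is reached by squaring \<open>t = \<tau> / 2\<close>.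
\<close>

lemma one_parameter_mem:
  assumes s: "s * s = 0" and \<tau>: "\<tau> \<noteq> 0" and mem: "\<And>a. a \<noteq> 0 \<Longrightarrow> 1 + (\<tau> * (1 - a)) *\<^sub>R s \<in> \<Gamma>"
  shows "1 + t *\<^sub>R s \<in> \<Gamma>"
proof -
  have 1: "1 + t *\<^sub>R s \<in> \<Gamma>" if "t \<noteq> \<tau>" for t
    using mem[of "1 - t / \<tau>"] that \<tau> by simp
  have "(1 + (\<tau> / 2) *\<^sub>R s) * (1 + (\<tau> / 2) *\<^sub>R s) = 1 + \<tau> *\<^sub>R s"
    using s by (simp add: algebra_simps scaleR_add_left[symmetric] del: scaleR_left_distrib)
  then show ?thesis using 1[of "\<tau> / 2"] 1[of t] mult_mem \<tau> by (cases "t = \<tau>") force+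
qed

end

text \<open>
  The situation of one inductive step. On the corner \<open>z\<close> the projection \<open>P\<close> is of rank one with diagonal
  \<open>l, 1 - l\<close>, and \<open>x a\<close>, \<open>x' a\<close> are diagonal. Outside \<open>z\<close> the behaviour of \<open>x\<close> and \<open>x'\<close> differs: \<open>x\<close> is a scalar
  on \<open>E\<close>, and \<open>x'\<close> moves nothing but \<open>z\<close> and \<open>E\<close>.
\<close>

locale block_group = matrix_block_sum e e' u v c f h + unit_group \<Gamma>
  for e e' u v :: "'a::real_algebra_1" and c f h \<Gamma> +
  fixes z P :: 'a and l :: real and x x' :: "real \<Rightarrow> 'a" and E :: 'a and r :: "real \<Rightarrow> real"
  assumes l: "1 / 2 < l" "l < 1" "c = l * (1 - l)"
    and z: "z = el 1 0 0 1 1 1"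
    and P: "P * z = z * P" "P * z = el l 1 1 (1 - l) 0 0"
    and y_mem: "t \<noteq> - 1 \<Longrightarrow> 1 + t *\<^sub>R P \<in> \<Gamma>"
    and x: "a \<noteq> 0 \<Longrightarrow> x a \<in> \<Gamma>" "a \<noteq> 0 \<Longrightarrow> x a * z = z * x a" "a \<noteq> 0 \<Longrightarrow> x a * z = el 1 0 0 a 1 a"
    and x': "a \<noteq> 0 \<Longrightarrow> x' a \<in> \<Gamma>" "a \<noteq> 0 \<Longrightarrow> x' a * z = z * x' a" "a \<noteq> 0 \<Longrightarrow> x' a * z = el 1 0 0 a 1 a"
      "a \<noteq> 0 \<Longrightarrow> x' a * E = E * x' a" "a \<noteq> 0 \<Longrightarrow> x' a * (1 - z - E) = 1 - z - E"
    and E: "E * E = E" "E * z = 0" "z * E = 0" "P * E = E * P"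
      "a \<noteq> 0 \<Longrightarrow> x a * E = r a *\<^sub>R E" "a \<noteq> 0 \<Longrightarrow> E * x a = r a *\<^sub>R E"
begin

lemma y_z: "(1 + t *\<^sub>R P) * z = el (1 + t * l) t t (1 + t * (1 - l)) 1 1"
  unfolding distrib_right mult_scaleR_left P(2) el_scale by (simp add: z el_add)

lemma z_z: "z * z = z"
  by (simp add: z el_mult)

lemma y_commute: "(1 + t *\<^sub>R P) * z = z * (1 + t *\<^sub>R P)" "(1 + t *\<^sub>R P) * E = E * (1 + t *\<^sub>R P)"
  using P(1) E(4) by (simp_all add: algebra_simps)

lemma word_z:
  assumes "a \<noteq> 0"
  shows "(1 + t *\<^sub>R P) * x a * (1 + s *\<^sub>R P) * z =
    el (1 + t * l) t t (1 + t * (1 - l)) 1 1 * el 1 0 0 a 1 a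
      * el (1 + s * l) s s (1 + s * (1 - l)) 1 1"
  unfolding y_z[symmetric] x(3)[OF assms, symmetric]
  using y_commute x(2)[OF assms] z_z by (metis mult.assoc)

lemma word_commute:
  assumes "a \<noteq> 0"
  shows "(1 + t *\<^sub>R P) * x a * (1 + s *\<^sub>R P) * z = z * ((1 + t *\<^sub>R P) * x a * (1 + s *\<^sub>R P))"
    "(1 + t *\<^sub>R P) * x a * (1 + s *\<^sub>R P) * E = E * ((1 + t *\<^sub>R P) * x a * (1 + s *\<^sub>R P))"
  using y_commute[of t] y_commute[of s] x(2)[OF assms] E(5,6)[OF assms] by (metis mult.assoc)+

lemma unipotents: "1 + t *\<^sub>R u \<in> \<Gamma>" "1 + t *\<^sub>R v \<in> \<Gamma>"
proof -
  (* This value of a makes the lower left entry of (1 + P) * x a * (1 + 2 P) vanish; the word is then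
     triangular on the corner, and its commutator with x 2 is unipotent. The reversed word gives v. *)
  define a where "a = - (1 + 2 * l) / (2 * (2 - l))"
  define B where "B = 5 / (2 * (2 - l))"
  define D :: real where "D = - 3 / 2"
  have a: "a \<noteq> 0" and B: "B \<noteq> 0" using l by (simp_all add: a_def B_def)
  have l2: "2 - l \<noteq> 0" using l by simp
  let ?g = "(1 + 1 *\<^sub>R P) * x a * (1 + 2 *\<^sub>R P)" and ?g' = "(1 + 2 *\<^sub>R P) * x a * (1 + 1 *\<^sub>R P)"
  have coeffs: "(1 + l) * (1 + 2 * l) + c * a * 2 = - 4 * a"
    "(1 + l) * 2 + a * (1 + 2 * (1 - l)) = B" "1 + 2 * l + (1 + (1 - l)) * a * 2 = 0"
    "c * 2 + (1 + (1 - l)) * a * (1 + 2 * (1 - l)) = D"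
    using l2 unfolding a_def B_def D_def l(3) by (simp_all add: divide_simps) (simp_all add: algebra_simps)
  have g: "?g * z = el (- 4 * a) B 0 D 1 a"
    unfolding word_z[OF a] el_mult using coeffs by (simp add: algebra_simps)
  have g': "?g' * z = el (- 4 * a) 0 B D 1 a"
    unfolding word_z[OF a] el_mult using coeffs by (simp add: algebra_simps)
  have mem: "?g \<in> \<Gamma>" "?g' \<in> \<Gamma>" using y_mem[of 1] y_mem[of 2] x a by (auto intro!: mult_mem)
  have s: "u * u = 0" "v * v = 0" by (simp_all add: products)
  have sz: "u * z = u" "z * u = u" "v * z = v" "z * v = v"
    by (simp_all add: z el_def algebra_simps products f_u u_f f_v v_f h_u u_h h_v v_h)
  have "1 + t *\<^sub>R u \<in> \<Gamma>" for t
  proof -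
    define \<tau> where "\<tau> = - B / (2 * D)"
    have N: "z + \<tau> *\<^sub>R u = el 1 \<tau> 0 1 1 1"
      unfolding z by (subst el_u) (simp add: el_add el_scale)
    have N1: "(z + \<tau> *\<^sub>R u) * (?g * z) * (x 2 * z) = x 2 * z * (?g * z)"
      unfolding N g x(3)[of 2, simplified] el_mult by (simp add: \<tau>_def D_def mult.commute)
    have N2: "(z + \<tau> *\<^sub>R u) * z = z + \<tau> *\<^sub>R u"
      using z_z sz by (simp add: distrib_right)
    obtain U where U: "U \<in> \<Gamma>" "U * z = z + \<tau> *\<^sub>R u" "z * U = U * z"
      "\<And>E r. ?g * E = E * ?g \<Longrightarrow> x 2 * E = r *\<^sub>R E \<Longrightarrow> E * x 2 = r *\<^sub>R E \<Longrightarrow> U * E = E \<and> E * U = E"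
      using commutator_on_corner[OF mem(1) word_commute(1)[OF a] x(1) x(2) z_z N1 N2] by auto
    have UE: "U * E = E" "E * U = E" using U(4)[OF word_commute(2)[OF a] E(5,6)] by auto
    have "1 + (\<tau> * (1 - b)) *\<^sub>R u \<in> \<Gamma>" if b: "b \<noteq> 0" for b
    proof -
      define \<rho> where "\<rho> = \<tau> * (1 - b)"
      have b': "1 / b \<noteq> 0" using b by simp
      have R: "z + \<rho> *\<^sub>R u = el 1 \<rho> 0 1 1 1"
        unfolding z by (subst el_u) (simp add: el_add el_scale)
      have "(z + \<rho> *\<^sub>R u) * (x' (1 / b) * z) * (z + \<tau> *\<^sub>R u) = (z + \<tau> *\<^sub>R u) * (x' (1 / b) * z)"
        unfolding N R x'(3)[OF b'] el_mult using b by (simp add: \<rho>_def field_simps)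
      from isolate_corner[OF U(1-3) UE E(3,2) sz(1,2) z_z E(1) x'(1,2,4,5)[OF b'] this]
      show ?thesis by (simp add: \<rho>_def)
    qed
    then show ?thesis using one_parameter_mem[OF s(1), of \<tau>] B by (simp add: \<tau>_def D_def)
  qed
  then show "1 + t *\<^sub>R u \<in> \<Gamma>" .
  have "1 + t *\<^sub>R v \<in> \<Gamma>" for t
  proof -
    define \<tau> where "\<tau> = B / (- 4 * a)"
    have N: "z + \<tau> *\<^sub>R v = el 1 0 \<tau> 1 1 1"
      unfolding z by (subst el_v) (simp add: el_add el_scale)
    have N1: "(z + \<tau> *\<^sub>R v) * (?g' * z) * (x 2 * z) = x 2 * z * (?g' * z)"
      unfolding N g' x(3)[of 2, simplified] el_mult using a by (simp add: \<tau>_def mult.commute)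
    have N2: "(z + \<tau> *\<^sub>R v) * z = z + \<tau> *\<^sub>R v"
      using z_z sz by (simp add: distrib_right)
    obtain U where U: "U \<in> \<Gamma>" "U * z = z + \<tau> *\<^sub>R v" "z * U = U * z"
      "\<And>E r. ?g' * E = E * ?g' \<Longrightarrow> x 2 * E = r *\<^sub>R E \<Longrightarrow> E * x 2 = r *\<^sub>R E \<Longrightarrow> U * E = E \<and> E * U = E"
      using commutator_on_corner[OF mem(2) word_commute(1)[OF a] x(1) x(2) z_z N1 N2] by auto
    have UE: "U * E = E" "E * U = E" using U(4)[OF word_commute(2)[OF a] E(5,6)] by auto
    have "1 + (\<tau> * (1 - b)) *\<^sub>R v \<in> \<Gamma>" if b: "b \<noteq> 0" for b
    proof -
      define \<rho> where "\<rho> = \<tau> * (1 - b)"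
      have R: "z + \<rho> *\<^sub>R v = el 1 0 \<rho> 1 1 1"
        unfolding z by (subst el_v) (simp add: el_add el_scale)
      have "(z + \<rho> *\<^sub>R v) * (x' b * z) * (z + \<tau> *\<^sub>R v) = (z + \<tau> *\<^sub>R v) * (x' b * z)"
        unfolding N R x'(3)[OF b] el_mult using b by (simp add: \<rho>_def field_simps)
      from isolate_corner[OF U(1-3) UE E(3,2) sz(3,4) z_z E(1) x'(1,2,4,5)[OF b] this]
      show ?thesis by (simp add: \<rho>_def)
    qed
    then show ?thesis using one_parameter_mem[OF s(2), of \<tau>] B a by (simp add: \<tau>_def)
  qed
  then show "1 + t *\<^sub>R v \<in> \<Gamma>" .
qed

end

locale tl_unit_group = temperley_lieb + unit_group \<Gamma> for \<Gamma> +
  assumes gen_mem: "i < M \<Longrightarrow> t \<noteq> - 1 \<Longrightarrow> 1 + t *\<^sub>R P i \<in> \<Gamma>"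
begin

text \<open>
  On the range of \<open>F (k - 1)\<close> the hypotheses of \<open>block_group\<close> hold with the summands \<open>F (k + 1)\<close> and
  \<open>F (k - 1) - F k - p' k\<close>; the required diagonal elements come from earlier blocks.
\<close>

lemma chain_step:
  assumes k: "1 \<le> k" "k < M"
    and x: "\<And>a. a \<noteq> 0 \<Longrightarrow> x a \<in> \<Gamma>" "\<And>a. a \<noteq> 0 \<Longrightarrow> x a * F (k - 1) = F (k - 1) * x a"
      "\<And>a. a \<noteq> 0 \<Longrightarrow> x a * F (k - 1) = F k + a *\<^sub>R (F (k - 1) - F k)"
    and x': "\<And>a. a \<noteq> 0 \<Longrightarrow> x' a \<in> \<Gamma>" "\<And>a. a \<noteq> 0 \<Longrightarrow> x' a * F (k - 1) = F (k - 1) * x' a"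
      "\<And>a. a \<noteq> 0 \<Longrightarrow> x' a * F (k - 1) = F k + a *\<^sub>R (F (k - 1) - F k)"
      "\<And>a. a \<noteq> 0 \<Longrightarrow> x' a * E = E * x' a" "\<And>a. a \<noteq> 0 \<Longrightarrow> x' a * (1 - F (k - 1) - E) = 1 - F (k - 1) - E"
    and E: "E * E = E" "E * F (k - 1) = 0" "F (k - 1) * E = 0" "P k * E = E * P k"
      "\<And>a. a \<noteq> 0 \<Longrightarrow> x a * E = r a *\<^sub>R E" "\<And>a. a \<noteq> 0 \<Longrightarrow> E * x a = r a *\<^sub>R E"
  shows "1 + t *\<^sub>R u k \<in> \<Gamma> \<and> 1 + t *\<^sub>R v k \<in> \<Gamma>"
proof -
  define z where "z = F (k - 1)"
  define h where "h = z - F k - p' k"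
  note km = less_imp_le[OF k(2)]
  interpret b: matrix_block "p k" "p' k" "u k" "v k" "c k" by (rule block[OF k])
  have zF: "z * F k = F k" "F k * z = F k" "z * z = z" "z * F (Suc k) = F (Suc k)" "F (Suc k) * z = F (Suc k)"
    unfolding z_def using F_F[of "k - 1" k] F_F[of "k - 1" "Suc k"] F_idem[of "k - 1"] k by auto
  have FF: "F k * F (Suc k) = F (Suc k)" "F (Suc k) * F k = F (Suc k)" "F k * F k = F k" "F (Suc k) * F (Suc k) = F (Suc k)"
    using F_F[of k "Suc k"] F_idem[of k] F_idem[of "Suc k"] k by auto
  have zp': "p' k * z = p' k" "z * p' k = p' k" unfolding z_def using p'_F'[OF k] by auto
  have Fp': "F k * p' k = 0" "p' k * F k = 0" using F_p' p'_F k by auto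
  have GP': "F (Suc k) * p' k = 0" "p' k * F (Suc k) = 0"
    by (metis FF Fp' mult.assoc mult_zero_left mult_zero_right)+
  have zp: "z * p k = p k" "p k * z = p k" "F k * p k = p k" "p k * F k = p k"
    "p k * F (Suc k) = 0" "F (Suc k) * p k = 0"
    unfolding p_def by (simp_all add: algebra_simps zF FF)
  interpret b: matrix_block_sum "p k" "p' k" "u k" "v k" "c k" "F (Suc k)" h
    by unfold_locales
      (simp_all add: h_def algebra_simps zF FF zp' Fp' GP' zp b.products)
  have el: "b.el 1 0 0 a 1 a = F k + a *\<^sub>R (z - F k)" for a
    unfolding b.el_def by (simp add: h_def p_def algebra_simps)
  interpret b: block_group "p k" "p' k" "u k" "v k" "c k" "F (Suc k)" h \<Gamma> z "P k" "l k" x x' E r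
  proof
    show "1 / 2 < l k" by (rule jw_ratio_bounds[OF q4])
    show "l k < 1" using jw_ratio_bounds(3)[OF q4, of "k - 1"] k by simp
    show "c k = l k * (1 - l k)" by (rule c_def)
    show "z = b.el 1 0 0 1 1 1" using el[of 1] by simp
    show "P k * z = z * P k" unfolding z_def using P_F_commute[of "k - 1" k] k by simp
    show "P k * z = b.el (l k) 1 1 (1 - l k) 0 0"
      unfolding z_def P_decomp[OF k] b.el_def by simp
    show "1 + t *\<^sub>R P k \<in> \<Gamma>" if "t \<noteq> - 1" for t using gen_mem k that by simp
    show "x a * z = b.el 1 0 0 a 1 a" "x' a * z = b.el 1 0 0 a 1 a" if "a \<noteq> 0" for a
      using x(3)[OF that] x'(3)[OF that] unfolding el z_def by auto
  qed (use x x' E z_def in auto)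
  show ?thesis using b.unipotents by blast
qed

lemma weyl_torus_mem:
  assumes k: "1 \<le> k" "k < M" and mem: "\<And>t. 1 + t *\<^sub>R u k \<in> \<Gamma> \<and> 1 + t *\<^sub>R v k \<in> \<Gamma>" and a: "a \<noteq> 0"
  shows "matrix_block.weyl (p k) (p' k) (u k) (v k) (c k) a \<in> \<Gamma>"
    "matrix_block.torus (p k) (p' k) a \<in> \<Gamma>"
proof -
  interpret b: matrix_block "p k" "p' k" "u k" "v k" "c k" by (rule block[OF k])
  have w: "b.weyl a \<in> \<Gamma>" if "a \<noteq> 0" for a
    unfolding b.weyl_factors[OF that, symmetric]
    using mem[of a] mem[of "- 1 / (a * c k)"] by (intro mult_mem) auto
  show "b.weyl a \<in> \<Gamma>" by (rule w[OF a])
  show "b.torus a \<in> \<Gamma>" unfolding b.torus_factors[OF a, symmetric]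
    using w a by (intro mult_mem) auto
qed

lemma torus_F:
  assumes k: "Suc k < M" "1 \<le> k"
  shows "matrix_block.torus (p k) (p' k) a * F k = F (Suc k) + a *\<^sub>R (F k - F (Suc k))"
    "F k * matrix_block.torus (p k) (p' k) a = F (Suc k) + a *\<^sub>R (F k - F (Suc k))"
proof -
  interpret b: matrix_block "p k" "p' k" "u k" "v k" "c k" by (rule block) (use k in auto)
  show "b.torus a * F k = F (Suc k) + a *\<^sub>R (F k - F (Suc k))"
    "F k * b.torus a = F (Suc k) + a *\<^sub>R (F k - F (Suc k))"
    unfolding b.torus_def using F_p'[of k] p'_F[of k] F_p[of k] p_F[of k] k
    by (simp_all add: algebra_simps) (simp_all add: p_def algebra_simps)
qed

lemma F_1: "F 1 = 1 - P 0" if "0 < M"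
  by (simp add: F_Suc)

text \<open>
  Here \<open>F 0 = 1\<close>, so nothing lies outside the corner, and \<open>1 + (a - 1) P 0\<close> is diagonal.
\<close>

lemma unipotents_1: assumes "1 < M" shows "1 + t *\<^sub>R u 1 \<in> \<Gamma> \<and> 1 + t *\<^sub>R v 1 \<in> \<Gamma>"
proof -
  let ?x = "\<lambda>a. 1 + (a - 1) *\<^sub>R P 0"
  have mem: "?x a \<in> \<Gamma>" if "a \<noteq> 0" for a using gen_mem[of 0 "a - 1"] assms that by simp
  have F1: "F 1 = 1 - P 0" using F_1 assms by simp
  show ?thesis
  proof (rule chain_step[where x = ?x and x' = ?x and E = 0 and r = "\<lambda>_. 1"])
    show "?x a * F (1 - 1) = F 1 + a *\<^sub>R (F (1 - 1) - F 1)" for a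
      unfolding F1 by (simp add: algebra_simps)
    then show "?x a * F (1 - 1) = F 1 + a *\<^sub>R (F (1 - 1) - F 1)" for a .
  qed (use assms mem in auto)
qed

lemma p'_1: assumes "1 < M" shows "p' 1 = P 0"
proof -
  have F1: "F 1 = 1 - P 0" using F_1 assms by simp
  have "v 1 * u 1 = (1 - F 1) * (P 1 * (F 1 * F 1) * P 1) * (1 - F 1)"
    unfolding u_def v_def by (simp add: mult.assoc)
  also have "\<dots> = l 1 *\<^sub>R (P 0 * P 1 * P 0)"
    using PFP[of 1] F_idem[of 1] assms F1 by simp
  also have "\<dots> = (l 1 / q) *\<^sub>R P 0"
    using braid_up[of 0] assms by simp
  also have "l 1 / q = c 1" by (simp add: c_def)
  finally show ?thesis using c_nz[of 1] by (simp add: p'_def)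
qed

text \<open>
  The torus of the first block is diagonal on the range of \<open>F 1\<close>, and the summand outside the corner is
  \<open>P 0 = p' 1\<close>, where it is the scalar \<open>1 / a\<close>.
\<close>

lemma unipotents_2: assumes "2 < M" shows "1 + t *\<^sub>R u 2 \<in> \<Gamma> \<and> 1 + t *\<^sub>R v 2 \<in> \<Gamma>"
proof -
  interpret b: matrix_block "p 1" "p' 1" "u 1" "v 1" "c 1" by (rule block) (use assms in auto)
  have k: "Suc 1 < M" "2 - 1 = (1::nat)" using assms by auto
  have tF: "b.torus a * F 1 = F 2 + a *\<^sub>R (F 1 - F 2)" "F 1 * b.torus a = F 2 + a *\<^sub>R (F 1 - F 2)" for a
    using torus_F[of 1 a] k by (simp_all add: numeral_2_eq_2)
  have pp: "p' 1 = P 0" using p'_1 assms by simp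
  have F1: "F 1 = 1 - P 0" using F_1 assms by simp
  have PF: "P 0 * F 1 = 0" "F 1 * P 0 = 0" "P 0 * P 0 = P 0" using P_F[of 0 1] F_P[of 0 1] idem[of 0] assms by simp_all
  have tP: "b.torus a * P 0 = (1 / a) *\<^sub>R P 0" "P 0 * b.torus a = (1 / a) *\<^sub>R P 0" for a
    using b.e_e'[unfolded pp] b.e'_e[unfolded pp] PF(3)
    unfolding b.torus_def unfolding pp by (simp_all add: algebra_simps)
  show ?thesis
  proof (rule chain_step[where x = b.torus and x' = b.torus and E = "P 0" and r = "\<lambda>a. 1 / a"], unfold k)
    show "b.torus a \<in> \<Gamma>" if "a \<noteq> 0" for a
      by (rule weyl_torus_mem) (use assms unipotents_1 that in auto)
    then show "b.torus a \<in> \<Gamma>" if "a \<noteq> 0" for a using that .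
    show "P 2 * P 0 = P 0 * P 2" using far[of 0 2] assms by simp
    show "b.torus a * (1 - F 1 - P 0) = 1 - F 1 - P 0" for a unfolding F1 by simp
  qed (use assms tF tP PF in auto)
qed

text \<open>
  The torus of block \<open>k + 1\<close> is not trivial outside the range of \<open>F (k + 1)\<close>: it moves part of \<open>p k\<close>.
  Conjugation by the Weyl element of block \<open>k\<close> carries this part into \<open>E = p' k\<close>, on which the torus itself is the
  identity.
\<close>

lemma unipotents_step:
  assumes k: "Suc (Suc k) < M" "1 \<le> k"
    and m0: "\<And>t. 1 + t *\<^sub>R u k \<in> \<Gamma> \<and> 1 + t *\<^sub>R v k \<in> \<Gamma>"
    and m1: "\<And>t. 1 + t *\<^sub>R u (Suc k) \<in> \<Gamma> \<and> 1 + t *\<^sub>R v (Suc k) \<in> \<Gamma>"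
  shows "1 + t *\<^sub>R u (Suc (Suc k)) \<in> \<Gamma> \<and> 1 + t *\<^sub>R v (Suc (Suc k)) \<in> \<Gamma>"
proof -
  let ?k = "Suc (Suc k)"
  interpret b0: matrix_block "p k" "p' k" "u k" "v k" "c k" by (rule block) (use k in auto)
  interpret b1: matrix_block "p (Suc k)" "p' (Suc k)" "u (Suc k)" "v (Suc k)" "c (Suc k)"
    by (rule block) (use k in auto)
  let ?z = "F (Suc k)" and ?e = "p k" and ?E = "p' k" and ?w = "b0.weyl 1" and ?w' = "b0.weyl (- 1)"
  let ?x = b1.torus and ?x' = "\<lambda>a. ?w * b1.torus a * ?w'"
  have xz: "?x a * ?z = F ?k + a *\<^sub>R (?z - F ?k)" "?z * ?x a = F ?k + a *\<^sub>R (?z - F ?k)" for a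
    using torus_F[of "Suc k" a] k by auto
  have Fz: "F k * ?z = ?z" "?z * F k = ?z" "?z * ?z = ?z"
    using F_F[of k "Suc k"] F_idem[of "Suc k"] k by auto
  have Fb0: "F k * v k = 0" "u k * F k = 0" "F k * ?E = 0" "?E * F k = 0"
    using F_v[of k] u_F[of k] F_p'[of k] p'_F[of k] k by auto
  have zu: "u k * ?z = 0" "?z * v k = 0" "?z * ?E = 0" "?E * ?z = 0"
    by (metis Fb0 Fz mult.assoc mult_zero_left mult_zero_right)+
  have zP: "?z * P k = 0" "P k * ?z = 0" using F_P[of k "Suc k"] P_F[of k "Suc k"] k by auto
  have zu': "?z * u k = 0" "v k * ?z = 0"
    unfolding u_def v_def using zP Fz by (metis mult.assoc mult_zero_left mult_zero_right)+
  have ze: "?e * ?z = 0" "?z * ?e = 0" unfolding p_def using Fz by (simp_all add: algebra_simps)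
  have wz: "?w * ?z = ?z" "?z * ?w = ?z" "?w' * ?z = ?z" "?z * ?w' = ?z"
    unfolding b0.weyl_def by (simp_all add: algebra_simps zu zu' ze)
  have w: "?w * ?w' = 1" "?w' * ?w = 1" by (rule b0.weyl_inverse)+
  have pz: "p (Suc k) * ?z = p (Suc k)" "?z * p (Suc k) = p (Suc k)" using p_F[of "Suc k"] F_p[of "Suc k"] k by auto
  have pe: "p (Suc k) * ?e = 0" "?e * p (Suc k) = 0" "p (Suc k) * ?E = 0" "?E * p (Suc k) = 0"
    by (metis pz ze zu mult.assoc mult_zero_left mult_zero_right)+
  have p'F: "p' (Suc k) * F k = p' (Suc k)" "F k * p' (Suc k) = p' (Suc k)"
    using p'_F'[of "Suc k"] k by auto
  have p'z: "p' (Suc k) * ?z = 0" "?z * p' (Suc k) = 0" using p'_F[of "Suc k"] F_p'[of "Suc k"] k by auto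
  have p'e: "p' (Suc k) * ?e = p' (Suc k)" "?e * p' (Suc k) = p' (Suc k)"
    using p'F p'z by (simp_all add: p_def algebra_simps)
  have p'E: "p' (Suc k) * ?E = 0" "?E * p' (Suc k) = 0"
    by (metis p'F Fb0 mult.assoc mult_zero_left mult_zero_right)+
  have xE: "?x a * ?E = ?E" "?E * ?x a = ?E" for a
    unfolding b1.torus_def by (simp_all add: algebra_simps pe p'E)
  have xe: "?x a * ?e = ?e * ?x a" for a
    unfolding b1.torus_def by (simp add: algebra_simps pe p'e)
  have xf: "?x a * (1 - ?z - ?e) = 1 - ?z - ?e" for a
    unfolding b1.torus_def by (simp add: algebra_simps pe p'e p'z pz)
  have wf: "?w * (1 - ?z - ?e) * ?w' = 1 - ?z - ?E"
    using w(1) wz b0.weyl_conj by (simp add: algebra_simps)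
  have we: "?w * ?e * ?w' = ?E" by (rule b0.weyl_conj)
  have mem: "?w \<in> \<Gamma>" "?w' \<in> \<Gamma>" "a \<noteq> 0 \<Longrightarrow> ?x a \<in> \<Gamma>" for a
    by (rule weyl_torus_mem; use k m0 m1 in simp)+
  have cancel: "?w' * (?w * y) = y" for y by (simp add: mult.assoc[symmetric] w)
  have x'z: "?x' a * ?z = ?x a * ?z" "?z * ?x' a = ?x a * ?z" for a
  proof -
    have "?x' a * ?z = ?w * (?x a * ?z)" by (simp only: mult.assoc wz)
    also have "\<dots> = ?w * (?z * ?x a)" by (simp only: xz)
    also have "\<dots> = ?z * ?x a" by (simp only: wz flip: mult.assoc)
    finally show "?x' a * ?z = ?x a * ?z" by (simp only: xz)
    have "?z * ?x' a = ?z * ?x a * ?w'" by (simp only: wz flip: mult.assoc)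
    also have "\<dots> = ?x a * ?z * ?w'" by (simp only: xz)
    also have "\<dots> = ?x a * ?z" by (simp only: wz mult.assoc)
    finally show "?z * ?x' a = ?x a * ?z" .
  qed
  have conj: "(?w * y * ?w') * (?w * y' * ?w') = ?w * (y * y') * ?w'" for y y'
    by (simp add: mult.assoc cancel)
  have x'E: "?x' a * ?E = ?E * ?x' a" for a
  proof -
    have "?x' a * (?w * ?e * ?w') = (?w * ?e * ?w') * ?x' a" by (simp only: conj xe)
    then show ?thesis by (simp only: we)
  qed
  have x'f: "?x' a * (1 - ?z - ?E) = 1 - ?z - ?E" for a
  proof -
    have "?x' a * (?w * (1 - ?z - ?e) * ?w') = ?w * (1 - ?z - ?e) * ?w'" by (simp only: conj xf)
    then show ?thesis by (simp only: wf)
  qed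
  show ?thesis
  proof (rule chain_step[where x = ?x and x' = ?x' and E = ?E and r = "\<lambda>_. 1"], unfold diff_Suc_1)
    show "?x' a \<in> \<Gamma>" if "a \<noteq> 0" for a using mem that by (intro mult_mem) auto
    show "P ?k * ?E = ?E * P ?k" by (rule p'_commute) (use k in auto)
    show "?E * ?E = ?E" by (rule b0.e'_e')
  qed (use k mem xz x'z x'E x'f xE zu in auto)
qed

theorem unipotents_mem: "1 \<le> k \<Longrightarrow> k < M \<Longrightarrow> \<forall>t. 1 + t *\<^sub>R u k \<in> \<Gamma> \<and> 1 + t *\<^sub>R v k \<in> \<Gamma>"
proof (induction k rule: less_induct)
  case (less k)
  consider "k = 1" | "k = 2" | j where "k = Suc (Suc j)" "1 \<le> j"
    using less.prems by (metis One_nat_def Suc_1 Suc_le_D less_one not_less)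
  then show ?case
  proof cases
    case 3
    then show ?thesis using unipotents_step[of j] less by auto
  qed (use less unipotents_1 unipotents_2 in auto)
qed

end

section \<open>All transvections from one block\<close>

text \<open>
  A type of its own makes the linear maps an instance of \<open>real_algebra_1\<close>, to which the preceding results apply.
\<close>

typedef 'g endo = "{f :: ('g \<Rightarrow>\<^sub>0 real) \<Rightarrow> ('g \<Rightarrow>\<^sub>0 real). linear f}" morphisms app Endo
  by (rule exI[of _ id]) (simp add: linear_id)

lemma linear_app: "linear (app a)"
  using app by auto

lemma app_Endo: "linear f \<Longrightarrow> app (Endo f) = f"
  by (simp add: Endo_inverse)

lemma endo_eqI: "(\<And>x. app a x = app b x) \<Longrightarrow> a = b"
  by (metis app_inject ext)

instantiation endo :: (type) real_algebra_1
begin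

definition "0 = Endo (\<lambda>_. 0)"
definition "1 = Endo (\<lambda>x. x)"
definition "a + b = Endo (\<lambda>x. app a x + app b x)"
definition "a - b = Endo (\<lambda>x. app a x - app b x)"
definition "- a = Endo (\<lambda>x. - app a x)" for a :: "'a endo"
definition "a * b = Endo (\<lambda>x. app a (app b x))"
definition "r *\<^sub>R a = Endo (\<lambda>x. r *\<^sub>R app a x)" for a :: "'a endo"

lemma app_zero [simp]: "app 0 x = 0"
  and app_one [simp]: "app 1 x = x"
  and app_plus [simp]: "app (a + b) x = app a x + app b x"
  and app_minus [simp]: "app (a - b) x = app a x - app b x"
  and app_uminus [simp]: "app (- a) x = - app a x"
  and app_times [simp]: "app (a * b) x = app a (app b x)"
  and app_scaleR [simp]: "app (r *\<^sub>R a) x = r *\<^sub>R app a x"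
  unfolding zero_endo_def one_endo_def plus_endo_def minus_endo_def uminus_endo_def times_endo_def scaleR_endo_def
  by (subst app_Endo; simp add: linear_zero linear_ident linear_compose_add linear_compose_sub
      linear_compose_neg linear_compose_scale_right linear_compose[unfolded comp_def] linear_app)+

instance
proof
  show "(0 :: 'a endo) \<noteq> 1"
  proof
    assume "(0 :: 'a endo) = 1"
    then have "app 0 (formal (undefined :: 'a)) = app 1 (formal (undefined :: 'a))" by simp
    then show False by (metis app_one app_zero lookup_single_eq lookup_zero zero_neq_one)
  qed
qed (auto intro!: endo_eqI simp: algebra_simps linear_add[OF linear_app] linear_diff[OF linear_app] linear_scale[OF linear_app])

end

lemma app_linear: "app a (x + y) = app a x + app a y" "app a (x - y) = app a x - app a y"
  "app a (r *\<^sub>R x) = r *\<^sub>R app a x" "app a 0 = 0"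
  using linear_app[of a] by (auto simp: linear_add linear_diff linear_scale linear_0)

definition dyad :: "('g \<Rightarrow>\<^sub>0 real) \<Rightarrow> (('g \<Rightarrow>\<^sub>0 real) \<Rightarrow> real) \<Rightarrow> 'g endo" where
  "dyad u \<phi> = Endo (\<lambda>x. \<phi> x *\<^sub>R u)"

lemma app_dyad [simp]: "linear \<phi> \<Longrightarrow> app (dyad u \<phi>) x = \<phi> x *\<^sub>R u"
  unfolding dyad_def by (subst app_Endo) (auto intro!: linearI simp: linear_add linear_scale scaleR_add_left)

lemma linear_comp_app: "linear \<phi> \<Longrightarrow> linear (\<lambda>x. \<phi> (app a x))"
  using linear_compose[OF linear_app] by (simp add: comp_def)

lemma linear_sum_functionals:
  fixes \<phi> \<psi> :: "('g \<Rightarrow>\<^sub>0 real) \<Rightarrow> real"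
  assumes "linear \<phi>" "linear \<psi>"
  shows "linear (\<lambda>x. \<phi> x + \<psi> x)" "linear (\<lambda>x. \<phi> x - \<psi> x)"
  using assms linear_compose_add linear_compose_sub by auto

lemma linear_mult_functional:
  fixes \<phi> :: "('g \<Rightarrow>\<^sub>0 real) \<Rightarrow> real"
  shows "linear \<phi> \<Longrightarrow> linear (\<lambda>x. r * \<phi> x)"
  using linear_compose_scale_right[of \<phi> r] by simp

lemmas linear_lin = linear_sum_functionals linear_mult_functional

text \<open>
  \<open>\<pi>\<close> projects onto the space of interest, and its complement splits off because the group commutes with \<open>\<pi>\<close>. The
  last two assumptions are the only input about this space: \<open>F k\<close> has rank at most one on it and
  \<open>F (k + 1)\<close> vanishes on it.
\<close>

locale tl_representation = tl_unit_group P q M \<Gamma> for P :: "nat \<Rightarrow> 'g endo" and q M \<Gamma> +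
  fixes \<pi> :: "'g endo" and k :: nat and \<rho> :: "'g \<Rightarrow>\<^sub>0 real"
  assumes M: "M = 2 * k + 1"
    and \<pi>: "\<pi> * \<pi> = \<pi>" "\<pi> \<noteq> 0"
    and P_\<pi>: "i < M \<Longrightarrow> P i * \<pi> = P i" "i < M \<Longrightarrow> \<pi> * P i = P i"
    and \<Gamma>_\<pi>: "g \<in> \<Gamma> \<Longrightarrow> g * \<pi> = \<pi> * g"
    and rank: "\<exists>r. app (F k * \<pi>) x = r *\<^sub>R \<rho>"
    and top: "F (Suc k) * \<pi> = 0"
begin

lemma F_\<pi>: "j \<le> M \<Longrightarrow> \<pi> * F j = F j * \<pi>"
  by (rule jones_wenzl_intertwine) (use P_\<pi> in auto)

definition T where "T = F k * \<pi>"

lemma kM: "k < M" "k \<le> M" "Suc k \<le> M" using M by auto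

lemma T_\<pi>: "T * \<pi> = T" "\<pi> * T = T"
  unfolding T_def using F_\<pi>[OF kM(2)] \<pi>(1) by (metis mult.assoc)+

lemma T_T: "T * T = T"
proof -
  have "T * T = F k * (\<pi> * F k) * \<pi>" by (simp add: T_def mult.assoc)
  also have "\<dots> = F k * F k * (\<pi> * \<pi>)" by (simp only: F_\<pi>[OF kM(2)] mult.assoc)
  finally show ?thesis using F_idem[OF kM(2)] \<pi> by (simp add: T_def)
qed

text \<open>
  Otherwise the annihilator of \<open>\<pi>\<close> would be an ideal that contains \<open>F k\<close>, hence \<open>1\<close>.
\<close>

lemma T_nonzero: "T \<noteq> 0"
proof
  assume T0: "T = 0"
  interpret I: tl_ideal P q M "{a. a * \<pi> = 0}"
    by unfold_locales (auto simp: distrib_right mult.assoc P_\<pi>, metis P_\<pi> mult.assoc mult_zero_left)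
  have "1 \<in> {a. a * \<pi> = 0}" by (rule I.one_mem_ideal[of k]) (use T0 M in \<open>auto simp: T_def\<close>)
  then show False using \<pi> by simp
qed

definition a where "a = (SOME a. app T a \<noteq> 0)"
definition va where "va = app T a"
definition \<phi>a where "\<phi>a x = (THE r. app T x = r *\<^sub>R va)"

lemma va_nonzero: "va \<noteq> 0"
proof -
  have "\<exists>a. app T a \<noteq> 0" using T_nonzero endo_eqI[of T 0] by auto
  then show ?thesis unfolding va_def a_def by (rule someI_ex)
qed

lemma T_\<phi>a: "app T x = \<phi>a x *\<^sub>R va"
proof -
  obtain r where r: "va = r *\<^sub>R \<rho>" using rank unfolding va_def T_def by blast
  obtain s where s: "app T x = s *\<^sub>R \<rho>" using rank unfolding T_def by blast
  have "r \<noteq> 0" using r va_nonzero by auto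
  then have "app T x = (s / r) *\<^sub>R va" using r s by simp
  then have "\<exists>!r. app T x = r *\<^sub>R va" using va_nonzero by (metis scaleR_right_imp_eq)
  then show ?thesis unfolding \<phi>a_def by (rule theI')
qed

lemma linear_\<phi>a: "linear \<phi>a"
proof (rule linearI)
  fix x y r
  have "\<phi>a (x + y) *\<^sub>R va = (\<phi>a x + \<phi>a y) *\<^sub>R va"
    by (simp add: T_\<phi>a[symmetric] app_linear scaleR_add_left)
  then show "\<phi>a (x + y) = \<phi>a x + \<phi>a y" using va_nonzero by (metis scaleR_right_imp_eq)
  have "\<phi>a (r *\<^sub>R x) *\<^sub>R va = (r * \<phi>a x) *\<^sub>R va"
    by (simp add: T_\<phi>a[symmetric] app_linear flip: scaleR_scaleR)
  then show "\<phi>a (r *\<^sub>R x) = r *\<^sub>R \<phi>a x" using va_nonzero by (metis real_scaleR_def scaleR_right_imp_eq)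
qed

lemma \<phi>a_va: "\<phi>a va = 1"
proof -
  have "\<phi>a va *\<^sub>R va = 1 *\<^sub>R va" using T_T T_\<phi>a[of va] by (metis app_times scaleR_one va_def)
  then show ?thesis using va_nonzero by (metis scaleR_right_imp_eq)
qed

lemma \<pi>_va: "app \<pi> va = va"
  using T_\<pi>(2) by (metis app_times va_def)

lemma \<phi>a_eq_iff: "T * x = r *\<^sub>R (T * y) \<Longrightarrow> \<phi>a (app x z) = r * \<phi>a (app y z)"
proof -
  assume "T * x = r *\<^sub>R (T * y)"
  then have "app T (app x z) = r *\<^sub>R app T (app y z)" by (metis app_scaleR app_times)
  then have "\<phi>a (app x z) *\<^sub>R va = (r * \<phi>a (app y z)) *\<^sub>R va" by (simp add: T_\<phi>a)
  then show ?thesis using va_nonzero by (metis scaleR_right_imp_eq)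
qed

lemma T_P_T: "T * P k * T = l k *\<^sub>R T"
proof -
  have "T * P k * T = F k * (\<pi> * P k) * F k * \<pi>" by (simp add: T_def mult.assoc)
  also have "\<dots> = l k *\<^sub>R (F k * \<pi> - F (Suc k) * \<pi>)"
    using P_\<pi>(2)[OF kM(1)] FPF[of k] by (simp add: left_diff_distrib)
  finally show ?thesis by (simp add: T_def top)
qed

lemma kill: assumes "i < M" "i \<noteq> k" shows "P i * T = 0" "T * P i = 0"
proof -
  have "P i * T = 0 \<and> T * P i = 0"
  proof (cases "i < k")
    case True
    then have "P i * F k = 0" "F k * P i = 0" using P_F F_P kM by auto
    then show ?thesis unfolding T_def using P_\<pi>[OF assms(1)] by (metis mult.assoc mult_zero_left mult_zero_right)
  next
    case False
    have up: "P (Suc (k + d)) * T = 0" if "Suc (k + d) < M" for d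
      using that
    proof (induction d)
      case 0
      have "l (Suc k) *\<^sub>R (P (Suc k) * F k) = P (Suc k) * F (Suc k) * P (Suc k)" using PFP[of "Suc k"] 0 by (simp del: jw_ratio.simps)
      also have "\<dots> = P (Suc k) * (F (Suc k) * \<pi>) * P (Suc k)" using P_\<pi>[of "Suc k"] 0 by (simp add: mult.assoc)
      finally have "l (Suc k) *\<^sub>R (P (Suc k) * F k) = 0" by (simp add: top)
      then have "P (Suc k) * F k = 0" using l_nz[of "Suc k"] by (simp del: jw_ratio.simps)
      then show ?case by (simp add: T_def flip: mult.assoc)
    next
      case (Suc d)
      let ?i = "Suc (k + d)"
      have c: "P (Suc ?i) * F k = F k * P (Suc ?i)" using P_F_commute[of k "Suc ?i"] Suc.prems by simp
      have c': "P (Suc ?i) * T = T * P (Suc ?i)"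
        unfolding T_def using c P_\<pi>[of "Suc ?i"] Suc.prems by (metis add_Suc_right mult.assoc)
      have "P (Suc ?i) * P ?i * P (Suc ?i) * T = P (Suc ?i) * (P ?i * T) * P (Suc ?i)"
        by (simp add: mult.assoc c')
      also have "\<dots> = 0" using Suc by simp
      finally have "(1 / q) *\<^sub>R (P (Suc ?i) * T) = 0" using braid_down[of ?i] Suc.prems by simp
      then show ?case using q4 by simp
    qed
    obtain d where d: "i = Suc (k + d)" using False assms(2) by (metis less_iff_Suc_add linorder_neqE_nat)
    have "P i * T = 0" using up[of d] d assms(1) by simp
    moreover have "P i * F k = F k * P i" using P_F_commute[of k i] d assms(1) by simp
    then have "P i * T = T * P i" unfolding T_def using P_\<pi>[OF assms(1)] by (metis mult.assoc)
    ultimately show ?thesis by simp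
  qed
  then show "P i * T = 0" "T * P i = 0" by auto
qed

lemma T_va: "app T va = va" using T_\<phi>a[of va] \<phi>a_va by simp

lemma P_va: "i < M \<Longrightarrow> i \<noteq> k \<Longrightarrow> app (P i) va = 0"
  using kill(1)[of i] by (metis T_va app_times app_zero)

lemma \<phi>a_P: "i < M \<Longrightarrow> i \<noteq> k \<Longrightarrow> \<phi>a (app (P i) x) = 0"
  using \<phi>a_eq_iff[of "P i" 0 1 x] kill(2)[of i] by simp

lemma \<phi>a_P_va: "\<phi>a (app (P k) va) = l k"
proof -
  have "app T (app (P k) va) = l k *\<^sub>R va" using T_P_T by (metis T_va app_scaleR app_times)
  then have "\<phi>a (app (P k) va) *\<^sub>R va = l k *\<^sub>R va" by (simp add: T_\<phi>a)
  then show ?thesis using va_nonzero by (metis scaleR_right_imp_eq)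
qed

text \<open>
  The functionals whose transvections along the vector \<open>va\<close> spanning the range of \<open>T\<close> are in the group.
\<close>

definition L where "L = {\<phi>. linear \<phi> \<and> \<phi> va = 0 \<and> (\<forall>t. 1 + t *\<^sub>R dyad va \<phi> \<in> \<Gamma>)}"

lemma conj_dyad:
  assumes "g \<in> \<Gamma>" "h \<in> \<Gamma>" "g * h = 1" "linear \<phi>" "1 + t *\<^sub>R dyad y \<phi> \<in> \<Gamma>"
  shows "1 + t *\<^sub>R dyad (app g y) (\<lambda>x. \<phi> (app h x)) \<in> \<Gamma>"
proof -
  have "g * (1 + t *\<^sub>R dyad y \<phi>) * h = 1 + t *\<^sub>R (g * dyad y \<phi> * h)"
    using assms(3) by (simp add: algebra_simps)
  also have "g * dyad y \<phi> * h = dyad (app g y) (\<lambda>x. \<phi> (app h x))"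
    by (rule endo_eqI) (simp add: assms(4) linear_comp_app app_linear)
  finally show ?thesis using assms mult_mem by metis
qed

lemma L_add: "\<phi> \<in> L \<Longrightarrow> \<psi> \<in> L \<Longrightarrow> (\<lambda>x. \<phi> x + \<psi> x) \<in> L"
proof -
  assume h: "\<phi> \<in> L" "\<psi> \<in> L"
  have "(1 + t *\<^sub>R dyad va \<phi>) * (1 + t *\<^sub>R dyad va \<psi>) = 1 + t *\<^sub>R dyad va (\<lambda>x. \<phi> x + \<psi> x)" for t
    by (rule endo_eqI) (use h in \<open>simp add: L_def linear_lin linear_add linear_scale algebra_simps\<close>)
  then have "1 + t *\<^sub>R dyad va (\<lambda>x. \<phi> x + \<psi> x) \<in> \<Gamma>" for t
    using mult_mem[of "1 + t *\<^sub>R dyad va \<phi>" "1 + t *\<^sub>R dyad va \<psi>"] h by (simp add: L_def)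
  then show ?thesis using h by (simp add: L_def linear_lin)
qed

lemma L_scale: "\<phi> \<in> L \<Longrightarrow> (\<lambda>x. r * \<phi> x) \<in> L"
proof -
  assume h: "\<phi> \<in> L"
  have "1 + t *\<^sub>R dyad va (\<lambda>x. r * \<phi> x) = 1 + (t * r) *\<^sub>R dyad va \<phi>" for t
    by (rule endo_eqI) (use h in \<open>simp add: L_def linear_lin\<close>)
  then show ?thesis using h by (simp add: L_def linear_lin)
qed

text \<open>
  The span of \<open>L\<close> and \<open>\<phi>a\<close>. Functionals in \<open>L\<close> vanish at \<open>va\<close>, a condition that composition with \<open>P k\<close> does
  not respect; adding \<open>\<phi>a\<close>, where \<open>\<phi>a va = 1\<close>, removes it.
\<close>

definition L' where "L' = {\<phi>. linear \<phi> \<and> (\<lambda>x. \<phi> x - \<phi> va * \<phi>a x) \<in> L}"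

lemma L'_add: "\<phi> \<in> L' \<Longrightarrow> \<psi> \<in> L' \<Longrightarrow> (\<lambda>x. \<phi> x + \<psi> x) \<in> L'"
  using L_add[of "\<lambda>x. \<phi> x - \<phi> va * \<phi>a x" "\<lambda>x. \<psi> x - \<psi> va * \<phi>a x"]
  by (simp add: L'_def linear_lin algebra_simps)

lemma L'_scale: "\<phi> \<in> L' \<Longrightarrow> (\<lambda>x. r * \<phi> x) \<in> L'"
  using L_scale[of "\<lambda>x. \<phi> x - \<phi> va * \<phi>a x" r] by (simp add: L'_def linear_lin algebra_simps)

lemma L_L': "\<phi> \<in> L \<Longrightarrow> \<phi> \<in> L'"
  by (simp add: L_def L'_def)

lemma zero_L: "(\<lambda>x. 0) \<in> L"
proof -
  have "dyad va (\<lambda>x. 0) = 0" by (rule endo_eqI) (simp add: linear_zero)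
  then show ?thesis by (simp add: L_def linear_zero one_mem)
qed

lemma \<phi>a_L': "\<phi>a \<in> L'"
  using zero_L by (simp add: L'_def linear_\<phi>a \<phi>a_va)

definition \<psi> where "\<psi> x = \<phi>a (app (P k) x) - l k * \<phi>a x"

lemma \<psi>_va: "\<psi> va = 0" and \<psi>_P_va: "\<psi> (app (P k) va) = c k"
proof -
  show "\<psi> va = 0" by (simp add: \<psi>_def \<phi>a_P_va \<phi>a_va)
  have "app (P k) (app (P k) va) = app (P k) va" using idem[OF kM(1)] by (metis app_times)
  then show "\<psi> (app (P k) va) = c k" by (simp add: \<psi>_def \<phi>a_P_va c_def algebra_simps)
qed

lemma linear_\<psi>: "linear \<psi>"
  unfolding \<psi>_def by (intro linear_lin linear_comp_app linear_\<phi>a)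

text \<open>
  On the range of \<open>\<pi>\<close>, the off-diagonal element \<open>u k\<close> is the dyad of \<open>va\<close> and \<open>\<psi>\<close>.
\<close>

lemma \<psi>_L: assumes "1 \<le> k" shows "\<psi> \<in> L"
proof -
  have "u k = F k * (\<pi> * P k * \<pi>) * (1 - F k)"
    unfolding u_def using P_\<pi>[OF kM(1)] by simp
  also have "\<dots> = F k * \<pi> * (P k * \<pi>) - F k * \<pi> * P k * (\<pi> * F k)" by (simp add: algebra_simps)
  also have "\<dots> = T * P k - T * P k * T"
    by (simp only: P_\<pi>[OF kM(1)] F_\<pi>[OF kM(2)] T_def)
  also have "\<dots> = T * P k - l k *\<^sub>R T" by (simp add: T_P_T)
  also have "\<dots> = dyad va \<psi>"
    by (rule endo_eqI) (simp add: linear_\<psi> T_\<phi>a, simp add: \<psi>_def scaleR_diff_left)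
  finally show ?thesis
    using unipotents_mem[OF assms kM(1)] by (auto simp: L_def linear_\<psi> \<psi>_va)
qed

lemma half_inverse: "i < M \<Longrightarrow> (1 + P i) * (1 - (1 / 2) *\<^sub>R P i) = 1"
  using idem[of i] by (simp add: algebra_simps flip: scaleR_add_left)

lemma gens: assumes "i < M" shows "1 + P i \<in> \<Gamma>" "1 - (1 / 2) *\<^sub>R P i \<in> \<Gamma>"
  using gen_mem[OF assms, of 1] gen_mem[OF assms, of "- 1 / 2"] by simp_all

lemma L_conj_fix:
  assumes "i < M" "\<phi> \<in> L" "(\<lambda>x. \<phi> (app (1 - (1 / 2) *\<^sub>R P i) x)) \<in> L"
  shows "(\<lambda>x. \<phi> (app (P i) x)) \<in> L"
proof -
  have lin: "linear \<phi>" using assms(2) by (simp add: L_def)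
  have "(\<lambda>x. 2 * \<phi> x + (- 2) * \<phi> (app (1 - (1 / 2) *\<^sub>R P i) x)) \<in> L"
    by (intro L_add L_scale assms)
  then show ?thesis by (simp add: linear_diff[OF lin] linear_scale[OF lin])
qed

text \<open>
  For \<open>i \<noteq> k\<close>, conjugation by \<open>1 + P i\<close> fixes \<open>va\<close> and composes the functional with \<open>1 - P i / 2\<close>. For
  \<open>i = k\<close> it moves \<open>va\<close>, and the commutator with the transvection of \<open>\<psi>\<close> brings the vector back to \<open>va\<close>.
\<close>

lemma L'_P:
  assumes k: "1 \<le> k" and i: "i < M" and \<phi>: "\<phi> \<in> L'"
  shows "(\<lambda>x. \<phi> (app (P i) x)) \<in> L'"
proof -
  define \<theta> where "\<theta> x = \<phi> x - \<phi> va * \<phi>a x" for x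
  have \<theta>: "\<theta> \<in> L" using \<phi> by (simp add: L'_def \<theta>_def[abs_def])
  have \<phi>_eq: "\<phi> x = \<theta> x + \<phi> va * \<phi>a x" for x by (simp add: \<theta>_def)
  let ?h = "1 - (1 / 2) *\<^sub>R P i"
  have 1: "(\<lambda>x. \<theta> (app (P i) x)) \<in> L'" "(\<lambda>x. \<phi>a (app (P i) x)) \<in> L'"
  proof -
    have "(\<lambda>x. \<theta> (app (P i) x)) \<in> L' \<and> (\<lambda>x. \<phi>a (app (P i) x)) \<in> L'"
    proof (cases "i = k")
      case False
      have lin: "linear \<theta>" and \<theta>va: "\<theta> va = 0" using \<theta> by (auto simp: L_def)
      have "(\<lambda>x. \<theta> (app ?h x)) \<in> L"
      proof -
        have "1 + t *\<^sub>R dyad (app (1 + P i) va) (\<lambda>x. \<theta> (app ?h x)) \<in> \<Gamma>" for t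
          by (rule conj_dyad[OF gens[OF i] half_inverse[OF i] lin]) (use \<theta> in \<open>simp add: L_def\<close>)
        then show ?thesis using P_va[OF i False] \<theta>va by (simp add: L_def linear_comp_app[OF lin] del: app_minus)
            (simp add: P_va[OF i False])
      qed
      then have "(\<lambda>x. \<theta> (app (P i) x)) \<in> L'" by (intro L_L' L_conj_fix[OF i \<theta>])
      then show ?thesis using \<phi>a_P[OF i False] zero_L L_L' by simp
    next
      case True
      have \<phi>aP: "(\<lambda>x. \<phi>a (app (P k) x)) \<in> L'"
      proof -
        have "(\<lambda>x. \<psi> x + l k * \<phi>a x) \<in> L'" by (intro L'_add L'_scale L_L' \<psi>_L k \<phi>a_L')
        then show ?thesis by (simp add: \<psi>_def)
      qed
      define w where "w = app (P k) va"
      have \<psi>w: "\<psi> w = c k" "c k \<noteq> 0" using \<psi>_P_va c_nz[OF k] by (auto simp: w_def)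
      define r where "r = \<theta> w / c k"
      (* Subtracting a multiple of \<psi> makes \<theta>1 vanish at P k va, so that \<theta>1 composed with 1 - P k / 2
         still vanishes at va and the products of the two dyads other than N * M are zero. *)
      define \<theta>1 where "\<theta>1 x = \<theta> x + (- r) * \<psi> x" for x
      have \<theta>1: "\<theta>1 \<in> L" unfolding \<theta>1_def[abs_def] by (intro L_add L_scale \<theta> \<psi>_L k)
      have lin: "linear \<theta>1" "\<theta>1 va = 0" using \<theta>1 by (auto simp: L_def)
      have w0: "\<theta>1 w = 0" using \<psi>w by (simp add: \<theta>1_def r_def)
      let ?\<mu> = "\<lambda>x. \<theta>1 (app ?h x)"
      have \<mu>: "linear ?\<mu>" "?\<mu> va = 0"
        using linear_comp_app[OF lin(1), of ?h] w0 lin(2) True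
        by (auto simp: linear_diff[OF lin(1)] linear_scale[OF lin(1)] w_def)
      have "1 + (s * c k) *\<^sub>R dyad va ?\<mu> \<in> \<Gamma>" for s
      proof -
        let ?N = "dyad va \<psi>" and ?m = "app (1 + P i) va"
        let ?M = "dyad ?m ?\<mu>"
        have M: "1 + t *\<^sub>R ?M \<in> \<Gamma>" for t
          by (rule conj_dyad[OF gens[OF i] half_inverse[OF i] lin(1)]) (use \<theta>1 in \<open>simp add: L_def\<close>)
        have N: "1 + t *\<^sub>R ?N \<in> \<Gamma>" for t using \<psi>_L[OF k] by (simp add: L_def)
        have \<psi>m: "\<psi> ?m = c k" using \<psi>_va \<psi>w True by (simp add: linear_add[OF linear_\<psi>] w_def)
        have \<mu>m: "?\<mu> ?m = 0"
        proof -
          have "?h * (1 + P i) = 1" using idem[OF i] by (simp add: algebra_simps flip: scaleR_add_left)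
          then have "app ?h ?m = va" by (metis app_one app_times)
          then show ?thesis using lin(2) by simp
        qed
        have NM: "?N * ?M = c k *\<^sub>R dyad va ?\<mu>"
          by (rule endo_eqI) (simp only: app_times app_dyad[OF \<mu>(1)] app_dyad[OF linear_\<psi>] app_scaleR
              linear_scale[OF linear_\<psi>] \<psi>m real_scaleR_def scaleR_scaleR mult.commute)
        have MN: "?M * ?N = 0"
          by (rule endo_eqI) (simp only: app_times app_dyad[OF \<mu>(1)] app_dyad[OF linear_\<psi>] app_zero
              linear_scale[OF \<mu>(1)] \<mu>(2) real_scaleR_def mult_zero_right scaleR_zero_left)
        have MM: "?M * ?M = 0"
          by (rule endo_eqI) (simp only: app_times app_dyad[OF \<mu>(1)] app_zero
              linear_scale[OF \<mu>(1)] \<mu>m real_scaleR_def mult_zero_right scaleR_zero_left)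
        have NN: "?N * ?N = 0"
          by (rule endo_eqI) (simp only: app_times app_dyad[OF linear_\<psi>] app_zero
              linear_scale[OF linear_\<psi>] \<psi>_va real_scaleR_def mult_zero_right scaleR_zero_left)
        have comm: "(1 + x) * (1 + y) * (1 - x) * (1 - y) = 1 + x * y"
          if "x * x = 0" "y * y = 0" "y * x = 0" for x y :: "'g endo"
        proof -
          have "x * (x * z) = 0" "y * (y * z) = 0" "y * (x * z) = 0" for z
            using that by (metis mult.assoc mult_zero_left)+
          then show ?thesis using that by (simp add: algebra_simps)
        qed
        have "(1 + s *\<^sub>R ?N) * (1 + 1 *\<^sub>R ?M) * (1 + (- s) *\<^sub>R ?N) * (1 + (- 1) *\<^sub>R ?M) \<in> \<Gamma>"
          by (intro mult_mem M N)
        moreover have "(1 + s *\<^sub>R ?N) * (1 + 1 *\<^sub>R ?M) * (1 + (- s) *\<^sub>R ?N) * (1 + (- 1) *\<^sub>R ?M) = 1 + s *\<^sub>R (?N * ?M)"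
          using comm[of "s *\<^sub>R ?N" ?M] NN MM MN by simp
        ultimately show ?thesis unfolding NM by simp
      qed
      from this[of "t / c k" for t] have "?\<mu> \<in> L" using \<mu> \<psi>w(2) by (simp add: L_def)
      then have "(\<lambda>x. \<theta>1 (app (P i) x)) \<in> L'" by (intro L_L' L_conj_fix[OF i \<theta>1])
      moreover have "(\<lambda>x. \<psi> (app (P k) x)) \<in> L'"
      proof -
        have "app (P k) (app (P k) x) = app (P k) x" for x using idem[OF kM(1)] by (metis app_times)
        then have "\<psi> (app (P k) x) = (1 - l k) * \<phi>a (app (P k) x)" for x by (simp add: \<psi>_def algebra_simps)
        then show ?thesis using L'_scale[OF \<phi>aP, of "1 - l k"] by simp
      qed
      ultimately have "(\<lambda>x. \<theta>1 (app (P k) x) + r * \<psi> (app (P k) x)) \<in> L'"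
        unfolding True by (intro L'_add L'_scale)
      then show ?thesis using \<phi>aP True by (simp add: \<theta>1_def)
    qed
    then show "(\<lambda>x. \<theta> (app (P i) x)) \<in> L'" "(\<lambda>x. \<phi>a (app (P i) x)) \<in> L'" by auto
  qed
  have "(\<lambda>x. \<theta> (app (P i) x) + \<phi> va * \<phi>a (app (P i) x)) \<in> L'"
    by (intro L'_add L'_scale 1)
  then show ?thesis by (simp add: \<theta>_def)
qed

text \<open>
  The operators \<open>a\<close> for which every functional composed with \<open>a \<pi>\<close> lies in \<open>L'\<close> form an ideal containing \<open>F k\<close>.
\<close>

lemma all_L:
  assumes k: "1 \<le> k" and \<phi>: "linear \<phi>" "\<And>x. \<phi> (app \<pi> x) = \<phi> x" "\<phi> va = 0"
  shows "\<phi> \<in> L"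
proof -
  let ?I = "{a. \<forall>\<phi>. linear \<phi> \<longrightarrow> (\<lambda>x. \<phi> (app (a * \<pi>) x)) \<in> L'}"
  interpret I: tl_ideal P q M ?I
  proof
    fix x y assume h: "x \<in> ?I" "y \<in> ?I"
    show "x + y \<in> ?I"
    proof (intro CollectI allI impI)
      fix \<phi> :: "('g \<Rightarrow>\<^sub>0 real) \<Rightarrow> real" assume lin: "linear \<phi>"
      then have "(\<lambda>z. \<phi> (app (x * \<pi>) z) + \<phi> (app (y * \<pi>) z)) \<in> L'" using h by (intro L'_add) auto
      then show "(\<lambda>z. \<phi> (app ((x + y) * \<pi>) z)) \<in> L'" by (simp add: linear_add[OF lin])
    qed
  next
    fix x r assume h: "x \<in> ?I"
    show "r *\<^sub>R x \<in> ?I"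
    proof (intro CollectI allI impI)
      fix \<phi> :: "('g \<Rightarrow>\<^sub>0 real) \<Rightarrow> real" assume lin: "linear \<phi>"
      then have "(\<lambda>z. r * \<phi> (app (x * \<pi>) z)) \<in> L'" using h by (intro L'_scale) auto
      then show "(\<lambda>z. \<phi> (app (r *\<^sub>R x * \<pi>) z)) \<in> L'" by (simp add: linear_scale[OF lin])
    qed
  next
    fix x i assume h: "x \<in> ?I" "i < M"
    show "P i * x \<in> ?I"
    proof (intro CollectI allI impI)
      fix \<phi> :: "('g \<Rightarrow>\<^sub>0 real) \<Rightarrow> real" assume lin: "linear \<phi>"
      show "(\<lambda>z. \<phi> (app (P i * x * \<pi>) z)) \<in> L'"
        using h(1)[unfolded mem_Collect_eq, rule_format, OF linear_comp_app[OF lin, of "P i"]]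
        by (simp add: mult.assoc)
    qed
    show "x * P i \<in> ?I"
    proof (intro CollectI allI impI)
      fix \<phi> :: "('g \<Rightarrow>\<^sub>0 real) \<Rightarrow> real" assume lin: "linear \<phi>"
      have "x * P i * \<pi> = x * \<pi> * P i" using P_\<pi>[OF h(2)] by (simp add: mult.assoc)
      then show "(\<lambda>z. \<phi> (app (x * P i * \<pi>) z)) \<in> L'"
        using L'_P[OF k h(2), of "\<lambda>z. \<phi> (app (x * \<pi>) z)"] h(1) lin by simp
    qed
  qed
  have "F k \<in> ?I"
  proof (intro CollectI allI impI)
    fix \<phi> :: "('g \<Rightarrow>\<^sub>0 real) \<Rightarrow> real" assume lin: "linear \<phi>"
    have "\<phi> (app (F k * \<pi>) x) = \<phi> va * \<phi>a x" for x
      using T_\<phi>a[of x] by (simp add: T_def linear_scale[OF lin] del: app_times)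
    then show "(\<lambda>x. \<phi> (app (F k * \<pi>) x)) \<in> L'" using L'_scale[OF \<phi>a_L'] by simp
  qed
  then have "1 \<in> ?I" by (rule I.one_mem_ideal) (use M in simp)
  then have "(\<lambda>x. \<phi> (app (1 * \<pi>) x)) \<in> L'" using \<phi>(1) by blast
  then show ?thesis using \<phi>(2,3) by (simp add: L'_def)
qed

text \<open>
  Transvections along \<open>va\<close> are carried to all vectors of the orbit, and the orbit turns out to be everything
  except \<open>0\<close>, once more by the ideal argument.
\<close>

definition Orb where "Orb = {y. \<exists>g\<in>\<Gamma>. app g va = y}"

lemma Orb_\<Gamma>: "y \<in> Orb \<Longrightarrow> g \<in> \<Gamma> \<Longrightarrow> app g y \<in> Orb"
  unfolding Orb_def using mult_mem app_times by blast

lemma Orb_\<pi>: "y \<in> Orb \<Longrightarrow> app \<pi> y = y"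
proof -
  assume "y \<in> Orb"
  then obtain g where g: "g \<in> \<Gamma>" "app g va = y" by (auto simp: Orb_def)
  have "app \<pi> (app g va) = app (g * \<pi>) va" using \<Gamma>_\<pi>[OF g(1)] by simp
  then show ?thesis using g(2) \<pi>_va by simp
qed

lemma Orb_nonzero: "y \<in> Orb \<Longrightarrow> y \<noteq> 0"
proof
  assume "y \<in> Orb" "y = 0"
  then obtain g where g: "g \<in> \<Gamma>" "app g va = 0" by (auto simp: Orb_def)
  obtain h where "h * g = 1" using inverse_mem[OF g(1)] by blast
  then have "va = app h (app g va)" by (metis app_one app_times)
  then show False using g(2) va_nonzero by (simp add: app_linear)
qed

lemma Orb_dyad:
  assumes k: "1 \<le> k" and y: "y \<in> Orb" and \<phi>: "linear \<phi>" "\<And>x. \<phi> (app \<pi> x) = \<phi> x" "\<phi> y = 0"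
  shows "1 + t *\<^sub>R dyad y \<phi> \<in> \<Gamma>"
proof -
  obtain g where g: "g \<in> \<Gamma>" "app g va = y" using y by (auto simp: Orb_def)
  obtain h where h: "h \<in> \<Gamma>" "g * h = 1" using inverse_mem[OF g(1)] by blast
  have "(\<lambda>x. \<phi> (app g x)) \<in> L"
  proof (rule all_L[OF k linear_comp_app[OF \<phi>(1)]])
    show "\<phi> (app g (app \<pi> x)) = \<phi> (app g x)" for x
      using \<Gamma>_\<pi>[OF g(1)] \<phi>(2) by (metis app_times)
    show "\<phi> (app g va) = 0" using g \<phi> by simp
  qed
  then have "1 + t *\<^sub>R dyad (app g va) (\<lambda>x. \<phi> (app g (app h x))) \<in> \<Gamma>"
    by (intro conj_dyad[OF g(1) h linear_comp_app[OF \<phi>(1)]]) (simp add: L_def)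
  moreover have "app g (app h x) = x" for x using h(2) by (metis app_one app_times)
  ultimately show ?thesis using g by simp
qed

lemma Orb_add_multiple:
  assumes k: "1 \<le> k" and y: "y \<in> Orb" and w: "w \<in> Orb" and np: "\<And>r. y \<noteq> r *\<^sub>R w"
  shows "y + t *\<^sub>R w \<in> Orb"
proof -
  have "independent {y, w}"
  proof -
    have "y \<notin> span {w}" using np by (auto simp: span_singleton)
    then show ?thesis using Orb_nonzero[OF w] by (simp add: independent_insert)
  qed
  from linear_independent_extend[OF this, of "\<lambda>x. if x = y then 1 else (0 :: real)"]
  obtain \<phi>0 where \<phi>0: "linear \<phi>0" "\<forall>x\<in>{y, w}. \<phi>0 x = (if x = y then 1 else (0 :: real))"
    by (elim exE conjE)
  have uw: "w \<noteq> y" using np[of 1] by auto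
  define \<phi> where "\<phi> x = \<phi>0 (app \<pi> x)" for x
  have lin: "linear \<phi>" unfolding \<phi>_def by (rule linear_comp_app[OF \<phi>0(1)])
  have "1 + t *\<^sub>R dyad w \<phi> \<in> \<Gamma>"
  proof (rule Orb_dyad[OF k w lin])
    show "\<phi> (app \<pi> x) = \<phi> x" for x unfolding \<phi>_def using \<pi>(1) by (metis app_times)
    show "\<phi> w = 0" using \<phi>0(2) uw by (simp add: \<phi>_def Orb_\<pi>[OF w])
  qed
  from Orb_\<Gamma>[OF y this] show ?thesis
    using \<phi>0(2) by (simp add: lin) (simp add: \<phi>_def Orb_\<pi>[OF y])
qed

text \<open>
  \<open>va\<close> and \<open>w = (1 + P k) va\<close> are independent vectors of the orbit. Adding a multiple of one to the other
  stays in the orbit, so \<open>w + r va\<close>, and then \<open>r va\<close>, is in it.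
\<close>

lemma Orb_scale:
  assumes k: "1 \<le> k" and y: "y \<in> Orb" and r: "r \<noteq> 0"
  shows "r *\<^sub>R y \<in> Orb"
proof -
  define w where "w = app (1 + P k) va"
  have va: "va \<in> Orb" unfolding Orb_def using one_mem by (auto intro: bexI[of _ 1])
  have w: "w \<in> Orb" unfolding w_def by (rule Orb_\<Gamma>[OF va gens(1)[OF kM(1)]])
  have \<psi>w: "\<psi> w = c k" "c k \<noteq> 0"
    using \<psi>_va \<psi>_P_va c_nz[OF k] by (simp_all add: w_def linear_add[OF linear_\<psi>])
  have np: "s *\<^sub>R va \<noteq> t *\<^sub>R w" if "t \<noteq> 0" for s t
  proof
    assume "s *\<^sub>R va = t *\<^sub>R w"
    then have "\<psi> (s *\<^sub>R va) = \<psi> (t *\<^sub>R w)" by simp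
    then show False using \<psi>w \<psi>_va that by (simp add: linear_scale[OF linear_\<psi>])
  qed
  have np': "w \<noteq> s *\<^sub>R va" for s using np[of 1 s] by auto
  have 1: "w + r *\<^sub>R va \<in> Orb" by (rule Orb_add_multiple[OF k w va np'])
  have "w + r *\<^sub>R va \<noteq> s *\<^sub>R w" for s
  proof
    assume h: "w + r *\<^sub>R va = s *\<^sub>R w"
    then have "r *\<^sub>R va = (s - 1) *\<^sub>R w" by (simp add: scaleR_diff_left) (metis add_diff_cancel_left')
    then have "s - 1 = 0" using np by blast
    then show False using h r va_nonzero by simp
  qed
  from Orb_add_multiple[OF k 1 w this, of "- 1"] have rva: "r *\<^sub>R va \<in> Orb" by simp
  obtain g where g: "g \<in> \<Gamma>" "app g va = y" using y by (auto simp: Orb_def)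
  from Orb_\<Gamma>[OF rva g(1)] show ?thesis using g by (simp add: app_linear)
qed

lemma Orb_add:
  assumes k: "1 \<le> k" and y: "y \<in> insert 0 Orb" "w \<in> insert 0 Orb"
  shows "y + w \<in> insert 0 Orb"
proof (cases "y = 0 \<or> w = 0")
  case False
  then have uw: "y \<in> Orb" "w \<in> Orb" using y by auto
  show ?thesis
  proof (cases "\<exists>r. y = r *\<^sub>R w")
    case True
    then obtain r where "y + w = (r + 1) *\<^sub>R w" by (auto simp: scaleR_add_left)
    then show ?thesis using Orb_scale[OF k uw(2), of "r + 1"] by (cases "r + 1 = 0") auto
  next
    case False
    then show ?thesis using Orb_add_multiple[OF k uw, of 1] by auto
  qed
qed (use y in auto)

lemma Orb_all:
  assumes k: "1 \<le> k" shows "app \<pi> x \<in> insert 0 Orb"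
proof -
  let ?I = "{a. \<forall>x. app (a * \<pi>) x \<in> insert 0 Orb}"
  have scale: "r *\<^sub>R y \<in> insert 0 Orb" if "y \<in> insert 0 Orb" for r y
    using Orb_scale[OF k, of y r] that by (cases "r = 0") auto
  interpret I: tl_ideal P q M ?I
  proof
    fix x y assume h: "x \<in> ?I" "y \<in> ?I"
    then show "x + y \<in> ?I" using Orb_add[OF k] by (simp add: distrib_right del: app_times insert_iff)
  next
    fix x r assume h: "x \<in> ?I"
    then show "r *\<^sub>R x \<in> ?I" using scale by (simp del: app_times insert_iff)
  next
    fix x i assume h: "x \<in> ?I" "i < M"
    have left: "app (P i) y \<in> insert 0 Orb" if "y \<in> insert 0 Orb" for y
    proof -
      have "app (1 + P i) y \<in> insert 0 Orb" using that Orb_\<Gamma>[OF _ gens(1)[OF h(2)], of y] app_linear(4)[of "P i"] by auto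
      from Orb_add[OF k this scale[OF that, of "- 1"]] show ?thesis by simp
    qed
    show "P i * x \<in> ?I"
    proof (intro CollectI allI)
      fix z have "app (x * \<pi>) z \<in> insert 0 Orb" using h by blast
      from left[OF this] show "app (P i * x * \<pi>) z \<in> insert 0 Orb" by (simp add: mult.assoc)
    qed
    show "x * P i \<in> ?I"
    proof (intro CollectI allI)
      fix z
      have "x * P i * \<pi> = x * \<pi> * P i" using P_\<pi>[OF h(2)] by (simp add: mult.assoc)
      then have "app (x * P i * \<pi>) z = app (x * \<pi>) (app (P i) z)" by simp
      then show "app (x * P i * \<pi>) z \<in> insert 0 Orb" using h(1) by (simp only: mem_Collect_eq)
    qed
  qed
  have va: "va \<in> Orb" unfolding Orb_def using one_mem by (auto intro: bexI[of _ 1])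
  have "F k \<in> ?I"
  proof (intro CollectI allI)
    fix z show "app (F k * \<pi>) z \<in> insert 0 Orb"
      using scale[of va "\<phi>a z"] va T_\<phi>a[of z] unfolding T_def by simp
  qed
  then have "1 \<in> ?I" by (rule I.one_mem_ideal) (use M in simp)
  then show ?thesis by simp
qed

text \<open>
  For \<open>k = 0\<close> the assumption on the rank says that the range of \<open>\<pi>\<close> is a line, on which every transvection is trivial.
\<close>

theorem transvection_mem:
  assumes y: "app \<pi> y = y" and \<phi>: "linear \<phi>" "\<And>x. \<phi> (app \<pi> x) = \<phi> x" "\<phi> y = 0"
  shows "1 + t *\<^sub>R dyad y \<phi> \<in> \<Gamma>"
proof (cases "y = 0")
  case True
  then have "dyad y \<phi> = 0" by (intro endo_eqI) (simp add: \<phi>(1))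
  then show ?thesis by (simp add: one_mem)
next
  case False
  show ?thesis
  proof (cases "k = 0")
    case True
    have "\<exists>r. x = r *\<^sub>R \<rho>" if "app \<pi> x = x" for x using rank[of x] True that by simp
    then obtain r where r: "y = r *\<^sub>R \<rho>" using y by blast
    then have "r \<noteq> 0" "\<phi> \<rho> = 0" using False \<phi>(3) by (auto simp: linear_scale[OF \<phi>(1)])
    have "\<phi> x = 0" for x
    proof -
      obtain s where "app \<pi> x = s *\<^sub>R \<rho>" using rank[of x] True by auto
      then show ?thesis using \<phi>(2)[of x] \<open>\<phi> \<rho> = 0\<close> by (simp add: linear_scale[OF \<phi>(1)])
    qed
    then have "dyad y \<phi> = 0" by (intro endo_eqI) (simp add: \<phi>(1))
    then show ?thesis by (simp add: one_mem)
  next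
    case k: False
    then have "y \<in> Orb" using Orb_all[of y] y False by simp
    then show ?thesis using Orb_dyad[of y \<phi> t] k \<phi> by simp
  qed
qed

end

section \<open>Graphs in a half-plane: renaming and subgraphs\<close>

lemma map_vertices_sel [simp]:
  "verts (map_vertices f G) = f ` verts G" "marks (map_vertices f G) = map f (marks G)"
  "edges (map_vertices f G) = image_mset (map_prod (image f) id) (edges G)"
  by (simp_all add: map_vertices_def)

lemma map_vertices_WGraph: "map_vertices f (WGraph V m E)
   = WGraph (f ` V) (map f m) (image_mset (map_prod (image f) id) E)"
  by (simp add: map_vertices_def)

text \<open>
  What survives contraction: marked vertices may coincide, and no drawing is required.
\<close>

definition wf_graph :: "nat \<Rightarrow> wgraph \<Rightarrow> bool" where
  "wf_graph n G \<longleftrightarrow> finite (verts G) \<and> length (marks G) = n \<and> set (marks G) \<subseteq> verts G \<and>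
     (\<forall>e\<in>#edges G. \<exists>u\<in>verts G. \<exists>v\<in>verts G. fst e = {u, v})"

lemma wf_graphD:
  assumes "wf_graph n G"
  shows "finite (verts G)" "length (marks G) = n" "set (marks G) \<subseteq> verts G"
    "e \<in># edges G \<Longrightarrow> fst e \<subseteq> verts G" "e \<in># edges G \<Longrightarrow> \<exists>u\<in>verts G. \<exists>v\<in>verts G. fst e = {u, v}"
    "i < n \<Longrightarrow> marks G ! i \<in> verts G"
  using assms by (auto simp: wf_graph_def)

lemma map_vertices_cong:
  assumes "wf_graph n G" "\<And>v. v \<in> verts G \<Longrightarrow> f v = g v"
  shows "map_vertices f G = map_vertices g G"
proof -
  have "map_prod (image f) id e = map_prod (image g) id e" if "e \<in># edges G" for e
    using wf_graphD(4)[OF assms(1) that] assms(2) by (cases e) (force simp: image_iff)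
  then show ?thesis
    using wf_graphD(3)[OF assms(1)] assms(2)
    by (auto simp: map_vertices_def intro!: image_cong image_mset_cong)
qed

lemma map_vertices_compose: "map_vertices f (map_vertices g G) = map_vertices (f \<circ> g) G"
proof -
  have "(`) f \<circ> (`) g = (`) (f \<circ> g)" by (auto simp: fun_eq_iff)
  then show ?thesis
    by (cases G) (simp add: map_vertices_def image_comp multiset.map_comp map_prod_compose[symmetric])
qed

lemma map_vertices_id: "wf_graph n G \<Longrightarrow> (\<And>v. v \<in> verts G \<Longrightarrow> f v = v) \<Longrightarrow> map_vertices f G = G"
  using map_vertices_cong[of n G f id]
  by (cases G) (simp add: map_vertices_def multiset.map_id0 prod.map_id0)

lemma wf_map_vertices: "wf_graph n G \<Longrightarrow> wf_graph n (map_vertices f G)"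
  unfolding wf_graph_def by fastforce

text \<open>
  The position of the vertices in a drawing, separated from the arcs, for which an arbitrary index set is
  allowed: passing to a subgraph then keeps the names of the arcs.
\<close>

definition drawn_marks :: "(nat \<Rightarrow> complex) \<Rightarrow> nat set \<Rightarrow> nat list \<Rightarrow> bool" where
  "drawn_marks pos V m \<longleftrightarrow> inj_on pos V \<and> (\<forall>i<length m. Im (pos (m ! i)) = 0) \<and>
     (\<forall>i j. i < j \<and> j < length m \<longrightarrow> Re (pos (m ! i)) < Re (pos (m ! j))) \<and>
     (\<forall>v \<in> V - set m. Im (pos v) > 0)"

definition drawn_arcs ::
  "(nat \<Rightarrow> complex) \<Rightarrow> nat set \<Rightarrow> nat set \<Rightarrow> (nat \<Rightarrow> nat set) \<Rightarrow> (nat \<Rightarrow> real \<Rightarrow> complex) \<Rightarrow> bool" where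
  "drawn_arcs pos V I ends \<gamma> \<longleftrightarrow>
     (\<forall>i\<in>I. simple_path (\<gamma> i) \<and> path_image (\<gamma> i) \<subseteq> {z. Im z \<ge> 0} \<and>
        (\<exists>u\<in>V. \<exists>v\<in>V. ends i = {u, v} \<and> pathstart (\<gamma> i) = pos u \<and> pathfinish (\<gamma> i) = pos v) \<and>
        \<gamma> i ` {0<..<1} \<inter> pos ` V = {}) \<and>
     (\<forall>i\<in>I. \<forall>k\<in>I. i \<noteq> k \<longrightarrow> \<gamma> i ` {0<..<1} \<inter> \<gamma> k ` {0<..<1} = {})"

lemma drawn_arcsD:
  assumes "drawn_arcs pos V I ends \<gamma>" "i \<in> I"
  shows "simple_path (\<gamma> i)" "path_image (\<gamma> i) \<subseteq> {z. Im z \<ge> 0}"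
    "\<exists>u\<in>V. \<exists>v\<in>V. ends i = {u, v} \<and> pathstart (\<gamma> i) = pos u \<and> pathfinish (\<gamma> i) = pos v"
    "\<gamma> i ` {0<..<1} \<inter> pos ` V = {}"
    "k \<in> I \<Longrightarrow> i \<noteq> k \<Longrightarrow> \<gamma> i ` {0<..<1} \<inter> \<gamma> k ` {0<..<1} = {}"
  using assms unfolding drawn_arcs_def by simp_all

lemma drawn_arcsI:
  assumes "\<And>i. i \<in> I \<Longrightarrow> simple_path (\<gamma> i)" "\<And>i. i \<in> I \<Longrightarrow> path_image (\<gamma> i) \<subseteq> {z. Im z \<ge> 0}"
    "\<And>i. i \<in> I \<Longrightarrow> \<exists>u\<in>V. \<exists>v\<in>V. ends i = {u, v} \<and> pathstart (\<gamma> i) = pos u \<and> pathfinish (\<gamma> i) = pos v"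
    "\<And>i. i \<in> I \<Longrightarrow> \<gamma> i ` {0<..<1} \<inter> pos ` V = {}"
    "\<And>i k. i \<in> I \<Longrightarrow> k \<in> I \<Longrightarrow> i \<noteq> k \<Longrightarrow> \<gamma> i ` {0<..<1} \<inter> \<gamma> k ` {0<..<1} = {}"
  shows "drawn_arcs pos V I ends \<gamma>"
  unfolding drawn_arcs_def by (intro conjI ballI impI; rule assms)

lemma drawn_arcs_ends:
  "drawn_arcs pos V I (fst \<circ> ed) \<gamma> \<Longrightarrow> i \<in> I \<Longrightarrow> \<exists>u\<in>V. \<exists>v\<in>V. fst (ed i) = {u, v}"
  using drawn_arcsD(3)[of pos V I "fst \<circ> ed" \<gamma> i] by auto

lemma mset_set_nth: "mset es = image_mset ((!) es) (mset_set {..<length es})"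
  by (metis atLeast0LessThan map_nth mset_map mset_upt)

lemma drawable_iff_list:
  "drawable_in_half_plane n G \<longleftrightarrow>
     (finite (verts G) \<and> length (marks G) = n \<and> distinct (marks G) \<and> set (marks G) \<subseteq> verts G) \<and>
     (\<exists>pos es \<gamma>. drawn_marks pos (verts G) (marks G) \<and> mset es = edges G \<and>
        drawn_arcs pos (verts G) {..<length es} (fst \<circ> (!) es) \<gamma>)"
proof -
  have *: "(\<exists>pos es \<gamma>. drawn_marks pos (verts G) (marks G) \<and> mset es = edges G \<and>
        drawn_arcs pos (verts G) {..<length es} (fst \<circ> (!) es) \<gamma>) \<longleftrightarrow>
      (\<exists>pos es \<gamma>. 
        inj_on pos (verts G) \<and>
        (\<forall>i<n. Im (pos (marks G ! i)) = 0) \<and>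
        (\<forall>i j. i < j \<and> j < n \<longrightarrow> Re (pos (marks G ! i)) < Re (pos (marks G ! j))) \<and>
        (\<forall>v \<in> verts G - set (marks G). Im (pos v) > 0) \<and>
        mset es = edges G \<and>
        (\<forall>i < length es.
           simple_path (\<gamma> i) \<and> path_image (\<gamma> i) \<subseteq> {z. Im z \<ge> 0} \<and>
           (\<exists>u\<in>verts G. \<exists>v\<in>verts G.
              fst (es ! i) = {u, v} \<and> pathstart (\<gamma> i) = pos u \<and> pathfinish (\<gamma> i) = pos v) \<and>
           \<gamma> i ` {0<..<1} \<inter> pos ` verts G = {}) \<and>
        (\<forall>i < length es. \<forall>k < length es. i \<noteq> k \<longrightarrow>
           \<gamma> i ` {0<..<1} \<inter> \<gamma> k ` {0<..<1} = {}))" if "length (marks G) = n"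
    unfolding drawn_marks_def drawn_arcs_def that lessThan_iff Ball_def[of "{..<_}"] o_apply conj_assoc ..
  show ?thesis
  proof (cases "length (marks G) = n")
    case True
    show ?thesis unfolding drawable_in_half_plane_def *[OF True] by (simp only: conj_assoc)
  next
    case False
    then show ?thesis unfolding drawable_in_half_plane_def by simp
  qed
qed

lemma drawable_iff:
  "drawable_in_half_plane n G \<longleftrightarrow>
     (finite (verts G) \<and> length (marks G) = n \<and> distinct (marks G) \<and> set (marks G) \<subseteq> verts G) \<and>
     (\<exists>pos I ed \<gamma>. finite I \<and> edges G = image_mset ed (mset_set I) \<and>
        drawn_marks pos (verts G) (marks G) \<and> drawn_arcs pos (verts G) I (fst \<circ> ed) \<gamma>)"
proof -
  have 1: "\<exists>es \<gamma>. mset es = edges G \<and> drawn_arcs pos (verts G) {..<length es} (fst \<circ> (!) es) \<gamma>"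
    if 1: "finite I" "edges G = image_mset ed (mset_set I)" "drawn_arcs pos (verts G) I (fst \<circ> ed) \<gamma>"
    for pos I ed \<gamma>
  proof -
    define L where "L = sorted_list_of_set I"
    have L: "set L = I" "distinct L" unfolding L_def using 1 by auto
    have LI: "L ! i \<in> I" if "i < length L" for i using L that nth_mem by blast
    have Li: "L ! i \<noteq> L ! k" if "i < length L" "k < length L" "i \<noteq> k" for i k
      using L that by (simp add: nth_eq_iff_index_eq)
    have "mset L = mset_set I" using L by (metis mset_set_set)
    then have "mset (map ed L) = edges G" using 1(2) by simp
    moreover have "drawn_arcs pos (verts G) {..<length (map ed L)} (fst \<circ> (!) (map ed L)) (\<lambda>i. \<gamma> (L ! i))"
      using 1(3) LI Li unfolding drawn_arcs_def by auto
    ultimately show ?thesis by blast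
  qed
  have 2: "\<exists>I ed. finite I \<and> edges G = image_mset ed (mset_set I) \<and> drawn_arcs pos (verts G) I (fst \<circ> ed) \<gamma>"
    if "mset es = edges G" "drawn_arcs pos (verts G) {..<length es} (fst \<circ> (!) es) \<gamma>" for pos es \<gamma>
    using that mset_set_nth[of es]
    by (intro exI[of _ "{..<length es}"] exI[of _ "(!) es"]) simp
  have "(\<exists>pos es \<gamma>. drawn_marks pos (verts G) (marks G) \<and> mset es = edges G \<and>
        drawn_arcs pos (verts G) {..<length es} (fst \<circ> (!) es) \<gamma>) \<longleftrightarrow>
    (\<exists>pos I ed \<gamma>. finite I \<and> edges G = image_mset ed (mset_set I) \<and>
        drawn_marks pos (verts G) (marks G) \<and> drawn_arcs pos (verts G) I (fst \<circ> ed) \<gamma>)" (is "?L \<longleftrightarrow> ?R")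
  proof
    assume ?L
    then obtain pos es \<gamma> where a: "drawn_marks pos (verts G) (marks G)" "mset es = edges G"
      "drawn_arcs pos (verts G) {..<length es} (fst \<circ> (!) es) \<gamma>" by (elim exE conjE)
    show ?R using 2[OF a(2,3)] a(1) by (elim exE conjE) (intro exI conjI)
  next
    assume ?R
    then obtain pos I ed \<gamma> where a: "finite I" "edges G = image_mset ed (mset_set I)"
      "drawn_marks pos (verts G) (marks G)" "drawn_arcs pos (verts G) I (fst \<circ> ed) \<gamma>" by (elim exE conjE)
    show ?L using 1[OF a(1,2,4)] a(3) by (elim exE conjE) (intro exI conjI)
  qed
  then show ?thesis unfolding drawable_iff_list by (rule arg_cong)
qed

lemma drawableE:
  assumes "drawable_in_half_plane n G"
  obtains pos I ed \<gamma> where "finite (verts G)" "length (marks G) = n" "distinct (marks G)"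
    "set (marks G) \<subseteq> verts G" "finite I" "edges G = image_mset ed (mset_set I)"
    "drawn_marks pos (verts G) (marks G)" "drawn_arcs pos (verts G) I (fst \<circ> ed) \<gamma>"
  using assms unfolding drawable_iff by (elim exE conjE)

lemma drawableI:
  assumes "finite (verts G)" "length (marks G) = n" "distinct (marks G)" "set (marks G) \<subseteq> verts G"
    "finite I" "edges G = image_mset ed (mset_set I)"
    "drawn_marks pos (verts G) (marks G)" "drawn_arcs pos (verts G) I (fst \<circ> ed) \<gamma>"
  shows "drawable_in_half_plane n G"
  unfolding drawable_iff using assms by (intro exI conjI)

lemma drawable_wf: "drawable_in_half_plane n G \<Longrightarrow> wf_graph n G"
  by (erule drawableE) (auto simp: wf_graph_def dest: drawn_arcs_ends)

lemma identify_sel [simp]: "verts (identify u v G) = id(v := u) ` verts G"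
  "marks (identify u v G) = map (id(v := u)) (marks G)"
  "edges (identify u v G) = image_mset (map_prod (image (id(v := u))) id) (edges G)"
  by (simp_all add: identify_def)

lemma half_plane_wf: "half_plane_graph n G \<Longrightarrow> wf_graph n G"
proof (induction rule: half_plane_graph.induct)
  case (contraction V m u v y E)
  then have "wf_graph n (WGraph V m E)" by (simp add: wf_graph_def)
  then show ?case unfolding identify_def by (rule wf_map_vertices)
qed (rule drawable_wf)

lemma drawable_relabel:
  assumes "drawable_in_half_plane n G" "inj_on f (verts G)"
  shows "drawable_in_half_plane n (map_vertices f G)"
proof -
  from drawableE[OF assms(1)] obtain pos I ed \<gamma> where 1: "finite (verts G)" "length (marks G) = n" "distinct (marks G)"
    "set (marks G) \<subseteq> verts G" "finite I" "edges G = image_mset ed (mset_set I)"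
    "drawn_marks pos (verts G) (marks G)" "drawn_arcs pos (verts G) I (fst \<circ> ed) \<gamma>" .
  define pos' where "pos' = pos \<circ> inv_into (verts G) f"
  have p: "pos' (f v) = pos v" if "v \<in> verts G" for v
    using that assms(2) by (simp add: pos'_def)
  have m: "marks G ! i \<in> verts G" if "i < length (marks G)" for i using 1(4) that nth_mem by blast
  have im: "pos' ` f ` verts G = pos ` verts G" using p by force
  show ?thesis
  proof (rule drawableI)
    show "edges (map_vertices f G) = image_mset (map_prod (image f) id \<circ> ed) (mset_set I)"
      by (simp add: 1(6) multiset.map_comp)
    show "distinct (marks (map_vertices f G))"
      using 1(3,4) assms(2) inj_on_subset by (auto simp: distinct_map)
    have "inj_on pos' (f ` verts G)"
      using 1(7) by (auto simp: inj_on_def p drawn_marks_def)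
    moreover have "\<forall>v \<in> f ` verts G - set (map f (marks G)). Im (pos' v) > 0"
      using 1(7) by (auto simp: p drawn_marks_def)
    ultimately show "drawn_marks pos' (verts (map_vertices f G)) (marks (map_vertices f G))"
      using 1(7) by (auto simp: drawn_marks_def p m)
    show "drawn_arcs pos' (verts (map_vertices f G)) I (fst \<circ> (map_prod (image f) id \<circ> ed)) \<gamma>"
      unfolding map_vertices_sel
    proof (rule drawn_arcsI, unfold im)
      fix i assume i: "i \<in> I"
      then obtain u v where uv: "u \<in> verts G" "v \<in> verts G" "fst (ed i) = {u, v}"
        "pathstart (\<gamma> i) = pos u" "pathfinish (\<gamma> i) = pos v"
        using drawn_arcsD(3)[OF 1(8) i] by auto
      then show "\<exists>u\<in>f ` verts G. \<exists>v\<in>f ` verts G.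
          (fst \<circ> (map_prod (image f) id \<circ> ed)) i = {u, v} \<and> pathstart (\<gamma> i) = pos' u \<and> pathfinish (\<gamma> i) = pos' v"
        by (intro bexI[of _ "f u"] bexI[of _ "f v"]) (auto simp: p)
    qed (fact drawn_arcsD[OF 1(8)])+
  qed (use 1 in auto)
qed

text \<open>
  A contraction forgets the vertex \<open>v\<close>, so a renaming of the contracted graph has to be extended to \<open>v\<close> by a
  fresh value before the induction hypothesis applies.
\<close>

lemma half_plane_relabel:
  "half_plane_graph n G \<Longrightarrow> inj_on f (verts G) \<Longrightarrow> half_plane_graph n (map_vertices f G)"
proof (induction arbitrary: f rule: half_plane_graph.induct)
  case (drawn G)
  then show ?case by (intro half_plane_graph.drawn drawable_relabel)
next
  case (contraction V m u v y E)
  let ?g = "id(v := u)"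
  note wfH = half_plane_wf[OF contraction.hyps]
  have uv: "u \<in> V" "v \<in> V" "finite V"
    using wf_graphD(4)[OF wfH, of "({u, v}, y)"] wf_graphD(1)[OF wfH] by simp_all
  have wf: "wf_graph n (WGraph V m E)" using wfH by (simp add: wf_graph_def)
  have inj: "inj_on f (?g ` V)" using contraction.prems by simp
  obtain z where z: "z \<notin> f ` V" using uv(3) ex_new_if_finite[of "f ` V"] by auto
  define f' where "f' = (if u = v then f else f(v := z))"
  have "inj_on f' V"
  proof (cases "u = v")
    case False
    have "inj_on f (V - {v})" by (rule inj_on_subset[OF inj]) (auto simp: False image_iff)
    then have "inj_on (f(v := z)) (V - {v})" by (rule inj_on_fun_updI) (use z in auto)
    moreover have "z \<notin> f(v := z) ` (V - {v})" using z by auto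
    ultimately have "inj_on (f(v := z)) (insert v (V - {v}))"
      by (subst inj_on_insert) simp
    then show ?thesis using False uv(2) by (simp add: f'_def insert_absorb)
  qed (use inj in \<open>auto simp: f'_def fun_upd_idem\<close>)
  then have "half_plane_graph n (map_vertices f' (WGraph V m (add_mset ({u, v}, y) E)))"
    by (rule contraction.IH[unfolded wgraph.sel])
  then have "half_plane_graph n (identify (f' u) (f' v) (map_vertices f' (WGraph V m E)))"
    by (simp add: map_vertices_WGraph half_plane_graph.contraction)
  also have "identify (f' u) (f' v) (map_vertices f' (WGraph V m E)) = map_vertices (id(f' v := f' u) \<circ> f') (WGraph V m E)"
    by (simp add: identify_def map_vertices_compose)
  also have "\<dots> = map_vertices (f \<circ> ?g) (WGraph V m E)"
    by (rule map_vertices_cong[OF wf]) (use z uv in \<open>auto simp: f'_def\<close>)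
  also have "\<dots> = map_vertices f (identify u v (WGraph V m E))"
    by (simp add: identify_def map_vertices_compose)
  finally show ?case .
qed

lemma submset_image_mset_set:
  assumes "finite I" "E \<subseteq># image_mset f (mset_set I)"
  obtains J where "J \<subseteq> I" "E = image_mset f (mset_set J)"
proof -
  have "\<exists>M. M \<subseteq># mset_set I \<and> E = image_mset f M"
  proof -
    obtain B where "image_mset f (mset_set I) = E + B"
      using assms(2) by (metis mset_subset_eq_exists_conv)
    then show ?thesis by (metis image_mset_eq_plusD mset_subset_eq_add_left)
  qed
  then obtain M where M: "M \<subseteq># mset_set I" "E = image_mset f M" by blast
  have "M = mset_set (set_mset M)"
  proof (rule multiset_eqI)
    fix x
    have "count M x \<le> 1"
      using mset_subset_eq_count[OF M(1), of x] assms(1) by (simp add: count_mset_set' split: if_splits)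
    then have "x \<in># M \<Longrightarrow> count M x = 1" "x \<notin># M \<Longrightarrow> count M x = 0"
      by (metis One_nat_def Suc_leI count_greater_zero_iff le_antisym) (simp add: not_in_iff)
    then show "count M x = count (mset_set (set_mset M)) x"
      by (cases "x \<in># M") (simp_all add: count_mset_set')
  qed
  moreover have "set_mset M \<subseteq> I" using M(1) assms(1) set_mset_mono by fastforce
  ultimately show thesis using that M(2) by metis
qed

lemma half_plane_subgraph:
  "half_plane_graph n G \<Longrightarrow> V' \<subseteq> verts G \<Longrightarrow> E' \<subseteq># edges G \<Longrightarrow> set (marks G) \<subseteq> V' \<Longrightarrow>
   \<forall>e\<in>#E'. fst e \<subseteq> V' \<Longrightarrow> half_plane_graph n (WGraph V' (marks G) E')"
proof (induction arbitrary: V' E' rule: half_plane_graph.induct)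
  case (drawn G)
  from drawableE[OF drawn(1)] obtain pos I ed \<gamma> where 1: "finite (verts G)" "length (marks G) = n" "distinct (marks G)"
    "set (marks G) \<subseteq> verts G" "finite I" "edges G = image_mset ed (mset_set I)"
    "drawn_marks pos (verts G) (marks G)" "drawn_arcs pos (verts G) I (fst \<circ> ed) \<gamma>" .
  obtain J where J: "J \<subseteq> I" "E' = image_mset ed (mset_set J)"
    using submset_image_mset_set[OF 1(5)] drawn(3) 1(6) by metis
  have fJ: "finite J" using J 1(5) finite_subset by blast
  have JV: "i \<in> J \<Longrightarrow> fst (ed i) \<subseteq> V'" for i using drawn(5) J fJ by auto
  show ?case
  proof (rule half_plane_graph.drawn, rule drawableI)
    show "drawn_marks pos (verts (WGraph V' (marks G) E')) (marks (WGraph V' (marks G) E'))"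
      using 1(7) drawn(2) inj_on_subset unfolding drawn_marks_def by auto
    show "drawn_arcs pos (verts (WGraph V' (marks G) E')) J (fst \<circ> ed) \<gamma>"
      unfolding wgraph.sel
    proof (rule drawn_arcsI)
      fix i assume i: "i \<in> J"
      then have "i \<in> I" using J by auto
      then obtain u v where uv: "fst (ed i) = {u, v}"
        "pathstart (\<gamma> i) = pos u" "pathfinish (\<gamma> i) = pos v"
        using drawn_arcsD(3)[OF 1(8) \<open>i \<in> I\<close>] by auto
      then show "\<exists>u\<in>V'. \<exists>v\<in>V'. (fst \<circ> ed) i = {u, v} \<and> pathstart (\<gamma> i) = pos u \<and> pathfinish (\<gamma> i) = pos v"
        using JV[OF i] by auto
      show "\<gamma> i ` {0<..<1} \<inter> pos ` V' = {}"
        using drawn_arcsD(4)[OF 1(8) \<open>i \<in> I\<close>] drawn(2) by blast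
      show "simple_path (\<gamma> i)" "path_image (\<gamma> i) \<subseteq> {z. Im z \<ge> 0}"
        by (rule drawn_arcsD[OF 1(8) \<open>i \<in> I\<close>])+
    next
      fix i k assume "i \<in> J" "k \<in> J" "i \<noteq> k"
      then show "\<gamma> i ` {0<..<1} \<inter> \<gamma> k ` {0<..<1} = {}"
        using drawn_arcsD(5)[OF 1(8), of i k] J(1) by (metis subsetD)
    qed
  qed (use 1 drawn fJ J in \<open>auto intro: finite_subset\<close>)
next
  case (contraction V m u v y E)
  let ?g = "id(v := u)" and ?h = "map_prod (image (id(v := u))) id :: nat set \<times> real \<Rightarrow> _"
  note wfH = half_plane_wf[OF contraction.hyps]
  have uv: "u \<in> V" "v \<in> V" "finite V"
    using wf_graphD(4)[OF wfH, of "({u, v}, y)"] wf_graphD(1)[OF wfH] by simp_all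
  have wf: "wf_graph n (WGraph V m E)" using wfH by (simp add: wf_graph_def)
  have mV: "set m \<subseteq> V" using wf by (simp add: wf_graph_def)
  obtain B where "image_mset ?h E = E' + B"
    using contraction.prems(2) by (metis identify_sel(3) mset_subset_eq_exists_conv wgraph.sel(3))
  then obtain E0 where E0: "E0 \<subseteq># E" "E' = image_mset ?h E0"
    by (metis image_mset_eq_plusD mset_subset_eq_add_left)
  have E0': "E0 \<subseteq># add_mset ({u, v}, y) E"
    using E0(1) by (metis add_mset_add_single mset_subset_eq_add_left subset_mset.order_trans)
  have E0V: "?g ` fst e \<subseteq> V'" if "e \<in># E0" for e
    using contraction.prems(4) E0(2) that by (force simp: image_iff)
  have E0V': "fst e \<subseteq> V" if "e \<in># E0" for e
    using wf_graphD(4)[OF wf, of e] mset_subset_eqD[OF E0(1) that] by simp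
  have mV': "?g ` set m \<subseteq> V'" using contraction.prems(3) by simp
  have V': "V' \<subseteq> ?g ` V" using contraction.prems(1) by simp
  show ?case
  proof (cases "u \<in> V'")
    case True
    let ?V0 = "{x \<in> V. ?g x \<in> V'}"
    have 1: "\<forall>e\<in>#add_mset ({u, v}, y) E0. fst e \<subseteq> ?V0"
    proof -
      have "fst e \<subseteq> ?V0" if "e \<in># E0" for e
        using subsetD[OF E0V[OF that] imageI] subsetD[OF E0V'[OF that]]
        by (intro subsetI CollectI conjI)
      then show ?thesis using uv True by auto
    qed
    have 2: "set m \<subseteq> ?V0" using subsetD[OF mV' imageI] subsetD[OF mV]
      by (intro subsetI CollectI conjI)
    have 3: "add_mset ({u, v}, y) E0 \<subseteq># add_mset ({u, v}, y) E" using E0(1) by simp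
    have "half_plane_graph n (WGraph ?V0 m (add_mset ({u, v}, y) E0))"
      by (rule contraction.IH[unfolded wgraph.sel, OF _ 3 2 1]) simp
    then have "half_plane_graph n (identify u v (WGraph ?V0 m E0))"
      by (rule half_plane_graph.contraction)
    moreover have "?g ` ?V0 = V'" using V' by auto
    ultimately show ?thesis by (simp add: identify_def map_vertices_WGraph E0(2))
  next
    case False
    have id: "?g x = x" if "?g x \<in> V'" for x using that False by (auto split: if_splits)
    have m: "map ?g m = m" by (rule map_idI, rule id, rule subsetD[OF mV' imageI])
    have "?g ` fst e = fst e" if "e \<in># E0" for e
    proof -
      have "?g x = x" if "x \<in> fst e" for x by (rule id, rule subsetD[OF E0V[OF \<open>e \<in># E0\<close>] imageI[OF that]])
      then show ?thesis by simp
    qed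
    then have "?h e = e" if "e \<in># E0" for e using that by (metis id_apply map_prod_simp prod.collapse)
    then have E: "E' = E0" unfolding E0(2) by (simp cong: image_mset_cong)
    have 1: "V' \<subseteq> V" using V' uv by auto
    have 2: "set m \<subseteq> V'" using mV' m by (metis set_map)
    have 3: "\<forall>e\<in>#E0. fst e \<subseteq> V'" using contraction.prems(4) E by simp
    have "half_plane_graph n (WGraph V' m E0)"
      by (rule contraction.IH[unfolded wgraph.sel, OF 1 E0' 2 3])
    then show ?thesis using m E by simp
  qed
qed

lemma drawn_arcs_transform:
  assumes d: "drawn_arcs pos V I ends \<gamma>"
    and \<phi>: "continuous_on UNIV \<phi>" "inj \<phi>" "\<And>z. Im z \<ge> 0 \<Longrightarrow> Im (\<phi> z) \<ge> 0"
  shows "drawn_arcs (\<phi> \<circ> pos) V I ends (\<lambda>i. \<phi> \<circ> \<gamma> i)"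
proof (rule drawn_arcsI)
  fix i assume i: "i \<in> I"
  note D = drawn_arcsD[OF d i]
  show "simple_path (\<phi> \<circ> \<gamma> i)"
    using D(1) \<phi>(1,2) by (intro simple_path_continuous_image) (auto intro: continuous_on_subset inj_on_subset)
  show "path_image (\<phi> \<circ> \<gamma> i) \<subseteq> {z. Im z \<ge> 0}"
    using D(2) \<phi>(3) by (auto simp: path_image_compose)
  show "\<exists>u\<in>V. \<exists>v\<in>V. ends i = {u, v} \<and> pathstart (\<phi> \<circ> \<gamma> i) = (\<phi> \<circ> pos) u \<and> pathfinish (\<phi> \<circ> \<gamma> i) = (\<phi> \<circ> pos) v"
    using D(3) unfolding pathstart_compose pathfinish_compose comp_apply by metis
  show "(\<phi> \<circ> \<gamma> i) ` {0<..<1} \<inter> (\<phi> \<circ> pos) ` V = {}"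
    unfolding image_comp[symmetric] using D(4) \<phi>(2) by (simp add: image_Int[symmetric])
  show "(\<phi> \<circ> \<gamma> i) ` {0<..<1} \<inter> (\<phi> \<circ> \<gamma> k) ` {0<..<1} = {}" if "k \<in> I" "i \<noteq> k" for k
    unfolding image_comp[symmetric] using D(5)[OF that] \<phi>(2) by (simp add: image_Int[symmetric])
qed

lemma drawn_arcs_insert:
  assumes d: "drawn_arcs pos V I ends \<gamma>" and i0: "i0 \<notin> I"
    and p: "simple_path p" "path_image p \<subseteq> {z. Im z \<ge> 0}" "u \<in> V" "v \<in> V" "pathstart p = pos u" "pathfinish p = pos v"
      "p ` {0<..<1} \<inter> pos ` V = {}" "\<And>i. i \<in> I \<Longrightarrow> \<gamma> i ` {0<..<1} \<inter> p ` {0<..<1} = {}"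
  shows "drawn_arcs pos V (insert i0 I) (ends(i0 := {u, v})) (\<gamma>(i0 := p))"
proof (rule drawn_arcsI)
  fix i assume i: "i \<in> insert i0 I"
  show "simple_path ((\<gamma>(i0 := p)) i)" "path_image ((\<gamma>(i0 := p)) i) \<subseteq> {z. Im z \<ge> 0}"
    "(\<gamma>(i0 := p)) i ` {0<..<1} \<inter> pos ` V = {}"
    using drawn_arcsD(1,2,4)[OF d, of i] i p by (cases "i = i0"; simp)+
  show "\<exists>u'\<in>V. \<exists>v'\<in>V. (ends(i0 := {u, v})) i = {u', v'} \<and> pathstart ((\<gamma>(i0 := p)) i) = pos u' \<and> pathfinish ((\<gamma>(i0 := p)) i) = pos v'"
    using drawn_arcsD(3)[OF d, of i] i p(3-6) by (cases "i = i0") auto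
next
  fix i k assume ik: "i \<in> insert i0 I" "k \<in> insert i0 I" "i \<noteq> k"
  then show "(\<gamma>(i0 := p)) i ` {0<..<1} \<inter> (\<gamma>(i0 := p)) k ` {0<..<1} = {}"
    using drawn_arcsD(5)[OF d, of i k] p(8)[of i] p(8)[of k] by (cases "i = i0"; cases "k = i0") (simp_all add: Int_commute)
qed

lemma drawn_arcs_insert_vertex:
  assumes d: "drawn_arcs pos V I ends \<gamma>" and w: "w \<notin> V"
    and z: "\<And>i. i \<in> I \<Longrightarrow> z \<notin> path_image (\<gamma> i)"
  shows "drawn_arcs (pos(w := z)) (insert w V) I ends \<gamma>"
proof (rule drawn_arcsI)
  fix i assume i: "i \<in> I"
  note D = drawn_arcsD[OF d i]
  show "simple_path (\<gamma> i)" "path_image (\<gamma> i) \<subseteq> {z. Im z \<ge> 0}" by (rule D)+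
  obtain u v where uv: "u \<in> V" "v \<in> V" "ends i = {u, v}" "pathstart (\<gamma> i) = pos u" "pathfinish (\<gamma> i) = pos v"
    using D(3) by blast
  show "\<exists>u\<in>insert w V. \<exists>v\<in>insert w V. ends i = {u, v} \<and> pathstart (\<gamma> i) = (pos(w := z)) u \<and> pathfinish (\<gamma> i) = (pos(w := z)) v"
    by (rule bexI[of _ u], rule bexI[of _ v]) (use uv w in auto)
  have "\<gamma> i ` {0<..<1} \<subseteq> path_image (\<gamma> i)" by (auto simp: path_image_def)
  then have "z \<notin> \<gamma> i ` {0<..<1}" using z[OF i] by blast
  moreover have im: "(pos(w := z)) ` V = pos ` V" using w by (intro image_cong) auto
  ultimately show "\<gamma> i ` {0<..<1} \<inter> (pos(w := z)) ` insert w V = {}"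
    using D(4) unfolding image_insert im fun_upd_same by auto
qed (rule drawn_arcsD(5)[OF d])

section \<open>Adjoining edges and boundary vertices\<close>

text \<open>
  A shear of the plane that pushes a drawing upwards, away from the real line, where \<open>g > 0\<close>. Taking for \<open>g\<close> a
  product of squares that vanishes at chosen boundary vertices makes room for new arcs near the real line while
  those vertices stay fixed.
\<close>

definition lift_by :: "(real \<Rightarrow> real) \<Rightarrow> complex \<Rightarrow> complex" where
  "lift_by g z = z + \<i> * of_real (g (Re z))"

lemma lift_by_sel [simp]: "Re (lift_by g z) = Re z" "Im (lift_by g z) = Im z + g (Re z)"
  by (simp_all add: lift_by_def)

lemma inj_lift_by: "inj (lift_by g)"
  by (rule injI) (metis add_right_cancel complex_eqI lift_by_sel)

lemma continuous_lift_by: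
  assumes "continuous_on UNIV g"
  shows "continuous_on UNIV (lift_by g)"
proof -
  have "continuous_on UNIV (\<lambda>z. g (Re z))"
    by (rule continuous_on_compose2[OF assms _ subset_UNIV]) (intro continuous_intros)
  then show ?thesis unfolding lift_by_def by (intro continuous_intros)
qed

lemma linepath_interior:
  "z \<in> linepath a b ` {0<..<1} \<longleftrightarrow> (\<exists>t. 0 < t \<and> t < 1 \<and> z = (1 - t) *\<^sub>R a + t *\<^sub>R b)"
  by (auto simp: linepath_def)

lemma arc_interior_subset: "\<gamma> ` {0<..<1} \<subseteq> path_image \<gamma>"
  unfolding path_image_def by (intro image_mono) auto

lemma transformed_disjoint:
  assumes "\<gamma> ` T \<subseteq> H" "\<And>z. z \<in> H \<Longrightarrow> \<phi> z \<notin> S"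
  shows "(\<phi> \<circ> \<gamma>) ` T \<inter> S = {}" "S \<inter> (\<phi> \<circ> \<gamma>) ` T = {}"
  using assms by auto

text \<open>
  A shear that fixes only the vertical lines through the boundary vertices leaves the real line free between
  them; the new edge is the segment between
  neighbouring boundary vertices.
\<close>

lemma drawable_adjoin_edge:
  assumes G: "drawable_in_half_plane n G" and j: "1 \<le> j" "j < n"
  shows "drawable_in_half_plane n (adjoin_edge j y G)"
proof -
  from drawableE[OF G] obtain pos I ed \<gamma> where 1: "finite (verts G)" "length (marks G) = n" "distinct (marks G)"
    "set (marks G) \<subseteq> verts G" "finite I" "edges G = image_mset ed (mset_set I)"
    "drawn_marks pos (verts G) (marks G)" "drawn_arcs pos (verts G) I (fst \<circ> ed) \<gamma>" .
  define m where "m = marks G"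
  define a where "a k = Re (pos (m ! k))" for k
  define g where "g x = (\<Prod>k<n. (x - a k)\<^sup>2)" for x
  have mn: "length m = n" using 1 by (simp add: m_def)
  have M: "inj_on pos (verts G)" "\<And>i. i < n \<Longrightarrow> Im (pos (m ! i)) = 0" "\<And>i k. i < k \<Longrightarrow> k < n \<Longrightarrow> a i < a k"
    "\<And>v. v \<in> verts G - set m \<Longrightarrow> Im (pos v) > 0"
    using 1(7) mn unfolding drawn_marks_def a_def m_def by auto
  have mV: "m ! i \<in> verts G" if "i < n" for i using 1(4) mn that nth_mem unfolding m_def by blast
  have g0: "g x \<ge> 0" for x unfolding g_def by (rule prod_nonneg) simp
  have ga: "g (a k) = 0" if "k < n" for k unfolding g_def using that by (intro prod_zero) auto
  have gpos: "\<exists>k<n. x = a k" if "g x = 0" for x using that unfolding g_def by auto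
  have gc: "continuous_on UNIV g" unfolding g_def by (intro continuous_intros)
  define \<phi> where "\<phi> = lift_by g"
  have d1: "drawn_arcs (\<phi> \<circ> pos) (verts G) I (fst \<circ> ed) (\<lambda>i. \<phi> \<circ> \<gamma> i)"
    by (rule drawn_arcs_transform[OF 1(8)]) (use g0 in \<open>auto simp: \<phi>_def gc continuous_lift_by inj_lift_by intro: add_nonneg_nonneg\<close>)
  have pm: "(\<phi> \<circ> pos) (m ! k) = pos (m ! k)" if "k < n" for k
    using ga[OF that] unfolding \<phi>_def by (simp add: complex_eq_iff a_def[symmetric])
  let ?p = "linepath (pos (m ! (j - 1))) (pos (m ! j))"
  have aj: "a (j - 1) < a j" using M(3)[of "j - 1" j] j by simp
  have gap: "\<not> (a (j - 1) < a k \<and> a k < a j)" if "k < n" for k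
  proof (cases "k \<le> j - 1")
    case True
    moreover have "j - 1 < n" using j by simp
    ultimately have "a k \<le> a (j - 1)" using M(3)[of k "j - 1"] by (cases "k = j - 1") (simp_all add: le_less)
    then show ?thesis by simp
  next
    case False
    then have "k = j \<or> j < k" using j by linarith
    then have "a j \<le> a k" using M(3)[of j k] that by auto
    then show ?thesis by simp
  qed
  have Imp: "Im z = 0" if "z \<in> path_image ?p" for z
    using that M(2)[of "j - 1"] M(2)[of j] j by (auto simp: path_image_linepath closed_segment_def)
  have int: "Im z = 0 \<and> a (j - 1) < Re z \<and> Re z < a j" if z: "z \<in> ?p ` {0<..<1}" for z
  proof -
    obtain t where t: "0 < t" "t < 1" "z = (1 - t) *\<^sub>R pos (m ! (j - 1)) + t *\<^sub>R pos (m ! j)"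
      using z linepath_interior by blast
    have "Re z = a (j - 1) + t * (a j - a (j - 1))" "Re z = a j - (1 - t) * (a j - a (j - 1))"
      unfolding t(3) a_def by (simp_all add: algebra_simps)
    moreover have "t * (a j - a (j - 1)) > 0" "(1 - t) * (a j - a (j - 1)) > 0" using t aj by auto
    ultimately show ?thesis using t(3) M(2)[of "j - 1"] M(2)[of j] j by auto
  qed
  have avoid: "\<phi> z \<notin> ?p ` {0<..<1}" if "Im z \<ge> 0" for z
  proof
    assume "\<phi> z \<in> ?p ` {0<..<1}"
    from int[OF this] have 2: "Im z + g (Re z) = 0" "a (j - 1) < Re z" "Re z < a j" by (simp_all add: \<phi>_def)
    then have "g (Re z) = 0" using g0[of "Re z"] that by linarith
    from gpos[OF this] obtain k where "k < n" "Re z = a k" by (elim exE conjE)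
    then show False using gap[of k] 2 by simp
  qed
  obtain i0 where i0: "i0 \<notin> I" using 1(5) ex_new_if_finite[of I] by auto
  have posIm: "Im (pos v) \<ge> 0" if "v \<in> verts G" for v
  proof (cases "v \<in> set m")
    case True then show ?thesis using M(2) mn by (metis in_set_conv_nth order_refl)
  next
    case False then show ?thesis using M(4)[of v] that by simp
  qed
  have d2: "drawn_arcs (\<phi> \<circ> pos) (verts G) (insert i0 I) ((fst \<circ> ed)(i0 := {m ! (j - 1), m ! j})) ((\<lambda>i. \<phi> \<circ> \<gamma> i)(i0 := ?p))"
  proof (rule drawn_arcs_insert[OF d1 i0])
    show "simple_path ?p" using aj by (intro simple_path_linepath) (auto simp: a_def)
    show "path_image ?p \<subseteq> {z. Im z \<ge> 0}" using Imp by auto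
    show "m ! (j - 1) \<in> verts G" "m ! j \<in> verts G" using mV j by auto
    show "pathstart ?p = (\<phi> \<circ> pos) (m ! (j - 1))" "pathfinish ?p = (\<phi> \<circ> pos) (m ! j)" using pm j by auto
    show "?p ` {0<..<1} \<inter> (\<phi> \<circ> pos) ` verts G = {}" 
      by (rule transformed_disjoint(2)[where H = "{z. Im z \<ge> 0}"]) (use avoid posIm in blast)+
    fix i assume "i \<in> I"
    then have "\<gamma> i ` {0<..<1} \<subseteq> {z. Im z \<ge> 0}"
      using drawn_arcsD(2)[OF 1(8)] arc_interior_subset by (meson subset_trans)
    then show "(\<phi> \<circ> \<gamma> i) ` {0<..<1} \<inter> ?p ` {0<..<1} = {}" 
      by (rule transformed_disjoint(1)) (use avoid in blast)
  qed
  show ?thesis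
  proof (rule drawableI)
    show "edges (adjoin_edge j y G) = image_mset (ed(i0 := ({m ! (j - 1), m ! j}, y))) (mset_set (insert i0 I))"
      using 1(5) i0 by (simp add: adjoin_edge_def 1(6) m_def cong: image_mset_cong) (auto intro!: image_mset_cong)
    have "(fst \<circ> ed(i0 := ({m ! (j - 1), m ! j}, y))) = (fst \<circ> ed)(i0 := {m ! (j - 1), m ! j})" by (simp add: fun_eq_iff)
    then show "drawn_arcs (\<phi> \<circ> pos) (verts (adjoin_edge j y G)) (insert i0 I) (fst \<circ> ed(i0 := ({m ! (j - 1), m ! j}, y)))
      ((\<lambda>i. \<phi> \<circ> \<gamma> i)(i0 := ?p))"
      using d2 by (simp add: adjoin_edge_def)
    have "inj_on (\<phi> \<circ> pos) (verts G)" using M(1) inj_lift_by unfolding \<phi>_def by (intro comp_inj_on) (auto intro: inj_on_subset)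
    moreover have "Im ((\<phi> \<circ> pos) v) > 0" if "v \<in> verts G - set m" for v
      using M(4)[OF that] g0[of "Re (pos v)"] by (simp add: \<phi>_def)
    ultimately show "drawn_marks (\<phi> \<circ> pos) (verts (adjoin_edge j y G)) (marks (adjoin_edge j y G))"
      using M(2,3) mn unfolding drawn_marks_def by (simp add: adjoin_edge_def m_def[symmetric] pm[unfolded comp_def] a_def)
  qed (use 1 in \<open>auto simp: adjoin_edge_def\<close>)
qed

text \<open>
  As \<open>adjoin_boundary_vertex\<close>, but with a free choice of the new vertex, since the least unused vertex is not
  stable under renaming, deleting or contracting.
\<close>

definition attach :: "nat \<Rightarrow> nat \<Rightarrow> real \<Rightarrow> wgraph \<Rightarrow> wgraph" where
  "attach w j y G = WGraph (insert w (verts G)) ((marks G)[j - 1 := w])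
     (add_mset ({marks G ! (j - 1), w}, y) (edges G))"

text \<open>
  Here the boundary vertex \<open>j\<close> itself is pushed up, which makes it interior; the new boundary vertex takes its
  place and the new edge is the vertical segment.
\<close>

lemma drawable_attach:
  assumes G: "drawable_in_half_plane n G" and j: "1 \<le> j" "j \<le> n" and w: "w \<notin> verts G"
  shows "drawable_in_half_plane n (attach w j y G)"
proof -
  from drawableE[OF G] obtain pos I ed \<gamma> where 1: "finite (verts G)" "length (marks G) = n" "distinct (marks G)"
    "set (marks G) \<subseteq> verts G" "finite I" "edges G = image_mset ed (mset_set I)"
    "drawn_marks pos (verts G) (marks G)" "drawn_arcs pos (verts G) I (fst \<circ> ed) \<gamma>" .
  define m where "m = marks G"
  define j' where "j' = j - 1"
  have j': "j' < n" using j by (simp add: j'_def)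
  define a where "a k = Re (pos (m ! k))" for k
  define g where "g x = (\<Prod>k\<in>{..<n} - {j'}. (x - a k)\<^sup>2)" for x
  have mn: "length m = n" using 1 by (simp add: m_def)
  have M: "inj_on pos (verts G)" "\<And>i. i < n \<Longrightarrow> Im (pos (m ! i)) = 0" "\<And>i k. i < k \<Longrightarrow> k < n \<Longrightarrow> a i < a k"
    "\<And>v. v \<in> verts G - set m \<Longrightarrow> Im (pos v) > 0"
    using 1(7) mn unfolding drawn_marks_def a_def m_def by auto
  have mV: "m ! i \<in> verts G" if "i < n" for i using 1(4) mn that nth_mem unfolding m_def by blast
  have g0: "g x \<ge> 0" for x unfolding g_def by (rule prod_nonneg) simp
  have ga: "g (a k) = 0" if "k < n" "k \<noteq> j'" for k unfolding g_def using that by (intro prod_zero) auto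
  have gj: "g (a j') > 0" unfolding g_def
  proof (rule prod_pos)
    fix k assume "k \<in> {..<n} - {j'}"
    then have "a k \<noteq> a j'" using M(3)[of k j'] M(3)[of j' k] j' by (cases "k < j'") auto
    then show "0 < (a j' - a k)\<^sup>2" by simp
  qed
  have gc: "continuous_on UNIV g" unfolding g_def by (intro continuous_intros)
  define \<phi> where "\<phi> = lift_by g"
  define z0 where "z0 = pos (m ! j')"
  have z0: "Im z0 = 0" "Re z0 = a j'" using M(2)[OF j'] by (simp_all add: z0_def a_def)
  have d1: "drawn_arcs (\<phi> \<circ> pos) (verts G) I (fst \<circ> ed) (\<lambda>i. \<phi> \<circ> \<gamma> i)"
    by (rule drawn_arcs_transform[OF 1(8)]) (use g0 in \<open>auto simp: \<phi>_def gc continuous_lift_by inj_lift_by intro: add_nonneg_nonneg\<close>)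
  have pm: "\<phi> (pos (m ! k)) = pos (m ! k)" if "k < n" "k \<noteq> j'" for k
    using ga[OF that] unfolding \<phi>_def by (simp add: complex_eq_iff a_def[symmetric])
  let ?p = "linepath (\<phi> z0) z0"
  have \<phi>z0: "Re (\<phi> z0) = a j'" "Im (\<phi> z0) = g (a j')" using z0 by (simp_all add: \<phi>_def)
  have int: "0 < Im z \<and> Im z < g (a j') \<and> Re z = a j'" if z: "z \<in> ?p ` {0<..<1}" for z
  proof -
    obtain t where t: "0 < t" "t < 1" "z = (1 - t) *\<^sub>R \<phi> z0 + t *\<^sub>R z0"
      using z linepath_interior by blast
    have "Re z = a j'" unfolding t(3) using z0 \<phi>z0 by (simp add: algebra_simps)
    moreover have "Im z = (1 - t) * g (a j')" unfolding t(3) using z0 \<phi>z0 by simp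
    moreover have "(1 - t) * g (a j') < 1 * g (a j')" using t gj by (intro mult_strict_right_mono) auto
    ultimately show ?thesis using t gj by auto
  qed
  have above: "\<phi> z \<noteq> x" if "Im z \<ge> 0" "Re x = a j'" "Im x < g (a j')" for z x
  proof
    assume "\<phi> z = x"
    then have "Re z = a j'" "Im z + g (Re z) = Im x" using that by (auto simp: \<phi>_def)
    then show False using that by simp
  qed
  have avoid: "\<phi> z \<notin> ?p ` {0<..<1}" if "Im z \<ge> 0" for z
    using above[OF that] int by blast
  obtain i0 where i0: "i0 \<notin> I" using 1(5) ex_new_if_finite[of I] by auto
  have posIm: "Im (pos v) \<ge> 0" if "v \<in> verts G" for v
  proof (cases "v \<in> set m")
    case True then show ?thesis using M(2) mn by (metis in_set_conv_nth order_refl)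
  next
    case False then show ?thesis using M(4)[of v] that by simp
  qed
  have arcIm: "path_image (\<gamma> i) \<subseteq> {z. Im z \<ge> 0}" if "i \<in> I" for i
    by (rule drawn_arcsD(2)[OF 1(8) that])
  let ?pos = "(\<phi> \<circ> pos)(w := z0)" and ?V = "insert w (verts G)"
  have d2: "drawn_arcs ?pos ?V I (fst \<circ> ed) (\<lambda>i. \<phi> \<circ> \<gamma> i)"
  proof (rule drawn_arcs_insert_vertex[OF d1 w])
    fix i assume "i \<in> I"
    then show "z0 \<notin> path_image (\<phi> \<circ> \<gamma> i)"
      using arcIm above[of _ z0] z0 gj by (fastforce simp: path_image_compose)
  qed
  have wm: "m ! j' \<noteq> w" using mV[OF j'] w by blast
  have d3: "drawn_arcs ?pos ?V (insert i0 I) ((fst \<circ> ed)(i0 := {m ! j', w})) ((\<lambda>i. \<phi> \<circ> \<gamma> i)(i0 := ?p))"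
  proof (rule drawn_arcs_insert[OF d2 i0])
    have "\<phi> z0 \<noteq> z0" using gj z0 \<phi>z0 by (metis less_irrefl)
    then show "simple_path ?p" by (rule simple_path_linepath)
    show "path_image ?p \<subseteq> {z. Im z \<ge> 0}"
      using z0 \<phi>z0 gj by (auto simp: path_image_linepath closed_segment_def intro!: mult_nonneg_nonneg)
    show "m ! j' \<in> ?V" "w \<in> ?V" using mV j' by auto
    show "pathstart ?p = ?pos (m ! j')" "pathfinish ?p = ?pos w" using wm by (auto simp: z0_def)
    show "?p ` {0<..<1} \<inter> ?pos ` ?V = {}"
    proof (rule equals0I)
      fix x assume x: "x \<in> ?p ` {0<..<1} \<inter> ?pos ` ?V"
      then obtain v where v: "v \<in> ?V" "x = ?pos v" by (elim IntE imageE)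
      have "x \<in> ?p ` {0<..<1}" using x by (rule IntD1)
      then show False
        using v avoid[OF posIm[of v]] int[of z0] z0 by (cases "v = w") simp_all
    qed
    fix i assume "i \<in> I"
    then have "\<gamma> i ` {0<..<1} \<subseteq> {z. Im z \<ge> 0}"
      using arcIm arc_interior_subset by (meson subset_trans)
    then show "(\<phi> \<circ> \<gamma> i) ` {0<..<1} \<inter> ?p ` {0<..<1} = {}" 
      by (rule transformed_disjoint(1)) (use avoid in blast)
  qed
  let ?ed = "ed(i0 := ({m ! j', w}, y))" and ?m = "m[j' := w]"
  have wset: "w \<notin> set m" using w 1(4) m_def by auto
  show ?thesis
  proof (rule drawableI)
    show "edges (attach w j y G) = image_mset ?ed (mset_set (insert i0 I))"
      using 1(5) i0 by (simp add: attach_def 1(6) m_def j'_def cong: image_mset_cong) (auto intro!: image_mset_cong)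
    have "(fst \<circ> ?ed) = (fst \<circ> ed)(i0 := {m ! j', w})" by (simp add: fun_eq_iff)
    then show "drawn_arcs ?pos (verts (attach w j y G)) (insert i0 I) (fst \<circ> ?ed) ((\<lambda>i. \<phi> \<circ> \<gamma> i)(i0 := ?p))"
      using d3 by (simp add: attach_def)
    have inj: "inj_on ?pos ?V"
    proof -
      have "inj_on (\<phi> \<circ> pos) (verts G)" using M(1) inj_lift_by unfolding \<phi>_def by (intro comp_inj_on) (auto intro: inj_on_subset)
      moreover have "inj_on ?pos (verts G) \<longleftrightarrow> inj_on (\<phi> \<circ> pos) (verts G)"
        by (rule inj_on_cong) (use w in auto)
      ultimately have "inj_on ?pos (verts G)" by simp
      moreover have "z0 \<noteq> \<phi> (pos v)" if "v \<in> verts G" for v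
        using above[OF posIm[OF that], of z0] z0 gj by auto
      then have "?pos w \<notin> ?pos ` verts G" using w by (auto simp: image_iff)
      ultimately show ?thesis using w by (simp add: inj_on_insert)
    qed
    have pos: "?pos (?m ! k) = pos (m ! k)" if "k < n" for k
      using pm[OF that] mV[OF that] w mn that by (cases "k = j'") (auto simp: z0_def)
    have mm: "set ?m = insert w (set m - {m ! j'})"
      using set_update_distinct[of m j' w] 1(3) mn j' m_def by simp
    have "Im (?pos v) > 0" if v: "v \<in> ?V - set ?m" for v
    proof -
      have vw: "v \<noteq> w" "v \<in> verts G" using v mm by auto
      show ?thesis
      proof (cases "v = m ! j'")
        case True
        then show ?thesis using vw \<phi>z0 gj z0_def by simp
      next
        case False
        then have "v \<in> verts G - set m" using v mm by auto
        then show ?thesis using M(4)[of v] g0[of "Re (pos v)"] vw by (simp add: \<phi>_def)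
      qed
    qed
    then show "drawn_marks ?pos (verts (attach w j y G)) (marks (attach w j y G))"
      using inj pos M(2,3) mn unfolding drawn_marks_def attach_def m_def[symmetric] j'_def[symmetric] wgraph.sel
      by (simp add: a_def del: fun_upd_apply)
    show "distinct (marks (attach w j y G))"
      using 1(3) wset by (simp add: attach_def m_def distinct_list_update)
    show "set (marks (attach w j y G)) \<subseteq> verts (attach w j y G)"
      using mm 1(4) m_def by (auto simp: attach_def j'_def)
  qed (use 1 in \<open>auto simp: attach_def\<close>)
qed

lemma adjoin_edge_map:
  assumes "length (marks G) = n" "1 \<le> j" "j < n"
  shows "adjoin_edge j y (map_vertices f G) = map_vertices f (adjoin_edge j y G)"
  using assms by (simp add: adjoin_edge_def map_vertices_def)

lemma attach_map:
  assumes "length (marks G) = n" "1 \<le> j" "j \<le> n"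
  shows "attach (f w) j y (map_vertices f G) = map_vertices f (attach w j y G)"
  using assms by (simp add: attach_def map_vertices_def map_update)

lemma attach_relabel:
  assumes "wf_graph n G" "1 \<le> j" "j \<le> n" "w \<notin> verts G" "w' \<notin> verts G"
  shows "attach w' j y G = map_vertices (id(w := w')) (attach w j y G)"
    "inj_on (id(w := w')) (verts (attach w j y G))"
proof -
  have "map_vertices (id(w := w')) G = G"
    by (rule map_vertices_id[OF assms(1)]) (use assms(4) in auto)
  then show "attach w' j y G = map_vertices (id(w := w')) (attach w j y G)"
    using attach_map[of G n j "id(w := w')" w y] wf_graphD(2)[OF assms(1)] assms by simp
  show "inj_on (id(w := w')) (verts (attach w j y G))"
    using assms(4,5) by (auto simp: inj_on_def attach_def)
qed

lemma half_plane_adjoin_edge: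
  "half_plane_graph n G \<Longrightarrow> 1 \<le> j \<Longrightarrow> j < n \<Longrightarrow> half_plane_graph n (adjoin_edge j y G)"
proof (induction rule: half_plane_graph.induct)
  case (drawn G)
  then show ?case by (intro half_plane_graph.drawn drawable_adjoin_edge)
next
  case (contraction V m u v y' E)
  let ?e = "({m ! (j - 1), m ! j}, y)"
  have len: "length m = n" using wf_graphD(2)[OF half_plane_wf[OF contraction.hyps]] by simp
  have "half_plane_graph n (WGraph V m (add_mset ({u, v}, y') (add_mset ?e E)))"
    using contraction.IH[OF contraction.prems] by (simp add: adjoin_edge_def add_mset_commute)
  then have "half_plane_graph n (identify u v (WGraph V m (add_mset ?e E)))"
    by (rule half_plane_graph.contraction)
  then show ?case
    unfolding identify_def using adjoin_edge_map[of "WGraph V m E" n j y "id(v := u)"] len contraction.prems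
    by (simp add: adjoin_edge_def)
qed

lemma half_plane_attach:
  "half_plane_graph n G \<Longrightarrow> 1 \<le> j \<Longrightarrow> j \<le> n \<Longrightarrow> w \<notin> verts G \<Longrightarrow> half_plane_graph n (attach w j y G)"
proof (induction arbitrary: w rule: half_plane_graph.induct)
  case (drawn G)
  then show ?case by (intro half_plane_graph.drawn drawable_attach)
next
  case (contraction V m u v y' E)
  let ?G = "WGraph V m E" and ?f = "id(v := u)"
  note wfH = half_plane_wf[OF contraction.hyps]
  have uv: "u \<in> V" "v \<in> V" "finite V"
    using wf_graphD(4)[OF wfH, of "({u, v}, y')"] wf_graphD(1)[OF wfH] by simp_all
  have len: "length m = n" using wf_graphD(2)[OF wfH] by simp
  have wf: "wf_graph n (identify u v ?G)"
    unfolding identify_def by (rule wf_map_vertices) (use wfH in \<open>simp add: wf_graph_def\<close>)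
  obtain w2 where w2: "w2 \<notin> V" using uv(3) ex_new_if_finite[of V] by auto
  let ?e = "({m ! (j - 1), w2}, y)"
  have "half_plane_graph n (WGraph (insert w2 V) (m[j - 1 := w2]) (add_mset ({u, v}, y') (add_mset ?e E)))"
    using contraction.IH[OF contraction.prems(1,2), of w2] w2 by (simp add: attach_def add_mset_commute)
  then have "half_plane_graph n (identify u v (attach w2 j y ?G))"
    unfolding attach_def by (auto dest: half_plane_graph.contraction)
  also have "identify u v (attach w2 j y ?G) = attach w2 j y (identify u v ?G)"
  proof -
    have "?f w2 = w2" using w2 uv by auto
    then show ?thesis unfolding identify_def
      using attach_map[of ?G n j ?f w2 y] len contraction.prems(1,2) by simp
  qed
  finally have h: "half_plane_graph n (attach w2 j y (identify u v ?G))" .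
  have w2': "w2 \<notin> verts (identify u v ?G)" using w2 uv by auto
  note rel = attach_relabel[OF wf contraction.prems(1,2) w2' contraction.prems(3), of y]
  show ?case unfolding rel(1) by (rule half_plane_relabel[OF h rel(2)])
qed

section \<open>Planarity: blocks do not cross\<close>

text \<open>
  Two paths in the half-plane with interlacing end points on the boundary meet, by the Fashoda theorem in a
  large box that rests on the real line.
\<close>

lemma paths_interlace:
  fixes f g :: "real \<Rightarrow> complex"
  assumes f: "path f" "path_image f \<subseteq> {z. Im z \<ge> 0}" "Im (pathstart f) = 0" "Im (pathfinish f) = 0"
    and g: "path g" "path_image g \<subseteq> {z. Im z \<ge> 0}" "Im (pathstart g) = 0" "Im (pathfinish g) = 0"
    and "Re (pathstart f) < Re (pathstart g)" "Re (pathstart g) < Re (pathfinish f)"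
      "Re (pathfinish f) < Re (pathfinish g)"
  shows "path_image f \<inter> path_image g \<noteq> {}"
proof -
  define h :: "complex \<Rightarrow> real^2" where "h z = Re z *\<^sub>R axis 1 1 + Im z *\<^sub>R axis 2 1" for z
  have h: "h z $ 1 = Re z" "h z $ 2 = Im z" for z by (simp_all add: h_def axis_def)
  have hc: "continuous_on S h" for S unfolding h_def by (intro continuous_intros)
  have "bounded (path_image f \<union> path_image g)"
    using f(1) g(1) by (simp add: bounded_path_image)
  then obtain B where B: "\<And>z. z \<in> path_image f \<union> path_image g \<Longrightarrow> norm z \<le> B"
    unfolding bounded_iff by auto
  define a :: "real^2" where "a = (- B) *\<^sub>R axis 1 1"
  define b :: "real^2" where "b = B *\<^sub>R axis 1 1 + B *\<^sub>R axis 2 1"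
  have ab: "a $ 1 = - B" "a $ 2 = 0" "b $ 1 = B" "b $ 2 = B" by (simp_all add: a_def b_def axis_def)
  have box: "h z \<in> cbox a b" if "norm z \<le> B" "Im z \<ge> 0" for z
    using that abs_Re_le_cmod[of z] abs_Im_le_cmod[of z] unfolding mem_box_cart forall_2 h ab by linarith
  have 1: "path (h \<circ> f)" "path (h \<circ> g)" using f(1) g(1) hc by (auto intro: path_continuous_image)
  have 2: "path_image (h \<circ> f) \<subseteq> cbox a b" "path_image (h \<circ> g) \<subseteq> cbox a b"
    unfolding path_image_compose using B f(2) g(2) box by blast+
  obtain z where "z \<in> path_image (h \<circ> f)" "z \<in> path_image (h \<circ> g)"
    by (rule fashoda_interlace[OF 1 2]) (use assms in \<open>auto simp: pathstart_compose pathfinish_compose h ab\<close>)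
  then obtain x y where "x \<in> path_image f" "y \<in> path_image g" "h x = h y"
    unfolding path_image_compose by auto
  then show ?thesis using h by (metis complex_eqI disjoint_iff)
qed

definition adj :: "wgraph \<Rightarrow> (nat \<times> nat) set" where
  "adj G = {(a, b). \<exists>e\<in>#edges G. fst e = {a, b}}"

lemma sym_adj: "sym (adj G)"
  by (auto simp: adj_def sym_def insert_commute)

context
  fixes pos :: "nat \<Rightarrow> complex" and V I ends \<gamma> R
  assumes d: "drawn_arcs pos V I ends \<gamma>" and inj: "inj_on pos V"
    and R: "R = {(a, b). \<exists>i\<in>I. ends i = {a, b}}\<^sup>*"
begin

text \<open>
  The part of the drawing that belongs to the connected component of \<open>a\<close>.
\<close>

definition piece :: "nat \<Rightarrow> complex set" where
  "piece a = pos ` {v \<in> V. (a, v) \<in> R} \<union> \<Union> (path_image ` \<gamma> ` {i \<in> I. \<exists>b\<in>ends i. (a, b) \<in> R})"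

lemma R_sym: "(a, b) \<in> R \<Longrightarrow> (b, a) \<in> R"
proof -
  have "sym {(a, b). \<exists>i\<in>I. ends i = {a, b}}" by (auto simp: sym_def insert_commute)
  then show "(a, b) \<in> R \<Longrightarrow> (b, a) \<in> R" unfolding R by (meson sym_rtrancl symD)
qed

lemma R_trans: "(a, b) \<in> R \<Longrightarrow> (b, c) \<in> R \<Longrightarrow> (a, c) \<in> R"
  unfolding R by (rule rtrancl_trans)

lemma R_edge: "i \<in> I \<Longrightarrow> ends i = {b, c} \<Longrightarrow> (b, c) \<in> R"
  unfolding R by (rule r_into_rtrancl) blast

lemma piece_connected:
  assumes "a \<in> V" "(a, b) \<in> R"
  shows "b \<in> V \<and> path_component (piece a) (pos a) (pos b)"
  using assms(2)[unfolded R]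
proof (induction rule: rtrancl_induct)
  case base
  have "(a, a) \<in> R" by (simp add: R)
  then have "pos a \<in> piece a" using assms(1) unfolding piece_def by blast
  then show ?case using assms(1) by (simp add: path_component_refl)
next
  case (step b c)
  then obtain i where i: "i \<in> I" "ends i = {b, c}" by auto
  have ab: "(a, b) \<in> R" using step(1) R by simp
  obtain u v where uv: "u \<in> V" "v \<in> V" "{b, c} = {u, v}" "pathstart (\<gamma> i) = pos u" "pathfinish (\<gamma> i) = pos v"
    using drawn_arcsD(3)[OF d i(1)] i(2) by auto
  have p: "path (\<gamma> i)" using drawn_arcsD(1)[OF d i(1)] by (rule simple_path_imp_path)
  have "path_image (\<gamma> i) \<subseteq> piece a" unfolding piece_def using i ab by blast
  then have "path_component (piece a) (pos u) (pos v)"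
    using p uv unfolding path_component_def by blast
  then have "path_component (piece a) (pos b) (pos c)"
    using uv(3) by (metis doubleton_eq_iff path_component_sym)
  moreover have "c \<in> V" using uv by (metis doubleton_eq_iff)
  ultimately show ?case using step.IH path_component_trans by blast
qed

lemma piece_cases:
  assumes "x \<in> piece a"
  shows "(\<exists>v\<in>V. (a, v) \<in> R \<and> x = pos v) \<or> (\<exists>i\<in>I. \<exists>b\<in>ends i. (a, b) \<in> R \<and> x \<in> \<gamma> i ` {0<..<1})"
proof -
  consider v where "v \<in> V" "(a, v) \<in> R" "x = pos v" | i b where "i \<in> I" "b \<in> ends i" "(a, b) \<in> R" "x \<in> path_image (\<gamma> i)"
    using assms unfolding piece_def by blast
  then show ?thesis
  proof cases
    case (2 i b)
    obtain u v where uv: "u \<in> V" "v \<in> V" "ends i = {u, v}" "pathstart (\<gamma> i) = pos u" "pathfinish (\<gamma> i) = pos v"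
      using drawn_arcsD(3)[OF d 2(1)] by auto
    have "(u, v) \<in> R" by (rule R_edge[OF 2(1) uv(3)])
    then have av: "(a, u) \<in> R" "(a, v) \<in> R" using 2(2,3) uv(3) R_sym R_trans by (metis insertE singletonD)+
    obtain t where t: "t \<in> {0..1}" "x = \<gamma> i t" using 2(4) by (auto simp: path_image_def)
    consider "t = 0" | "t = 1" | "t \<in> {0<..<1}" using t(1) by fastforce
    then show ?thesis
    proof cases
      case 1 then show ?thesis using t uv av by (auto simp: pathstart_def)
    next
      case b: 2 then show ?thesis using t uv av by (auto simp: pathfinish_def)
    next
      case 3 then show ?thesis using t 2 by blast
    qed
  qed blast
qed

lemma pieces_meet:
  assumes "x \<in> piece a" "x \<in> piece b"
  shows "(a, b) \<in> R"
proof -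
  have no: False if "i \<in> I" "y \<in> \<gamma> i ` {0<..<1}" "y = pos v" "v \<in> V" for i y v
    using drawn_arcsD(4)[OF d that(1)] that by blast
  from piece_cases[OF assms(1)] show ?thesis
  proof (elim disjE bexE conjE)
    fix v assume v: "v \<in> V" "(a, v) \<in> R" "x = pos v"
    from piece_cases[OF assms(2)] show ?thesis
    proof (elim disjE bexE conjE)
      fix v' assume "v' \<in> V" "(b, v') \<in> R" "x = pos v'"
      then have "v' = v" using inj v by (auto dest: inj_onD)
      then show ?thesis using v \<open>(b, v') \<in> R\<close> R_sym R_trans by metis
    qed (use no v in blast)
  next
    fix i c assume i: "i \<in> I" "c \<in> ends i" "(a, c) \<in> R" "x \<in> \<gamma> i ` {0<..<1}"
    from piece_cases[OF assms(2)] show ?thesis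
    proof (elim disjE bexE conjE)
      fix k c' assume k: "k \<in> I" "c' \<in> ends k" "(b, c') \<in> R" "x \<in> \<gamma> k ` {0<..<1}"
      have "i = k" using drawn_arcsD(5)[OF d i(1) k(1)] i(4) k(4) by blast
      obtain u v where uv: "ends i = {u, v}" using drawn_arcsD(3)[OF d i(1)] by blast
      have "(u, v) \<in> R" by (rule R_edge[OF i(1) uv])
      then have "(c, c') \<in> R" using i(2) k(2) \<open>i = k\<close> uv R_sym R by auto
      then show ?thesis using i(3) k(3) R_sym R_trans by metis
    qed (use no i in blast)
  qed
qed

end

definition noncrossing_marks :: "nat \<Rightarrow> wgraph \<Rightarrow> bool" where
  "noncrossing_marks n G \<longleftrightarrow> (\<forall>i j k l. i < j \<and> j < k \<and> k < l \<and> l < n \<longrightarrow>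
     (marks G ! i, marks G ! k) \<in> (adj G)\<^sup>* \<longrightarrow> (marks G ! j, marks G ! l) \<in> (adj G)\<^sup>* \<longrightarrow>
     (marks G ! i, marks G ! j) \<in> (adj G)\<^sup>*)"

text \<open>
  If the components of \<open>i, k\<close> and of \<open>j, l\<close> interlace, paths inside them meet, and two pieces that meet belong to
  the same component.
\<close>

lemma drawable_noncrossing:
  assumes G: "drawable_in_half_plane n G"
  shows "noncrossing_marks n G"
proof -
  from drawableE[OF G] obtain pos I ed \<gamma> where 1: "finite (verts G)" "length (marks G) = n" "distinct (marks G)"
    "set (marks G) \<subseteq> verts G" "finite I" "edges G = image_mset ed (mset_set I)"
    "drawn_marks pos (verts G) (marks G)" "drawn_arcs pos (verts G) I (fst \<circ> ed) \<gamma>" .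
  define m where "m = marks G"
  define R where "R = (adj G)\<^sup>*"
  have adj: "adj G = {(a, b). \<exists>i\<in>I. (fst \<circ> ed) i = {a, b}}"
    using 1(5) by (auto simp: adj_def 1(6))
  have mn: "length m = n" using 1 by (simp add: m_def)
  have M: "inj_on pos (verts G)" "\<And>i. i < n \<Longrightarrow> Im (pos (m ! i)) = 0" "\<And>i k. i < k \<Longrightarrow> k < n \<Longrightarrow> Re (pos (m ! i)) < Re (pos (m ! k))"
    "\<And>v. v \<in> verts G - set m \<Longrightarrow> Im (pos v) > 0"
    using 1(7) mn unfolding drawn_marks_def m_def by auto
  have mV: "m ! i \<in> verts G" if "i < n" for i using 1(4) mn that nth_mem unfolding m_def by blast
  have posIm: "Im (pos v) \<ge> 0" if "v \<in> verts G" for v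
  proof (cases "v \<in> set m")
    case True then show ?thesis using M(2) mn by (metis in_set_conv_nth order_refl)
  next
    case False then show ?thesis using M(4)[of v] that by simp
  qed
  let ?K = "piece pos (verts G) I (fst \<circ> ed) \<gamma> R"
  note facts = 1(8) M(1) R_def[unfolded adj]
  have Kim: "?K a \<subseteq> {z. Im z \<ge> 0}" for a
    unfolding piece_def[OF facts] using posIm drawn_arcsD(2)[OF 1(8)] by blast
  have arc: "\<exists>f. path f \<and> path_image f \<subseteq> ?K (m ! i) \<and> pathstart f = pos (m ! i) \<and> pathfinish f = pos (m ! k)"
    if "(m ! i, m ! k) \<in> R" "i < n" for i k
    using piece_connected[OF facts mV[OF that(2)] that(1)] unfolding path_component_def by blast
  show ?thesis unfolding noncrossing_marks_def m_def[symmetric] R_def[symmetric]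
  proof (intro allI impI, elim conjE)
    fix i j k l assume ord: "i < j" "j < k" "k < l" "l < n" and r: "(m ! i, m ! k) \<in> R" "(m ! j, m ! l) \<in> R"
    obtain f where f: "path f" "path_image f \<subseteq> ?K (m ! i)" "pathstart f = pos (m ! i)" "pathfinish f = pos (m ! k)"
      using arc[OF r(1)] ord by auto
    obtain g where g: "path g" "path_image g \<subseteq> ?K (m ! j)" "pathstart g = pos (m ! j)" "pathfinish g = pos (m ! l)"
      using arc[OF r(2)] ord by auto
    have "path_image f \<inter> path_image g \<noteq> {}"
      by (rule paths_interlace[OF f(1) subset_trans[OF f(2) Kim] _ _ g(1) subset_trans[OF g(2) Kim]])
        (use ord M(2,3) in \<open>simp_all add: f(3,4) g(3,4)\<close>)
    then obtain x where "x \<in> path_image f" "x \<in> path_image g" by blast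
    then have "x \<in> ?K (m ! i)" "x \<in> ?K (m ! j)" using f(2) g(2) by auto
    then show "(m ! i, m ! j) \<in> R" by (rule pieces_meet[OF facts])
  qed
qed

text \<open>
  Contracting an edge does not change which boundary vertices are connected.
\<close>

lemma half_plane_noncrossing: "half_plane_graph n G \<Longrightarrow> noncrossing_marks n G"
proof (induction rule: half_plane_graph.induct)
  case (contraction V m u v y E)
  let ?f = "id(v := u)" and ?H = "WGraph V m (add_mset ({u, v}, y) E)" and ?G = "identify u v (WGraph V m E)"
  note wfH = half_plane_wf[OF contraction.hyps]
  have len: "length m = n" using wf_graphD(2)[OF wfH] by simp
  have up: "(a, ?f a) \<in> (adj ?H)\<^sup>*" for a
    by (auto simp: adj_def insert_commute intro!: r_into_rtrancl)
  have symH: "(a, b) \<in> (adj ?H)\<^sup>* \<Longrightarrow> (b, a) \<in> (adj ?H)\<^sup>*" for a b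
    using sym_adj by (meson sym_rtrancl symD)
  have adjG: "adj ?G = {(?f a, ?f b) |a b. (a, b) \<in> adj (WGraph V m E)}"
  proof (rule equalityI; rule subsetI)
    fix p assume "p \<in> adj ?G"
    then obtain x z e where p: "p = (x, z)" "e \<in># E" "?f ` fst e = {x, z}" by (auto simp: adj_def)
    obtain a b where ab: "fst e = {a, b}" using wf_graphD(5)[OF wfH, of e] p(2) by auto
    have "{?f a, ?f b} = {x, z}" by (rule p(3)[unfolded ab image_insert image_empty])
    moreover have "(a, b) \<in> adj (WGraph V m E)" "(b, a) \<in> adj (WGraph V m E)"
      using p(2) ab by (auto simp: adj_def insert_commute)
    ultimately show "p \<in> {(?f a, ?f b) |a b. (a, b) \<in> adj (WGraph V m E)}"
      using p(1) by (auto simp: doubleton_eq_iff simp del: fun_upd_apply)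
  next
    fix p assume "p \<in> {(?f a, ?f b) |a b. (a, b) \<in> adj (WGraph V m E)}"
    then obtain a b where p: "p = (?f a, ?f b)" "(a, b) \<in> adj (WGraph V m E)"
      by (elim CollectE exE conjE)
    then obtain e where e: "e \<in># E" "fst e = {a, b}" by (auto simp: adj_def)
    let ?e = "map_prod (image ?f) id e"
    have "?e \<in># edges ?G" using e(1) by (simp only: identify_sel wgraph.sel in_image_mset imageI)
    moreover have "fst ?e = {?f a, ?f b}" by (simp only: fst_map_prod e(2) image_insert image_empty)
    ultimately show "p \<in> adj ?G" unfolding adj_def p(1) by blast
  qed
  have "adj (WGraph V m E) \<subseteq> adj ?H" by (auto simp: adj_def)
  then have step: "(?f a, ?f b) \<in> (adj ?H)\<^sup>*" if "(a, b) \<in> adj (WGraph V m E)" for a b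
    by (rule rtrancl_trans[OF symH[OF up] rtrancl_trans[OF r_into_rtrancl up], OF subsetD[OF _ that]])
  have "adj ?G \<subseteq> (adj ?H)\<^sup>*"
  proof
    fix p assume "p \<in> adj ?G"
    then obtain a b where "p = (?f a, ?f b)" "(a, b) \<in> adj (WGraph V m E)"
      unfolding adjG by (elim CollectE exE conjE)
    then show "p \<in> (adj ?H)\<^sup>*" using step[of a b] by (simp only:)
  qed
  then have down: "(adj ?G)\<^sup>* \<subseteq> (adj ?H)\<^sup>*" by (metis rtrancl_idemp rtrancl_mono)
  have to_G: "(?f a, ?f b) \<in> (adj ?G)\<^sup>*" if "(a, b) \<in> (adj ?H)\<^sup>*" for a b
    using that
  proof (induction rule: rtrancl_induct)
    case (step b c)
    have "(?f b, ?f c) \<in> (adj ?G)\<^sup>*"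
    proof (cases "{b, c} = {u, v}")
      case True
      then have "?f b = ?f c" by (auto simp: doubleton_eq_iff)
      then show ?thesis by (simp del: fun_upd_apply)
    next
      case False
      then have "(b, c) \<in> adj (WGraph V m E)" using step(2) by (auto simp: adj_def)
      then show ?thesis unfolding adjG by blast
    qed
    then show ?case using step.IH by (rule rtrancl_trans[rotated])
  qed simp
  have iff: "(?f a, ?f b) \<in> (adj ?G)\<^sup>* \<longleftrightarrow> (a, b) \<in> (adj ?H)\<^sup>*" for a b
    using to_G rtrancl_trans[OF up rtrancl_trans[OF subsetD[OF down] symH[OF up]]] by (rule iffI[rotated])
  have mk: "marks ?G ! i = ?f (m ! i)" if "i < n" for i using that len by simp
  show ?case unfolding noncrossing_marks_def
  proof (intro allI impI, elim conjE)
    fix i j k l assume ord: "i < j" "j < k" "k < l" "l < n"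
      and c: "(marks ?G ! i, marks ?G ! k) \<in> (adj ?G)\<^sup>*" "(marks ?G ! j, marks ?G ! l) \<in> (adj ?G)\<^sup>*"
    have lt: "i < n" "j < n" "k < n" using ord by auto
    show "(marks ?G ! i, marks ?G ! j) \<in> (adj ?G)\<^sup>*"
      using contraction.IH c ord unfolding noncrossing_marks_def mk[OF lt(1)] mk[OF lt(2)] mk[OF lt(3)] mk[OF ord(4)] iff
      by (simp only: wgraph.sel)
  qed
qed (rule drawable_noncrossing)

lemma edgeless_noncrossing:
  assumes "half_plane_graph n (WGraph V m {#})" "i < j" "j < k" "k < l" "l < n" "m ! i = m ! k" "m ! j = m ! l"
  shows "m ! i = m ! j"
proof -
  have "adj (WGraph V m {#}) = {}" by (simp add: adj_def)
  then show ?thesis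
    using half_plane_noncrossing[OF assms(1)] assms(2-) unfolding noncrossing_marks_def by auto
qed

section \<open>Skein relations and edge operations\<close>

lemma linear_linear_extension: "linear (linear_extension f)"
proof -
  have ext: "linear_extension f x = (\<Sum>g\<in>A. Poly_Mapping.lookup x g *\<^sub>R formal (f g))"
    if "finite A" "Poly_Mapping.keys x \<subseteq> A" for x A
    unfolding linear_extension_def using that
    by (intro sum.mono_neutral_left) (auto simp: in_keys_iff)
  show ?thesis
  proof (rule linearI)
    fix x y :: "'a \<Rightarrow>\<^sub>0 real" and r
    let ?A = "Poly_Mapping.keys x \<union> Poly_Mapping.keys y"
    have "Poly_Mapping.keys (x + y) \<subseteq> ?A" by (rule Poly_Mapping.keys_add)
    then show "linear_extension f (x + y) = linear_extension f x + linear_extension f y"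
      by (simp add: ext[of ?A] lookup_add scaleR_add_left sum.distrib)
    have l: "Poly_Mapping.lookup (r *\<^sub>R x) g = r * Poly_Mapping.lookup x g" for g
      by (simp add: scaleR_poly_mapping.rep_eq)
    then have "Poly_Mapping.keys (r *\<^sub>R x) \<subseteq> Poly_Mapping.keys x"
      by (auto simp: in_keys_iff)
    then show "linear_extension f (r *\<^sub>R x) = r *\<^sub>R linear_extension f x"
      by (simp add: ext[of "Poly_Mapping.keys x"] l scaleR_sum_right)
  qed
qed

lemma linear_extension_formal [simp]: "linear_extension f (formal g) = formal (f g)"
  by (simp add: linear_extension_def)

lemma linear_image_span_subset:
  assumes "linear f" "\<And>x. x \<in> S \<Longrightarrow> f x \<in> span T" "y \<in> span S"
  shows "f y \<in> span T"
proof -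
  have "f ` span S \<subseteq> span T"
    unfolding linear_span_image[OF assms(1), symmetric] by (rule span_minimal) (use assms(2) in auto)
  then show ?thesis using assms(3) by blast
qed

definition graph_space :: "nat \<Rightarrow> (wgraph \<Rightarrow>\<^sub>0 real) set" where
  "graph_space n = span (formal ` {G. half_plane_graph n G})"

definition relation_space :: "real \<Rightarrow> nat \<Rightarrow> (wgraph \<Rightarrow>\<^sub>0 real) set" where
  "relation_space q n = span (skein_relators q n)"

lemma half_plane_smaller:
  assumes "half_plane_graph n (WGraph V m (add_mset e E))"
  shows "half_plane_graph n (WGraph V m E)"
  using half_plane_subgraph[OF assms, of V E] wf_graphD(3,4)[OF half_plane_wf[OF assms]]
  by auto

lemma half_plane_remove_isolated:
  assumes "half_plane_graph n (WGraph (insert v V) m E)" "v \<notin> set m" "\<forall>e\<in>#E. v \<notin> fst e"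
  shows "half_plane_graph n (WGraph V m E)"
proof -
  have wf: "wf_graph n (WGraph (insert v V) m E)" by (rule half_plane_wf[OF assms(1)])
  have "fst e \<subseteq> V" if "e \<in># E" for e
    using wf_graphD(4)[OF wf, of e] assms(3) that by auto
  then show ?thesis
    using half_plane_subgraph[OF assms(1), of V E] wf_graphD(3)[OF wf] assms(2) by auto
qed

lemma formal_in_graph_space: "half_plane_graph n G \<Longrightarrow> formal G \<in> graph_space n"
  unfolding graph_space_def by (intro span_base) simp

lemma subspace_graph_space: "subspace (graph_space n)"
  unfolding graph_space_def by (rule subspace_span)

lemma subspace_relation_space: "subspace (relation_space q n)"
  unfolding relation_space_def by (rule subspace_span)

lemma relator_in_relation_space: "r \<in> skein_relators q n \<Longrightarrow> r \<in> relation_space q n"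
  unfolding relation_space_def by (rule span_base)

lemma relation_subset_graph: "relation_space q n \<subseteq> graph_space n"
proof -
  have "r \<in> graph_space n" if "r \<in> skein_relators q n" for r
    using that
  proof cases
    case (relabel G f)
    then show ?thesis
      by (auto intro!: subspace_diff[OF subspace_graph_space] formal_in_graph_space half_plane_relabel)
  next
    case (edge V m u v y E)
    then show ?thesis
      by (auto intro!: subspace_diff[OF subspace_graph_space] subspace_add[OF subspace_graph_space]
          subspace_scale[OF subspace_graph_space] formal_in_graph_space half_plane_smaller[OF edge(2)]
          half_plane_graph.contraction[OF edge(2)])
  next
    case (isolated v V m E)
    show ?thesis unfolding isolated(1)
      by (intro subspace_diff[OF subspace_graph_space] subspace_scale[OF subspace_graph_space]
          formal_in_graph_space half_plane_remove_isolated[OF isolated(2,4,5)] isolated(2))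
  qed
  then show ?thesis unfolding relation_space_def
    by (intro span_minimal subspace_graph_space) auto
qed

lemma relabel_relation:
  "half_plane_graph n G \<Longrightarrow> inj_on f (verts G) \<Longrightarrow> formal G - formal (map_vertices f G) \<in> relation_space q n"
  by (intro relator_in_relation_space skein_relators.relabel)

lemma adjoin_edge_preserves:
  assumes j: "1 \<le> j" "j < n" and r: "r \<in> relation_space q n"
  shows "linear_extension (adjoin_edge j y) r \<in> relation_space q n"
  unfolding relation_space_def
proof (rule linear_image_span_subset[OF linear_linear_extension _ r[unfolded relation_space_def]], rule span_base)
  note lin = linear_diff[OF linear_linear_extension] linear_add[OF linear_linear_extension]
    linear_scale[OF linear_linear_extension]
  fix r assume "r \<in> skein_relators q n"
  then show "linear_extension (adjoin_edge j y) r \<in> skein_relators q n"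
  proof cases
    case (relabel G f)
    have len: "length (marks G) = n" by (rule wf_graphD(2)[OF half_plane_wf[OF relabel(2)]])
    show ?thesis unfolding relabel(1)
      using skein_relators.relabel[OF half_plane_adjoin_edge[OF relabel(2) j], of f y q] relabel(3)
      by (simp add: lin adjoin_edge_map[OF len j]) (simp add: adjoin_edge_def)
  next
    case (edge V m u v y' E)
    let ?e = "({m ! (j - 1), m ! j}, y)"
    have len: "length m = n" using wf_graphD(2)[OF half_plane_wf[OF edge(2)]] by simp
    have a: "adjoin_edge j y (WGraph V m X) = WGraph V m (add_mset ?e X)" for X by (simp add: adjoin_edge_def)
    have b: "adjoin_edge j y (identify u v (WGraph V m E)) = identify u v (WGraph V m (add_mset ?e E))"
      unfolding identify_def using adjoin_edge_map[of "WGraph V m E" n j y] len j by (simp add: a)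
    have h: "half_plane_graph n (WGraph V m (add_mset ({u, v}, y') (add_mset ?e E)))"
      using half_plane_adjoin_edge[OF edge(2) j, of y] by (simp add: a add_mset_commute)
    show ?thesis unfolding edge(1) lin linear_extension_formal a b add_mset_commute[of ?e]
      by (rule skein_relators.edge[OF h])
  next
    case (isolated v V m E)
    let ?e = "({m ! (j - 1), m ! j}, y)"
    have len: "length m = n" using wf_graphD(2)[OF half_plane_wf[OF isolated(2)]] by simp
    have a: "adjoin_edge j y (WGraph X m E) = WGraph X m (add_mset ?e E)" for X by (simp add: adjoin_edge_def)
    have "m ! (j - 1) \<in> set m" "m ! j \<in> set m" using len j by auto
    then have e: "\<forall>e\<in>#add_mset ?e E. v \<notin> fst e" using isolated(4,5) by auto
    show ?thesis unfolding isolated(1) lin linear_extension_formal a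
      by (rule skein_relators.isolated[OF _ isolated(3,4) e])
        (use half_plane_adjoin_edge[OF isolated(2) j, of y] in \<open>simp add: a\<close>)
  qed
qed

text \<open>
  The two graphs differ by the name of the new vertex only.
\<close>

lemma adjoin_boundary_vertex_attach:
  assumes "half_plane_graph n G" "1 \<le> j" "j \<le> n" "w \<notin> verts G"
  shows "formal (adjoin_boundary_vertex j y G) - formal (attach w j y G) \<in> relation_space q n"
proof -
  let ?w = "LEAST w. w \<notin> verts G"
  note wf = half_plane_wf[OF assms(1)]
  have w: "?w \<notin> verts G" using assms(4) by (rule LeastI)
  have "adjoin_boundary_vertex j y G = attach ?w j y G"
    by (simp add: adjoin_boundary_vertex_def attach_def Let_def)
  then show ?thesis
    using relabel_relation[OF half_plane_attach[OF assms(1-3) w] attach_relabel(2)[OF wf assms(2,3) w assms(4)]]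
      attach_relabel(1)[OF wf assms(2,3) w assms(4)] by simp
qed

lemma adjoin_boundary_vertex_preserves:
  assumes j: "1 \<le> j" "j \<le> n" and r: "r \<in> relation_space q n"
  shows "linear_extension (adjoin_boundary_vertex j y) r \<in> relation_space q n"
  unfolding relation_space_def
proof (rule linear_image_span_subset[OF linear_linear_extension _ r[unfolded relation_space_def]])
  let ?L = "linear_extension (adjoin_boundary_vertex j y)"
  note lin = linear_diff[OF linear_linear_extension] linear_add[OF linear_linear_extension]
    linear_scale[OF linear_linear_extension]
  note U = subspace_relation_space[of q n]
  have L: "?L (formal G) - formal (attach w j y G) \<in> relation_space q n"
    if "half_plane_graph n G" "w \<notin> verts G" for G w
    using adjoin_boundary_vertex_attach[OF that(1) j that(2)] by simp
  fix r assume "r \<in> skein_relators q n"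
  then have "?L r \<in> relation_space q n"
  proof cases
    case (relabel G f)
    note wf = half_plane_wf[OF relabel(2)]
    have "finite (verts G \<union> f ` verts G)" using wf_graphD(1)[OF wf] by simp
    then obtain w where w: "w \<notin> verts G" "w \<notin> f ` verts G" by (metis UnCI ex_new_if_finite infinite_UNIV_nat)
    let ?f = "f(w := w)"
    have map: "map_vertices f G = map_vertices ?f G" by (rule map_vertices_cong[OF wf]) (use w in auto)
    have att: "attach w j y (map_vertices f G) = map_vertices ?f (attach w j y G)"
      unfolding map using attach_map[OF wf_graphD(2)[OF wf] j, of ?f w y] by simp
    have inj: "inj_on ?f (verts (attach w j y G))"
      using relabel(3) w unfolding attach_def by (auto simp: inj_on_def)
    have "formal (attach w j y G) - formal (attach w j y (map_vertices f G)) \<in> relation_space q n"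
      unfolding att by (rule relabel_relation[OF half_plane_attach[OF relabel(2) j w(1)] inj])
    from subspace_diff[OF U subspace_add[OF U L[OF relabel(2) w(1)] this] L[OF half_plane_relabel[OF relabel(2,3)], of w]] w(2)
    show ?thesis unfolding relabel(1) lin by simp
  next
    case (edge V m u v y' E)
    let ?G1 = "WGraph V m (add_mset ({u, v}, y') E)" and ?G2 = "WGraph V m E"
    let ?G3 = "identify u v ?G2"
    note wfH = half_plane_wf[OF edge(2)]
    have uv: "u \<in> V" "v \<in> V" "finite V"
      using wf_graphD(4)[OF wfH, of "({u, v}, y')"] wf_graphD(1)[OF wfH] by simp_all
    have len: "length m = n" using wf_graphD(2)[OF wfH] by simp
    obtain w where w: "w \<notin> V" using uv(3) ex_new_if_finite[of V] by auto
    then have w3: "w \<notin> verts ?G3" using uv by auto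
    let ?e = "({m ! (j - 1), w}, y)" and ?m = "m[j - 1 := w]" and ?V = "insert w V"
    have a: "attach w j y (WGraph V m X) = WGraph ?V ?m (add_mset ?e X)" for X by (simp add: attach_def)
    have fw: "(id(v := u)) w = w" using w uv by auto
    have b: "attach w j y ?G3 = identify u v (WGraph ?V ?m (add_mset ?e E))"
      unfolding identify_def a[symmetric]
      using attach_map[of ?G2 n j "id(v := u)" w y, unfolded fw] len j by simp
    have h: "half_plane_graph n (WGraph ?V ?m (add_mset ({u, v}, y') (add_mset ?e E)))"
      using half_plane_attach[OF edge(2) j, of w y] w by (simp add: a add_mset_commute)
    have 1: "formal (attach w j y ?G1) - (formal (attach w j y ?G2) + (y' - 1) *\<^sub>R formal (attach w j y ?G3)) \<in> relation_space q n"
      unfolding a b add_mset_commute[of ?e] by (rule relator_in_relation_space, rule skein_relators.edge[OF h])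
    have 2: "?L (formal ?G1) - formal (attach w j y ?G1) \<in> relation_space q n"
      "?L (formal ?G2) - formal (attach w j y ?G2) \<in> relation_space q n"
      "?L (formal ?G3) - formal (attach w j y ?G3) \<in> relation_space q n"
      by (rule L; use edge(2) half_plane_smaller[OF edge(2)] half_plane_graph.contraction[OF edge(2)] w w3 in simp)+
    have "?L r = (?L (formal ?G1) - formal (attach w j y ?G1)) - (?L (formal ?G2) - formal (attach w j y ?G2))
      - (y' - 1) *\<^sub>R (?L (formal ?G3) - formal (attach w j y ?G3))
      + (formal (attach w j y ?G1) - (formal (attach w j y ?G2) + (y' - 1) *\<^sub>R formal (attach w j y ?G3)))"
      unfolding edge(1) lin by (simp add: scaleR_right_diff_distrib)
    then show ?thesis using subspace_add[OF U subspace_diff[OF U subspace_diff[OF U 2(1,2)] subspace_scale[OF U 2(3)]] 1]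
      by simp
  next
    case (isolated v V m E)
    let ?G1 = "WGraph (insert v V) m E" and ?G2 = "WGraph V m E"
    note wfH = half_plane_wf[OF isolated(2)]
    have fin: "finite (insert v V)" using wf_graphD(1)[OF wfH] by simp
    have len: "length m = n" using wf_graphD(2)[OF wfH] by simp
    obtain w where w: "w \<notin> insert v V" using fin ex_new_if_finite[of "insert v V"] by auto
    let ?e = "({m ! (j - 1), w}, y)" and ?m = "m[j - 1 := w]"
    have a: "attach w j y (WGraph X m E) = WGraph (insert w X) ?m (add_mset ?e E)" for X by (simp add: attach_def)
    have "m ! (j - 1) \<in> set m" using len j by auto
    then have e: "\<forall>e\<in>#add_mset ?e E. v \<notin> fst e" using isolated(4,5) w by auto
    have m: "v \<notin> set ?m" using set_update_subset_insert[of m "j - 1" w] isolated(4) w by auto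
    have h: "half_plane_graph n (WGraph (insert v (insert w V)) ?m (add_mset ?e E))"
      using half_plane_attach[OF isolated(2) j, of w y] w by (simp add: a insert_commute)
    have 1: "formal (attach w j y ?G1) - q *\<^sub>R formal (attach w j y ?G2) \<in> relation_space q n"
      unfolding a insert_commute[of w v]
      by (rule relator_in_relation_space, rule skein_relators.isolated[OF h]) (use isolated(3) w m e in auto)
    have 2: "?L (formal ?G1) - formal (attach w j y ?G1) \<in> relation_space q n"
      "?L (formal ?G2) - formal (attach w j y ?G2) \<in> relation_space q n"
      by (rule L; use isolated half_plane_remove_isolated[OF isolated(2)] w in simp)+
    have "?L r = (?L (formal ?G1) - formal (attach w j y ?G1)) - q *\<^sub>R (?L (formal ?G2) - formal (attach w j y ?G2))
      + (formal (attach w j y ?G1) - q *\<^sub>R formal (attach w j y ?G2))"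
      unfolding isolated(1) lin by (simp add: scaleR_right_diff_distrib)
    then show ?thesis using subspace_add[OF U subspace_diff[OF U 2(1) subspace_scale[OF U 2(2)]] 1]
      by simp
  qed
  then show "?L r \<in> span (skein_relators q n)" by (simp add: relation_space_def)
qed

lemma adjoin_edge_expand:
  assumes "half_plane_graph n G" "1 \<le> j" "j < n"
  shows "formal (adjoin_edge j y G) - (formal G + (y - 1) *\<^sub>R formal (identify (marks G ! (j - 1)) (marks G ! j) G))
    \<in> relation_space q n"
  using skein_relators.edge[of n "verts G" "marks G" "marks G ! (j - 1)" "marks G ! j" y "edges G" q]
    half_plane_adjoin_edge[OF assms, of y]
  by (intro relator_in_relation_space) (simp add: adjoin_edge_def)

text \<open>
  The graph obtained from \<open>attach\<close> by deleting the new edge: the old boundary vertex has become interior and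
  \<open>w\<close> is an isolated boundary vertex.
\<close>

definition detach :: "nat \<Rightarrow> nat \<Rightarrow> wgraph \<Rightarrow> wgraph" where
  "detach w j G = WGraph (insert w (verts G)) ((marks G)[j - 1 := w]) (edges G)"

lemma half_plane_detach:
  assumes "half_plane_graph n G" "1 \<le> j" "j \<le> n" "w \<notin> verts G"
  shows "half_plane_graph n (detach w j G)"
  using half_plane_smaller[OF half_plane_attach[OF assms, of 1, unfolded attach_def]]
  by (simp add: detach_def)

text \<open>
  Contracting the new edge gives back the graph \<open>G\<close>.
\<close>

lemma attach_expand:
  assumes "half_plane_graph n G" "1 \<le> j" "j \<le> n" "w \<notin> verts G"
  shows "formal (attach w j y G) - (formal (detach w j G) + (y - 1) *\<^sub>R formal G) \<in> relation_space q n"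
proof -
  let ?u = "marks G ! (j - 1)"
  note wf = half_plane_wf[OF assms(1)]
  have uV: "?u \<in> verts G" using wf_graphD(6)[OF wf, of "j - 1"] assms(2,3) by simp
  have "map_vertices (id(w := ?u)) (WGraph (verts G) (marks G) (edges G)) = WGraph (verts G) (marks G) (edges G)"
    by (rule map_vertices_id[of n]) (use wf assms(4) in auto)
  then have "identify ?u w (detach w j G) = G"
    unfolding identify_def detach_def map_vertices_WGraph using uV
    by (cases G) (simp add: map_update del: fun_upd_apply, auto)
  then show ?thesis
    using skein_relators.edge[of n "verts (detach w j G)" "marks (detach w j G)" ?u w y "edges G" q]
      half_plane_attach[OF assms, of y]
    by (intro relator_in_relation_space) (simp add: attach_def detach_def)
qed

section \<open>Noncrossing partitions\<close>

text \<open>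
  Think of \<open>c\<close> as the labelling of a noncrossing partition of \<open>0, \<dots>, N\<close>. Two joined points of the left half
  would enclose, between them, a singleton or two joined neighbours, which is excluded; so the left points lie in
  different blocks, each has a partner in the right half, and by planarity the partners descend as the left points
  ascend. There is room for only one such arrangement.
\<close>

lemma rainbow_kernel:
  fixes c :: "nat \<Rightarrow> 'b"
  assumes nc: "\<And>i j k l. i < j \<Longrightarrow> j < k \<Longrightarrow> k < l \<Longrightarrow> l \<le> N \<Longrightarrow> c i = c k \<Longrightarrow> c j = c l \<Longrightarrow> c i = c j"
    and ns: "\<And>a. 2 * a < N \<Longrightarrow> \<exists>l\<le>N. l \<noteq> a \<and> c l = c a"
    and na: "\<And>a. 2 * a + 1 < N \<Longrightarrow> c a \<noteq> c (Suc a)"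
    and ik: "i \<le> N" "k \<le> N"
  shows "c i = c k \<longleftrightarrow> i = k \<or> i + k = N"
proof -
  have left: "i < k \<Longrightarrow> 2 * k \<le> N \<Longrightarrow> c i \<noteq> c k" for i k
  proof (induction "k - i" arbitrary: i k rule: less_induct)
    case less
    have adj: "c i \<noteq> c (Suc i)" using na[of i] less.prems by simp
    show ?case
    proof
      assume eq: "c i = c k"
      then have k: "Suc i < k" using adj less.prems by (metis Suc_lessI)
      then obtain l where l: "l \<le> N" "l \<noteq> Suc i" "c l = c (Suc i)" using ns[of "Suc i"] less.prems by auto
      have "l \<noteq> i" "l \<noteq> k" using l adj eq by auto
      moreover have "\<not> k < l" using nc[of i "Suc i" k l] k l eq adj by auto
      moreover have "\<not> l < i" using nc[of l i "Suc i" k] k l eq adj less.prems by auto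
      ultimately have "Suc i < l" "l < k" using l by auto
      then have "l - Suc i < k - i" by arith
      then show False
        using less.hyps[of l "Suc i"] l less.prems \<open>Suc i < l\<close> \<open>l < k\<close> by auto
    qed
  qed
  have right: "N < 2 * l" if "2 * a < N" "l \<noteq> a" "c l = c a" for a l
  proof (rule ccontr)
    assume "\<not> N < 2 * l"
    then show False using left[of l a] left[of a l] that by (cases "l < a") auto
  qed
  have dec: "l' < l" if "a < b" "2 * b < N" "l \<noteq> a" "c l = c a" "l' \<noteq> b" "c l' = c b" "l' \<le> N" "l \<le> N" for a b l l'
  proof (rule ccontr)
    assume "\<not> l' < l"
    have ab: "c a \<noteq> c b" using left[of a b] that by simp
    have "N < 2 * l" using right[of a l] that by simp
    then have "b < l" using that by simp
    moreover have "l \<noteq> l'" using ab that by auto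
    ultimately show False using nc[of a b l l'] \<open>\<not> l' < l\<close> ab that by auto
  qed
  have upper: "l \<le> N - a" if "2 * a < N" "l \<le> N" "l \<noteq> a" "c l = c a" for a l
    using that
  proof (induction a arbitrary: l)
    case (Suc a)
    obtain l' where l': "l' \<le> N" "l' \<noteq> a" "c l' = c a" using ns[of a] Suc.prems by auto
    have "l < l'" by (rule dec[of a "Suc a"]) (use Suc.prems l' in auto)
    moreover have "l' \<le> N - a" using Suc.IH l' Suc.prems by simp
    ultimately show ?case by simp
  qed simp
  have lower: "N - a \<le> l" if "2 * a < N" "l \<le> N" "l \<noteq> a" "c l = c a" for a l
    using that
  proof (induction "N - 2 * a" arbitrary: a l rule: less_induct)
    case less
    show ?case
    proof (cases "2 * Suc a < N")
      case True
      obtain l' where l': "l' \<le> N" "l' \<noteq> Suc a" "c l' = c (Suc a)" using ns[OF True] by auto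
      have "l' < l" by (rule dec[of a "Suc a"]) (use less.prems l' True in auto)
      moreover have "N - Suc a \<le> l'" by (rule less.hyps) (use True l' less.prems in auto)
      ultimately show ?thesis by simp
    next
      case False
      then show ?thesis using right[of a l] less.prems by auto
    qed
  qed
  have main: "c l = c a \<longleftrightarrow> l = N - a" if "2 * a < N" "l \<le> N" "l \<noteq> a" for a l
  proof
    assume "c l = c a"
    then show "l = N - a" using upper[of a l] lower[of a l] that by simp
  next
    assume "l = N - a"
    moreover obtain l' where l': "l' \<le> N" "l' \<noteq> a" "c l' = c a" using ns[of a] \<open>2 * a < N\<close> by auto
    ultimately show "c l = c a" using upper[of a l'] lower[of a l'] that by simp
  qed
  show ?thesis
  proof (cases "i = k")
    case neq: False
    consider "2 * i < N" | "2 * k < N" | "2 * i \<ge> N" "2 * k \<ge> N" by linarith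
    then show ?thesis
    proof cases
      case 1
      then show ?thesis using main[of i k] neq ik by auto
    next
      case 2
      then show ?thesis using main[of k i] neq ik by auto
    next
      case 3
      have "c i \<noteq> c k"
      proof
        assume eq: "c i = c k"
        show False
        proof (cases "2 * i = N")
          case False
          then have "c i = c (N - i)" using main[of "N - i" i] 3 ik by auto
          then show False using main[of "N - i" k] 3 ik eq neq False by auto
        next
          case True
          then have "c k = c (N - k)" using main[of "N - k" k] 3 ik neq by auto
          moreover have "2 * (N - k) < N" "i \<noteq> N - k" "N - (N - k) = k" using True 3 ik neq by auto
          ultimately show False using main[of "N - k" i] ik eq neq by auto
        qed
      qed
      then show ?thesis using 3 neq by auto
    qed
  qed simp
qed

text \<open>
  Every class of the skein space is a combination of graphs that have no edges and only boundary vertices. Such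
  a graph is a partition, recorded as an equivalence relation (kernel) on the positions \<open>i < n\<close>, counted from \<open>0\<close>.
\<close>

definition edgeless :: "nat list \<Rightarrow> wgraph" where
  "edgeless m = WGraph (set m) m {#}"

type_synonym kernel = "nat \<Rightarrow> nat \<Rightarrow> bool"

definition join_blocks :: "nat \<Rightarrow> kernel \<Rightarrow> kernel" where
  "join_blocks a K i k \<longleftrightarrow> K i k \<or> ((K i a \<or> K i (Suc a)) \<and> (K k a \<or> K k (Suc a)))"

definition make_singleton :: "nat \<Rightarrow> kernel \<Rightarrow> kernel" where
  "make_singleton a K i k \<longleftrightarrow> i = k \<or> (i \<noteq> a \<and> k \<noteq> a \<and> K i k)"

lemma join_prop1: "(A \<or> B \<and> (C \<or> D)) \<or> (A' \<or> B \<and> (C' \<or> D')) \<longleftrightarrow> (A \<or> A') \<or> B \<and> (C \<or> D \<or> C' \<or> D')"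
  by blast

lemma join_prop2: "(A \<or> B \<and> (C \<or> D)) \<or> (A' \<or> B \<and> (C' \<or> D')) \<longleftrightarrow> (A \<or> A') \<or> B \<and> (C \<or> C' \<or> D \<or> D')"
  by blast

text \<open>
  Merging two pairs of labels in either order. The two sides agree by propositional reasoning once it is
  abstracted whether the two pairs have a label in common.
\<close>

lemma join_values: fixes x y p q r s :: 'b
  shows "(((x = y \<or> (x = r \<or> x = s) \<and> (y = r \<or> y = s)) \<or>
    ((x = p \<or> (x = r \<or> x = s) \<and> (p = r \<or> p = s)) \<or> (x = q \<or> (x = r \<or> x = s) \<and> (q = r \<or> q = s))) \<and>
    ((y = p \<or> (y = r \<or> y = s) \<and> (p = r \<or> p = s)) \<or> (y = q \<or> (y = r \<or> y = s) \<and> (q = r \<or> q = s))))) =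
   ((x = y \<or> (x = p \<or> x = q) \<and> (y = p \<or> y = q)) \<or>
    ((x = r \<or> (x = p \<or> x = q) \<and> (r = p \<or> r = q)) \<or> (x = s \<or> (x = p \<or> x = q) \<and> (s = p \<or> s = q))) \<and>
    ((y = r \<or> (y = p \<or> y = q) \<and> (r = p \<or> r = q)) \<or> (y = s \<or> (y = p \<or> y = q) \<and> (s = p \<or> s = q))))"
proof -
  define m where "m \<longleftrightarrow> p = r \<or> p = s \<or> q = r \<or> q = s"
  have 1: "(x = p \<or> (x = r \<or> x = s) \<and> (p = r \<or> p = s)) \<or> (x = q \<or> (x = r \<or> x = s) \<and> (q = r \<or> q = s))
    \<longleftrightarrow> (x = p \<or> x = q) \<or> (x = r \<or> x = s) \<and> m" for x
    unfolding m_def by (rule join_prop1)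
  have 2: "(x = r \<or> (x = p \<or> x = q) \<and> (r = p \<or> r = q)) \<or> (x = s \<or> (x = p \<or> x = q) \<and> (s = p \<or> s = q))
    \<longleftrightarrow> (x = r \<or> x = s) \<or> (x = p \<or> x = q) \<and> m" for x
    unfolding m_def eq_commute[of r] eq_commute[of s] by (rule join_prop2)
  have 3: "((e \<or> Bx \<and> By) \<or> (Ax \<or> Bx \<and> m) \<and> (Ay \<or> By \<and> m)) \<longleftrightarrow>
    ((e \<or> Ax \<and> Ay) \<or> (Bx \<or> Ax \<and> m) \<and> (By \<or> Ay \<and> m))" for e Ax Ay Bx By
    by blast
  show ?thesis unfolding 1 2 by (rule 3)
qed

lemma kernel_join_join:
  assumes "(\<And>i k. i < n \<Longrightarrow> k < n \<Longrightarrow> K i k \<longleftrightarrow> (c i::'b) = c k)" "Suc a < n" "Suc b < n" "i < n" "k<n"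
 shows "(join_blocks a (join_blocks b K)) i k = (join_blocks b (join_blocks a K)) i k"
 using assms(2-) unfolding join_blocks_def make_singleton_def by (simp only: assms(1) Suc_lessD) (rule join_values)

lemma kernel_single_join_single:
  assumes "(\<And>i k. i < n \<Longrightarrow> k < n \<Longrightarrow> K i k \<longleftrightarrow> (c i::'b) = c k)" "Suc a < n" "b = a \<or> b = Suc a" "i < n" "k<n"
 shows "(make_singleton b (join_blocks a (make_singleton b K))) i k = (make_singleton b K) i k"
 using assms(2-) unfolding join_blocks_def make_singleton_def
 by (simp only: assms(1) Suc_lessD) (auto simp: assms(1))

lemma join_single_refl:
  assumes c: "(\<And>i k. i < n \<Longrightarrow> k < n \<Longrightarrow> K i k \<longleftrightarrow> (c i::'b) = c k)" and "Suc a < n" "b = a \<or> b = Suc a" "i < n" "k<n"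
   "K a (Suc a)"
 shows "(join_blocks a (make_singleton b K)) i k = K i k"
proof -
  have n: "a < n" using assms by simp
  have ca: "c (Suc a) = c a" using c[OF n assms(2)] assms(6) by simp
  have 1: "K i k \<longleftrightarrow> c i = c k" "K i a \<longleftrightarrow> c i = c a" "K i (Suc a) \<longleftrightarrow> c i = c a" "K k a \<longleftrightarrow> c k = c a" "K k (Suc a) \<longleftrightarrow> c k = c a"
    using c assms n ca by simp_all
  show ?thesis
    using assms(3) unfolding join_blocks_def make_singleton_def 1
    by (elim disjE; cases "i = a"; cases "k = a"; cases "i = Suc a"; cases "k = Suc a"; auto simp: ca)
qed

lemma kernel_join_single_join:
  assumes "(\<And>i k. i < n \<Longrightarrow> k < n \<Longrightarrow> K i k \<longleftrightarrow> (c i::'b) = c k)" "Suc a < n" "b = a \<or> b = Suc a" "i < n" "k<n"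
 shows "(join_blocks a (make_singleton b (join_blocks a K))) i k = (join_blocks a K) i k"
proof (rule join_single_refl[where c = "\<lambda>i. if c i = c (Suc a) then c a else c i"])
  show "join_blocks a K a (Suc a)" using assms by (simp add: join_blocks_def)
  fix i k assume ik: "i < n" "k < n"
  have "K i k \<longleftrightarrow> c i = c k" "K i a \<longleftrightarrow> c i = c a" "K i (Suc a) \<longleftrightarrow> c i = c (Suc a)" "K k a \<longleftrightarrow> c k = c a" "K k (Suc a) \<longleftrightarrow> c k = c (Suc a)"
    using assms ik by simp_all
  then show "join_blocks a K i k \<longleftrightarrow> (if c i = c (Suc a) then c a else c i) = (if c k = c (Suc a) then c a else c k)"
    unfolding join_blocks_def by auto
qed (use assms in auto)

lemma kernel_join_single:
  assumes "(\<And>i k. i < n \<Longrightarrow> k < n \<Longrightarrow> K i k \<longleftrightarrow> (c i::'b) = c k)" "Suc a < n" "b < n" "b \<noteq> a" "b \<noteq> Suc a" "i < n" "k<n"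
 shows "(join_blocks a (make_singleton b K)) i k = (make_singleton b (join_blocks a K)) i k"
 using assms(2-) unfolding join_blocks_def make_singleton_def by (simp only: assms(1) Suc_lessD) (auto)

lemma kernel_single_single:
  assumes "(\<And>i k. i < n \<Longrightarrow> k < n \<Longrightarrow> K i k \<longleftrightarrow> (c i::'b) = c k)" "a < n" "b < n" "i < n" "k<n"
 shows "(make_singleton a (make_singleton b K)) i k = (make_singleton b (make_singleton a K)) i k"
 using assms(2-) unfolding join_blocks_def make_singleton_def by (simp only: assms(1) Suc_lessD) (auto)

section \<open>The Temperley-Lieb action on the skein space\<close>

text \<open>
  A linear projection of the formal combinations of graphs onto a complement of the relations in the space of
  half-plane graphs. Its range is a copy of the skein space, on which operators can be multiplied as honest linear
  maps instead of maps of cosets.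
\<close>

locale skein_projection =
  fixes q :: real and n :: nat and \<pi> :: "wgraph endo"
  assumes q4: "q \<ge> 4" and n1: "n \<ge> 1"
    and \<pi>_U: "r \<in> relation_space q n \<Longrightarrow> app \<pi> r = 0"
    and \<pi>_W: "x \<in> graph_space n \<Longrightarrow> app \<pi> x - x \<in> relation_space q n"
    and \<pi>_range: "app \<pi> x \<in> graph_space n"
    and \<pi>_idem: "\<pi> * \<pi> = \<pi>"
begin

lemma \<pi>_cong: "x - y \<in> relation_space q n \<Longrightarrow> app \<pi> x = app \<pi> y"
  using \<pi>_U[of "x - y"] by (simp add: app_linear)

definition vec :: "wgraph \<Rightarrow> (wgraph \<Rightarrow>\<^sub>0 real)" where "vec G = app \<pi> (formal G)"

definition op :: "(wgraph \<Rightarrow> wgraph) \<Rightarrow> wgraph endo" where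
  "op f = \<pi> * Endo (linear_extension f) * \<pi>"

lemma op_\<pi>: "\<pi> * op f = op f" "op f * \<pi> = op f"
  unfolding op_def using \<pi>_idem by (metis mult.assoc)+

lemma op_vec:
  assumes "half_plane_graph n G" "\<And>r. r \<in> relation_space q n \<Longrightarrow> linear_extension f r \<in> relation_space q n"
  shows "app (op f) (formal G) = app \<pi> (formal (f G))" "app (op f) (vec G) = app \<pi> (formal (f G))"
proof -
  have "linear_extension f (app \<pi> (formal G) - formal G) \<in> relation_space q n"
    by (intro assms \<pi>_W formal_in_graph_space)
  then have "linear_extension f (app \<pi> (formal G)) - formal (f G) \<in> relation_space q n"
    by (simp add: linear_diff[OF linear_linear_extension])
  from \<pi>_cong[OF this] show 1: "app (op f) (formal G) = app \<pi> (formal (f G))"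
    by (simp add: op_def app_Endo linear_linear_extension)
  have "app (op f) (vec G) = app (op f * \<pi>) (formal G)" by (simp add: vec_def)
  then show "app (op f) (vec G) = app \<pi> (formal (f G))" using 1 by (simp only: op_\<pi>)
qed

lemma op_adjoin_edge:
  assumes "half_plane_graph n G" "Suc a < n"
  shows "app (op (adjoin_edge (Suc a) y)) (vec G)
    = vec G + (y - 1) *\<^sub>R vec (identify (marks G ! a) (marks G ! Suc a) G)"
  using op_vec(2)[OF assms(1), of "adjoin_edge (Suc a) y"] adjoin_edge_preserves[of "Suc a" n _ q y] assms(2)
    \<pi>_cong[OF adjoin_edge_expand[OF assms(1), of "Suc a" y]] by (simp add: vec_def app_linear)

lemma op_attach:
  assumes "half_plane_graph n G" "a < n" "w \<notin> verts G"
  shows "app (op (adjoin_boundary_vertex (Suc a) y)) (vec G) = vec (detach w (Suc a) G) + (y - 1) *\<^sub>R vec G"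
  using op_vec(2)[OF assms(1), of "adjoin_boundary_vertex (Suc a) y"] adjoin_boundary_vertex_preserves[of "Suc a" n _ q y] assms(2)
    \<pi>_cong[OF adjoin_boundary_vertex_attach[OF assms(1) _ _ assms(3), of "Suc a" y]]
    \<pi>_cong[OF attach_expand[OF assms(1) _ _ assms(3), of "Suc a" y]] by (simp add: vec_def app_linear)

text \<open>
  At even positions, the edge of Potts weight \<open>1\<close> is the same as no edge, which leaves the operator \<open>D / q\<close>; at odd
  positions, the edge of weight \<open>2\<close> is the sum of deletion and contraction, which leaves \<open>J\<close>.
\<close>

definition P :: "nat \<Rightarrow> wgraph endo" where
  "P i = (if even i then (1 / q) *\<^sub>R op (adjoin_boundary_vertex (Suc (i div 2)) 1)
          else op (adjoin_edge (Suc (i div 2)) 2) - \<pi>)"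

lemma P_\<pi>: "P i * \<pi> = P i" "\<pi> * P i = P i"
  by (simp_all add: P_def op_\<pi> \<pi>_idem algebra_simps)

lemma \<pi>_vec: "app \<pi> (vec G) = vec G"
  using \<pi>_idem by (metis app_times vec_def)

definition has_kernel :: "nat list \<Rightarrow> kernel \<Rightarrow> bool" where
  "has_kernel m K \<longleftrightarrow> half_plane_graph n (edgeless m) \<and> (\<forall>i<n. \<forall>k<n. m ! i = m ! k \<longleftrightarrow> K i k)"

lemma has_kernel_length: "has_kernel m K \<Longrightarrow> length m = n"
  unfolding has_kernel_def edgeless_def using wf_graphD(2)[OF half_plane_wf] by fastforce

lemma vec_relabel: "half_plane_graph n G \<Longrightarrow> inj_on f (verts G) \<Longrightarrow> vec (map_vertices f G) = vec G"
  unfolding vec_def using \<pi>_cong[OF relabel_relation] by metis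

lemma kernel_unique:
  assumes "has_kernel m K" "has_kernel m' K"
  shows "vec (edgeless m) = vec (edgeless m')"
proof -
  have len: "length m = n" "length m' = n" using assms by (auto dest: has_kernel_length)
  have K: "m ! i = m ! k \<longleftrightarrow> m' ! i = m' ! k" if "i < n" "k < n" for i k
    using assms that by (auto simp: has_kernel_def)
  define f where "f v = m' ! (SOME i. i < n \<and> m ! i = v)" for v
  have f: "f (m ! i) = m' ! i" if "i < n" for i
  proof -
    have "(SOME k. k < n \<and> m ! k = m ! i) < n \<and> m ! (SOME k. k < n \<and> m ! k = m ! i) = m ! i"
      by (rule someI[of _ i]) (simp add: that)
    then show ?thesis using K that unfolding f_def by blast
  qed
  have "map f m = m'" by (rule nth_equalityI) (use len f in auto)
  moreover have "inj_on f (set m)"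
    unfolding inj_on_def by (auto simp: in_set_conv_nth len f K)
  ultimately show ?thesis
    using vec_relabel[of "edgeless m" f] assms(1)
    by (auto simp: has_kernel_def edgeless_def map_vertices_WGraph)
qed

definition kvec :: "kernel \<Rightarrow> (wgraph \<Rightarrow>\<^sub>0 real)" where
  "kvec K = vec (edgeless (SOME m. has_kernel m K))"

definition realizable :: "kernel \<Rightarrow> bool" where
  "realizable K \<longleftrightarrow> (\<exists>m. has_kernel m K)"

lemma kvec: "has_kernel m K \<Longrightarrow> kvec K = vec (edgeless m)"
  unfolding kvec_def by (rule kernel_unique[OF someI])

lemma has_kernel_cong: "(\<And>i k. i < n \<Longrightarrow> k < n \<Longrightarrow> K i k \<longleftrightarrow> K' i k) \<Longrightarrow> has_kernel m K \<longleftrightarrow> has_kernel m K'"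
  by (simp add: has_kernel_def)

lemma kvec_cong:
  assumes "\<And>i k. i < n \<Longrightarrow> k < n \<Longrightarrow> K i k \<longleftrightarrow> K' i k"
  shows "kvec K = kvec K'"
proof -
  have "has_kernel m K \<longleftrightarrow> has_kernel m K'" for m by (rule has_kernel_cong[OF assms])
  then show ?thesis by (simp add: kvec_def)
qed

lemma has_kernel_join:
  assumes m: "has_kernel m K" and a: "Suc a < n"
  shows "has_kernel (map (id(m ! Suc a := m ! a)) m) (join_blocks a K)"
    "identify (m ! a) (m ! Suc a) (edgeless m) = edgeless (map (id(m ! Suc a := m ! a)) m)"
proof -
  have len: "length m = n" by (rule has_kernel_length[OF m])
  show eq: "identify (m ! a) (m ! Suc a) (edgeless m) = edgeless (map (id(m ! Suc a := m ! a)) m)"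
    by (simp add: identify_def edgeless_def map_vertices_WGraph del: fun_upd_apply)
  have g: "half_plane_graph n (edgeless m)" using m by (simp add: has_kernel_def)
  have "half_plane_graph n (WGraph (set m) m (add_mset ({m ! a, m ! Suc a}, 2) {#}))"
    using half_plane_adjoin_edge[OF g, of "Suc a" 2] a by (simp add: adjoin_edge_def edgeless_def)
  from half_plane_graph.contraction[OF this]
  have "half_plane_graph n (edgeless (map (id(m ! Suc a := m ! a)) m))"
    using eq by (simp add: edgeless_def)
  then show "has_kernel (map (id(m ! Suc a := m ! a)) m) (join_blocks a K)"
    unfolding has_kernel_def
  proof (intro conjI allI impI)
    fix i k assume ik: "i < n" "k < n"
    have "K i k \<longleftrightarrow> m ! i = m ! k" "K i a \<longleftrightarrow> m ! i = m ! a" "K i (Suc a) \<longleftrightarrow> m ! i = m ! Suc a"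
      "K k a \<longleftrightarrow> m ! k = m ! a" "K k (Suc a) \<longleftrightarrow> m ! k = m ! Suc a"
      using m a ik unfolding has_kernel_def by auto
    then show "map (id(m ! Suc a := m ! a)) m ! i = map (id(m ! Suc a := m ! a)) m ! k \<longleftrightarrow> join_blocks a K i k"
      unfolding join_blocks_def using ik len by auto
  qed
qed

lemma P_join:
  assumes K: "realizable K" and a: "Suc a < n"
  shows "app (P (Suc (2 * a))) (kvec K) = kvec (join_blocks a K)" "realizable (join_blocks a K)"
proof -
  obtain m where m: "has_kernel m K" using K by (auto simp: realizable_def)
  note J = has_kernel_join[OF m a]
  show "realizable (join_blocks a K)" using J(1) by (auto simp: realizable_def)
  have g: "half_plane_graph n (edgeless m)" using m by (simp add: has_kernel_def)
  have "app (P (Suc (2 * a))) (vec (edgeless m)) = vec (identify (m ! a) (m ! Suc a) (edgeless m))"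
    using op_adjoin_edge[OF g a, of 2] by (simp add: P_def \<pi>_vec) (simp add: edgeless_def)
  then show "app (P (Suc (2 * a))) (kvec K) = kvec (join_blocks a K)"
    unfolding kvec[OF m] kvec[OF J(1)] J(2) .
qed

text \<open>
  Detaching a vertex from its block leaves the rest of the block as it is, unless the vertex was alone: then the
  old vertex remains as an isolated interior vertex and contributes the scalar \<open>q\<close>.
\<close>

definition singleton_factor :: "nat \<Rightarrow> kernel \<Rightarrow> real" where
  "singleton_factor a K = (if \<exists>i<n. i \<noteq> a \<and> K i a then 1 else q)"

lemma P_singleton:
  assumes K: "realizable K" and a: "a < n"
  shows "app (P (2 * a)) (kvec K) = (singleton_factor a K / q) *\<^sub>R kvec (make_singleton a K)"
    "realizable (make_singleton a K)"
proof -
  obtain m where m: "has_kernel m K" using K by (auto simp: realizable_def)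
  have len: "length m = n" by (rule has_kernel_length[OF m])
  have g: "half_plane_graph n (edgeless m)" using m by (simp add: has_kernel_def)
  obtain w where w: "w \<notin> set m" using ex_new_if_finite[of "set m"] by auto
  then have wi: "m ! i \<noteq> w" if "i < n" for i using that len nth_mem by blast
  let ?m = "m[a := w]"
  have nth: "?m ! i = (if i = a then w else m ! i)" if "i < n" for i using that len by simp
  have hd: "half_plane_graph n (detach w (Suc a) (edgeless m))"
    by (rule half_plane_detach[OF g]) (use a w in \<open>auto simp: edgeless_def\<close>)
  have d: "detach w (Suc a) (edgeless m) = WGraph (insert w (set m)) ?m {#}"
    by (simp add: detach_def edgeless_def)
  have sub: "set ?m \<subseteq> insert w (set m)" by (rule set_update_subset_insert)
  have g': "half_plane_graph n (edgeless ?m)"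
    using half_plane_subgraph[OF hd[unfolded d], of "set ?m" "{#}"] sub by (simp add: edgeless_def)
  have m': "has_kernel ?m (make_singleton a K)"
    unfolding has_kernel_def
  proof (intro conjI g' allI impI)
    fix i k assume ik: "i < n" "k < n"
    then show "?m ! i = ?m ! k \<longleftrightarrow> make_singleton a K i k"
      using m wi[of i] wi[of k] unfolding nth[OF ik(1)] nth[OF ik(2)] make_singleton_def has_kernel_def by auto
  qed
  then show "realizable (make_singleton a K)" by (auto simp: realizable_def)
  have wm: "w \<in> set ?m" using nth[OF a] a len by (metis length_list_update nth_mem)
  have old: "m ! i \<in> set ?m" if "i < n" "i \<noteq> a" for i using nth[OF that(1)] that len by (metis length_list_update nth_mem)
  have "vec (detach w (Suc a) (edgeless m)) = singleton_factor a K *\<^sub>R vec (edgeless ?m)"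
  proof (cases "\<exists>i<n. i \<noteq> a \<and> K i a")
    case True
    then obtain i where i: "i < n" "i \<noteq> a" "m ! i = m ! a" using m a by (auto simp: has_kernel_def)
    have "set m \<subseteq> set ?m"
    proof
      fix x assume "x \<in> set m"
      then obtain k where "k < n" "x = m ! k" using len by (auto simp: in_set_conv_nth)
      then show "x \<in> set ?m" using old[of k] old[OF i(1,2)] i(3) by (cases "k = a") auto
    qed
    then have "insert w (set m) = set ?m" using sub wm by blast
    then show ?thesis using True unfolding d singleton_factor_def by (simp add: edgeless_def)
  next
    case False
    then have other: "m ! i \<noteq> m ! a" if "i < n" "i \<noteq> a" for i using that m a by (auto simp: has_kernel_def)
    have iso: "m ! a \<notin> set ?m"
      using nth other wi[OF a] len by (auto simp: in_set_conv_nth)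
    have "insert w (set m) = insert (m ! a) (set ?m)"
    proof (intro equalityI subsetI)
      fix x assume "x \<in> insert w (set m)"
      then show "x \<in> insert (m ! a) (set ?m)"
        using old wm len by (auto simp: in_set_conv_nth)
    qed (use sub a len in auto)
    then have d': "detach w (Suc a) (edgeless m) = WGraph (insert (m ! a) (set ?m)) ?m {#}" using d by simp
    have "formal (WGraph (insert (m ! a) (set ?m)) ?m {#}) - q *\<^sub>R formal (WGraph (set ?m) ?m {#}) \<in> relation_space q n"
      by (rule relator_in_relation_space, rule skein_relators.isolated) (use hd d' iso in auto)
    note rel = \<pi>_cong[OF this]
    have "singleton_factor a K = q" unfolding singleton_factor_def using False by (rule if_not_P)
    then show ?thesis using rel unfolding d' by (simp add: vec_def app_linear edgeless_def)
  qed
  moreover have "app (P (2 * a)) (vec (edgeless m)) = (1 / q) *\<^sub>R vec (detach w (Suc a) (edgeless m))"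
    using op_attach[OF g a, of w 1] w by (simp add: P_def edgeless_def)
  ultimately show "app (P (2 * a)) (kvec K) = (singleton_factor a K / q) *\<^sub>R kvec (make_singleton a K)"
    unfolding kvec[OF m] kvec[OF m'] by simp
qed

lemma realizable_equiv:
  assumes "realizable K"
  obtains c :: "nat \<Rightarrow> nat" where "\<And>i k. i < n \<Longrightarrow> k < n \<Longrightarrow> K i k \<longleftrightarrow> c i = c k"
    "\<And>i j k l. i < j \<Longrightarrow> j < k \<Longrightarrow> k < l \<Longrightarrow> l < n \<Longrightarrow> c i = c k \<Longrightarrow> c j = c l \<Longrightarrow> c i = c j"
proof -
  obtain m where m: "has_kernel m K" using assms by (auto simp: realizable_def)
  show thesis
  proof (rule that[of "\<lambda>i. m ! i"])
    show "K i k \<longleftrightarrow> m ! i = m ! k" if "i < n" "k < n" for i k using m that by (auto simp: has_kernel_def)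
    show "m ! i = m ! j" if "i < j" "j < k" "k < l" "l < n" "m ! i = m ! k" "m ! j = m ! l" for i j k l
      by (rule edgeless_noncrossing[of n "set m" m i j k l])
        (use m that in \<open>auto simp: has_kernel_def edgeless_def\<close>)
  qed
qed

text \<open>
  Edges are removed by deletion and contraction, and then isolated interior vertices one by one.
\<close>

lemma vec_in_span: "half_plane_graph n G \<Longrightarrow> vec G \<in> span (kvec ` Collect realizable)"
proof (induction "size (edges G) + card (verts G)" arbitrary: G rule: less_induct)
  case less
  note wf = half_plane_wf[OF less.prems]
  obtain V m E where G: "G = WGraph V m E" by (cases G)
  have fin: "finite V" using wf_graphD(1)[OF wf] G by simp
  show ?case
  proof (cases "E = {#}")
    case False
    then obtain e E' where E: "E = add_mset e E'" by (meson multiset_cases)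
    obtain u v y where e: "e = ({u, v}, y)"
      using wf_graphD(5)[OF wf, of e] G E by (cases e) auto
    have h: "half_plane_graph n (WGraph V m (add_mset ({u, v}, y) E'))" using less.prems G E e by simp
    let ?G2 = "WGraph V m E'" and ?G3 = "identify u v (WGraph V m E')"
    have "vec ?G2 \<in> span (kvec ` Collect realizable)"
      by (rule less.hyps) (use G E half_plane_smaller[OF h] in auto)
    moreover have "vec ?G3 \<in> span (kvec ` Collect realizable)"
    proof (rule less.hyps)
      have "card (verts ?G3) \<le> card V" using card_image_le[OF fin] by (simp del: fun_upd_apply)
      then show "size (edges ?G3) + card (verts ?G3) < size (edges G) + card (verts G)" using G E by simp
    qed (rule half_plane_graph.contraction[OF h])
    moreover have "vec G = vec ?G2 + (y - 1) *\<^sub>R vec ?G3"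
      using \<pi>_cong[OF relator_in_relation_space[OF skein_relators.edge[OF h]]] G E e by (simp add: vec_def app_linear)
    ultimately show ?thesis by (simp add: span_add span_scale)
  next
    case E: True
    have mV: "set m \<subseteq> V" using wf_graphD(3)[OF wf] G by simp
    show ?thesis
    proof (cases "V = set m")
      case True
      then have "has_kernel m (\<lambda>i k. m ! i = m ! k)"
        using less.prems G E by (simp add: has_kernel_def edgeless_def)
      then have "vec G = kvec (\<lambda>i k. m ! i = m ! k)" "realizable (\<lambda>i k. m ! i = m ! k)"
        using kvec True G E by (auto simp: edgeless_def realizable_def)
      then show ?thesis by (auto intro: span_base)
    next
      case False
      then obtain v where v: "v \<in> V" "v \<notin> set m" using mV by blast
      let ?V = "V - {v}"
      have V: "V = insert v ?V" using v by auto
      have h: "half_plane_graph n (WGraph (insert v ?V) m {#})" using less.prems G E V by simp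
      have r: "half_plane_graph n (WGraph ?V m {#})"
        by (rule half_plane_remove_isolated[OF h v(2)]) simp
      have "vec (WGraph ?V m {#}) \<in> span (kvec ` Collect realizable)"
        by (rule less.hyps) (use G E r card_Diff1_less[OF fin v(1)] in auto)
      moreover have "vec (WGraph (insert v ?V) m {#}) = q *\<^sub>R vec (WGraph ?V m {#})"
        using \<pi>_cong[OF relator_in_relation_space[OF skein_relators.isolated[OF h]]] v(2) by (simp add: vec_def app_linear)
      ultimately show ?thesis using G E V by (simp add: span_scale)
    qed
  qed
qed

lemma range_in_span: "app \<pi> x \<in> span (kvec ` Collect realizable)"
proof -
  have "app \<pi> y \<in> span (kvec ` Collect realizable)" if "y \<in> graph_space n" for y
    by (rule linear_image_span_subset[OF linear_app _ that[unfolded graph_space_def]])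
      (use vec_in_span in \<open>auto simp: vec_def\<close>)
  from this[OF \<pi>_range[of x]] show ?thesis using \<pi>_idem by (metis app_times)
qed

lemma endo_eq_on_kernels:
  assumes "\<And>K. realizable K \<Longrightarrow> app X (kvec K) = app Y (kvec K)" "X * \<pi> = X" "Y * \<pi> = Y"
  shows "X = Y"
proof (rule endo_eqI)
  fix x
  have "app X y = app Y y" if "y \<in> span (kvec ` Collect realizable)" for y
    by (rule linear_eq_on_span[OF linear_app linear_app _ that]) (use assms(1) in auto)
  from this[OF range_in_span[of x]] show "app X x = app Y x" using assms(2,3) by (metis app_times)
qed

lemma realizable_classes:
  assumes "realizable K"
  obtains c :: "nat \<Rightarrow> nat" where "\<And>i k. i < n \<Longrightarrow> k < n \<Longrightarrow> K i k \<longleftrightarrow> c i = c k"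
  by (rule realizable_equiv[OF assms]) (rule that)

lemma join_join: "realizable K \<Longrightarrow> Suc a < n \<Longrightarrow> Suc b < n \<Longrightarrow>
    kvec (join_blocks a (join_blocks b K)) = kvec (join_blocks b (join_blocks a K))"
  by (erule realizable_classes, rule kvec_cong, rule kernel_join_join; assumption)

lemma join_idem: "kvec (join_blocks a (join_blocks a K)) = kvec (join_blocks a K)" if h: "realizable K" "Suc a < n"
proof -
  obtain c :: "nat \<Rightarrow> nat" where c: "\<And>i k. i < n \<Longrightarrow> k < n \<Longrightarrow> K i k \<longleftrightarrow> c i = c k"
    by (rule realizable_classes[OF h(1)]) (rule that)
  have "K a (Suc a) \<longleftrightarrow> K (Suc a) a" "K a a" "K (Suc a) (Suc a)" using c h(2) by auto
  then show ?thesis by (intro kvec_cong) (unfold join_blocks_def, blast)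
qed

lemma join_single: "realizable K \<Longrightarrow> Suc a < n \<Longrightarrow> b < n \<Longrightarrow> b \<noteq> a \<Longrightarrow> b \<noteq> Suc a \<Longrightarrow>
    kvec (join_blocks a (make_singleton b K)) = kvec (make_singleton b (join_blocks a K))"
  by (erule realizable_classes, rule kvec_cong, rule kernel_join_single; assumption)

lemma single_single: "realizable K \<Longrightarrow> a < n \<Longrightarrow> b < n \<Longrightarrow>
    kvec (make_singleton a (make_singleton b K)) = kvec (make_singleton b (make_singleton a K))"
  by (erule realizable_classes, rule kvec_cong, rule kernel_single_single; assumption)

lemma single_idem: "kvec (make_singleton a (make_singleton a K)) = kvec (make_singleton a K)"
  by (rule kvec_cong) (auto simp: make_singleton_def)

lemma join_single_join: "realizable K \<Longrightarrow> Suc a < n \<Longrightarrow> b = a \<or> b = Suc a \<Longrightarrow>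
    kvec (join_blocks a (make_singleton b (join_blocks a K))) = kvec (join_blocks a K)"
  by (erule realizable_classes, rule kvec_cong, rule kernel_join_single_join; assumption)

lemma single_join_single: "realizable K \<Longrightarrow> Suc a < n \<Longrightarrow> b = a \<or> b = Suc a \<Longrightarrow>
    kvec (make_singleton b (join_blocks a (make_singleton b K))) = kvec (make_singleton b K)"
  by (erule realizable_classes, rule kvec_cong, rule kernel_single_join_single; assumption)

lemma factors:
  assumes "realizable K" 
  shows "a < n \<Longrightarrow> singleton_factor a (make_singleton a K) = q"
    "Suc a < n \<Longrightarrow> b = a \<or> b = Suc a \<Longrightarrow> singleton_factor b (join_blocks a K) = 1"
    "Suc a < n \<Longrightarrow> b < n \<Longrightarrow> b \<noteq> a \<Longrightarrow> b \<noteq> Suc a \<Longrightarrow> singleton_factor b (join_blocks a K) = singleton_factor b K"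
    "a < n \<Longrightarrow> b < n \<Longrightarrow> a \<noteq> b \<Longrightarrow>
      singleton_factor b K * singleton_factor a (make_singleton b K) = singleton_factor a K * singleton_factor b (make_singleton a K)"
proof -
  obtain c :: "nat \<Rightarrow> nat" where c: "\<And>i k. i < n \<Longrightarrow> k < n \<Longrightarrow> K i k \<longleftrightarrow> c i = c k"
    by (rule realizable_classes[OF assms]) (rule that)
  show "a < n \<Longrightarrow> singleton_factor a (make_singleton a K) = q"
    by (auto simp: singleton_factor_def make_singleton_def)
  show "singleton_factor b (join_blocks a K) = 1" if "Suc a < n" "b = a \<or> b = Suc a"
  proof -
    have J: "join_blocks a K a (Suc a)" "join_blocks a K (Suc a) a" using that c by (auto simp: join_blocks_def)
    have "\<exists>i<n. i \<noteq> b \<and> join_blocks a K i b"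
    proof (cases "b = a")
      case True
      then show ?thesis using J that by (intro exI[of _ "Suc a"]) simp
    next
      case False
      then show ?thesis using J that by (intro exI[of _ a]) auto
    qed
    then show ?thesis by (simp add: singleton_factor_def)
  qed
  show "singleton_factor b (join_blocks a K) = singleton_factor b K"
    if "Suc a < n" "b < n" "b \<noteq> a" "b \<noteq> Suc a"
  proof -
    have "(\<exists>i<n. i \<noteq> b \<and> join_blocks a K i b) \<longleftrightarrow> (\<exists>i<n. i \<noteq> b \<and> K i b)"
    proof
      assume "\<exists>i<n. i \<noteq> b \<and> join_blocks a K i b"
      then obtain i where "i < n" "i \<noteq> b" "join_blocks a K i b" by blast
      moreover have "K b a \<longleftrightarrow> K a b" "K b (Suc a) \<longleftrightarrow> K (Suc a) b" using c that by auto
      ultimately show "\<exists>i<n. i \<noteq> b \<and> K i b" using that Suc_lessD[OF that(1)] unfolding join_blocks_def by metis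
    qed (auto simp: join_blocks_def)
    then show ?thesis by (simp add: singleton_factor_def)
  qed
  show "singleton_factor b K * singleton_factor a (make_singleton b K) = singleton_factor a K * singleton_factor b (make_singleton a K)"
    if ab: "a < n" "b < n" "a \<noteq> b"
  proof -
    define A where "A \<longleftrightarrow> (\<exists>i<n. i \<noteq> a \<and> i \<noteq> b \<and> c i = c a)"
    define B where "B \<longleftrightarrow> (\<exists>i<n. i \<noteq> a \<and> i \<noteq> b \<and> c i = c b)"
    have "(\<exists>i<n. i \<noteq> a \<and> K i a) \<longleftrightarrow> A \<or> c a = c b" "(\<exists>i<n. i \<noteq> b \<and> K i b) \<longleftrightarrow> B \<or> c a = c b"
      "(\<exists>i<n. i \<noteq> a \<and> make_singleton b K i a) \<longleftrightarrow> A" "(\<exists>i<n. i \<noteq> b \<and> make_singleton a K i b) \<longleftrightarrow> B"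
      unfolding A_def B_def make_singleton_def using ab c by metis+
    moreover have "c a = c b \<Longrightarrow> A = B" by (simp add: A_def B_def)
    ultimately show ?thesis by (auto simp: singleton_factor_def)
  qed
qed

lemma generator_cases:
  assumes "i < 2 * n - 1"
  obtains a where "i = 2 * a" "a < n" | a where "i = Suc (2 * a)" "Suc a < n"
proof (cases "even i")
  case True
  then show thesis using that(1)[of "i div 2"] assms by auto
next
  case False
  then show thesis using that(2)[of "i div 2"] assms by (auto elim!: oddE)
qed

lemmas P_simps = P_join P_singleton app_linear

lemma P_idem: "i < 2 * n - 1 \<Longrightarrow> P i * P i = P i"
proof (rule endo_eq_on_kernels)
  fix K assume i: "i < 2 * n - 1" and K: "realizable K"
  consider a where "i = 2 * a" "a < n" | a where "i = Suc (2 * a)" "Suc a < n"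
    using i generator_cases by blast
  then show "app (P i * P i) (kvec K) = app (P i) (kvec K)"
  proof cases
    case 1
    then show ?thesis using K q4 single_idem[of a K] factors(1)[OF K, of a] by (simp add: P_simps)
  next
    case 2
    then show ?thesis using K join_idem[OF K, of a] by (simp add: P_simps)
  qed
qed (simp_all add: mult.assoc P_\<pi>)

lemma P_braid:
  assumes K: "Suc i < 2 * n - 1"
  shows "P i * P (Suc i) * P i = (1 / q) *\<^sub>R P i" "P (Suc i) * P i * P (Suc i) = (1 / q) *\<^sub>R P (Suc i)"
proof -
  have "P i * P (Suc i) * P i = (1 / q) *\<^sub>R P i \<and> P (Suc i) * P i * P (Suc i) = (1 / q) *\<^sub>R P (Suc i)"
  proof (cases "even i")
    case True
    then obtain a where a: "i = 2 * a" "Suc a < n" using assms by auto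
    have 1: "P i * P (Suc i) * P i = (1 / q) *\<^sub>R P i"
    proof (rule endo_eq_on_kernels)
      fix K assume K: "realizable K"
      then show "app (P i * P (Suc i) * P i) (kvec K) = app ((1 / q) *\<^sub>R P i) (kvec K)"
        using a single_join_single[OF K, of a a] factors(2)[of "make_singleton a K" a a] by (simp add: P_simps)
    qed (simp_all add: mult.assoc P_\<pi>)
    have 2: "P (Suc i) * P i * P (Suc i) = (1 / q) *\<^sub>R P (Suc i)"
    proof (rule endo_eq_on_kernels)
      fix K assume K: "realizable K"
      then show "app (P (Suc i) * P i * P (Suc i)) (kvec K) = app ((1 / q) *\<^sub>R P (Suc i)) (kvec K)"
        using a join_single_join[OF K, of a a] factors(2)[OF K, of a a] by (simp add: P_simps)
    qed (simp_all add: mult.assoc P_\<pi>)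
    show ?thesis using 1 2 by simp
  next
    case False
    then obtain a where a: "i = Suc (2 * a)" "Suc a < n" using assms by (auto elim!: oddE)
    have b: "Suc i = 2 * Suc a" using a by simp
    have 1: "P i * P (Suc i) * P i = (1 / q) *\<^sub>R P i"
    proof (rule endo_eq_on_kernels)
      fix K assume K: "realizable K"
      then show "app (P i * P (Suc i) * P i) (kvec K) = app ((1 / q) *\<^sub>R P i) (kvec K)"
        unfolding b unfolding a(1)
        using a(2) join_single_join[OF K, of a "Suc a"] factors(2)[OF K, of a "Suc a"]
        by (simp add: P_simps del: mult_Suc_right)
    qed (simp_all add: mult.assoc P_\<pi>)
    have 2: "P (Suc i) * P i * P (Suc i) = (1 / q) *\<^sub>R P (Suc i)"
    proof (rule endo_eq_on_kernels)
      fix K assume K: "realizable K"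
      then show "app (P (Suc i) * P i * P (Suc i)) (kvec K) = app ((1 / q) *\<^sub>R P (Suc i)) (kvec K)"
        unfolding b unfolding a(1)
        using a(2) single_join_single[OF K, of a "Suc a"] factors(2)[of "make_singleton (Suc a) K" a "Suc a"]
        by (simp add: P_simps del: mult_Suc_right)
    qed (simp_all add: mult.assoc P_\<pi>)
    show ?thesis using 1 2 by simp
  qed
  then show "P i * P (Suc i) * P i = (1 / q) *\<^sub>R P i" "P (Suc i) * P i * P (Suc i) = (1 / q) *\<^sub>R P (Suc i)"
    by auto
qed

lemma P_far:
  assumes ij: "Suc i < j" "j < 2 * n - 1"
  shows "P i * P j = P j * P i"
proof (rule endo_eq_on_kernels)
  fix K assume K: "realizable K"
  have i: "i < 2 * n - 1" using ij by simp
  show "app (P i * P j) (kvec K) = app (P j * P i) (kvec K)"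
  proof (rule generator_cases[OF i]; rule generator_cases[OF ij(2)])
    fix a b assume ab: "i = 2 * a" "a < n" "j = 2 * b" "b < n"
    then have "a \<noteq> b" using ij by auto
    then show ?thesis
      using ab K single_single[OF K, of a b] factors(4)[OF K, of a b] by (simp add: P_simps)
  next
    fix a b assume ab: "i = 2 * a" "a < n" "j = Suc (2 * b)" "Suc b < n"
    then have "a \<noteq> b" "a \<noteq> Suc b" using ij by auto
    then show ?thesis
      using ab K join_single[OF K, of b a] factors(3)[OF K, of b a] by (simp add: P_simps)
  next
    fix a b assume ab: "i = Suc (2 * a)" "Suc a < n" "j = 2 * b" "b < n"
    then have "b \<noteq> a" "b \<noteq> Suc a" using ij by auto
    then show ?thesis
      using ab K join_single[OF K, of a b] factors(3)[OF K, of a b] by (simp add: P_simps)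
  next
    fix a b assume ab: "i = Suc (2 * a)" "Suc a < n" "j = Suc (2 * b)" "Suc b < n"
    then show ?thesis using K join_join[OF K, of a b] by (simp add: P_simps)
  qed
qed (simp_all add: mult.assoc P_\<pi>)

sublocale tl: temperley_lieb P q "2 * n - 1"
  by unfold_locales (fact q4 P_idem P_braid P_far)+

definition rainbow :: kernel where
  "rainbow i k \<longleftrightarrow> i = k \<or> i + k = n - 1"

text \<open>
  A partition fixed by none of the first \<open>n - 1\<close> generators has no singleton and no joined neighbours in its left
  half, hence is the rainbow; the middle of the rainbow is a singleton or a joined pair of neighbours, according to the
  parity of \<open>n\<close>, and both are fixed by the generator \<open>n - 1\<close>.
\<close>

lemma cup_cases:
  assumes K: "realizable K"
  shows "(\<exists>i<n - 1. app (P i) (kvec K) = kvec K) \<or>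
    (kvec K = kvec rainbow \<and> app (P (n - 1)) (kvec K) = kvec K)"
proof (cases "\<exists>i<n - 1. app (P i) (kvec K) = kvec K")
  case False
  obtain c :: "nat \<Rightarrow> nat" where c: "\<And>i k. i < n \<Longrightarrow> k < n \<Longrightarrow> K i k \<longleftrightarrow> c i = c k"
    "\<And>i j k l. i < j \<Longrightarrow> j < k \<Longrightarrow> k < l \<Longrightarrow> l < n \<Longrightarrow> c i = c k \<Longrightarrow> c j = c l \<Longrightarrow> c i = c j"
    by (rule realizable_equiv[OF K]) (rule that)
  have fix_single: "app (P (2 * a)) (kvec K) = kvec K" if "a < n" "\<not> (\<exists>i<n. i \<noteq> a \<and> K i a)" for a
  proof -
    have "kvec (make_singleton a K) = kvec K"
    proof (rule kvec_cong)
      fix i k assume "i < n" "k < n"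
      then show "make_singleton a K i k \<longleftrightarrow> K i k"
        using that c(1)[of i k] c(1)[of k a] c(1)[of i a] by (auto simp: make_singleton_def)
    qed
    then show ?thesis using P_singleton(1)[OF K that(1)] that q4 by (simp add: singleton_factor_def)
  qed
  have fix_join: "app (P (Suc (2 * a))) (kvec K) = kvec K" if "Suc a < n" "c a = c (Suc a)" for a
  proof -
    have "kvec (join_blocks a K) = kvec K"
      by (rule kvec_cong) (use that c(1) in \<open>auto simp: join_blocks_def\<close>)
    then show ?thesis using P_join(1)[OF K that(1)] by simp
  qed
  have eq: "K i k \<longleftrightarrow> rainbow i k" if ik: "i < n" "k < n" for i k
  proof -
    have "c i = c k \<longleftrightarrow> i = k \<or> i + k = n - 1"
    proof (rule rainbow_kernel)
      fix a assume a: "2 * a < n - 1"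
      then have an: "a < n" by simp
      obtain i where i: "i < n" "i \<noteq> a" "K i a" using fix_single[of a] False a an by auto
      then show "\<exists>l\<le>n - 1. l \<noteq> a \<and> c l = c a" using c(1)[of i a] an by (intro exI[of _ i]) auto
    next
      fix a assume a: "2 * a + 1 < n - 1"
      then have "Suc a < n" by linarith
      with a show "c a \<noteq> c (Suc a)" using fix_join[of a] False by auto
    next
      fix i j k l assume "i < j" "j < k" "k < l" "l \<le> n - 1" "c i = c k" "c j = c l"
      then show "c i = c j" using c(2)[of i j k l] n1 by simp
    qed (use ik in auto)
    then show ?thesis using c(1)[OF ik] by (simp add: rainbow_def)
  qed
  have "app (P (n - 1)) (kvec K) = kvec K"
  proof (cases "even (n - 1)")
    case True
    then obtain a where a: "n - 1 = 2 * a" by (elim evenE)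
    then have an: "a < n" using n1 by auto
    have "\<not> (\<exists>i<n. i \<noteq> a \<and> K i a)" using eq an a by (auto simp: rainbow_def)
    then show ?thesis using fix_single[OF an] a by simp
  next
    case False
    then obtain a where "n - 1 = 2 * a + 1" by (elim oddE)
    then have a: "n - 1 = Suc (2 * a)" by simp
    then have an: "Suc a < n" by linarith
    have "K a (Suc a)" using eq[of a "Suc a"] an a by (auto simp: rainbow_def)
    then have "c a = c (Suc a)" using c(1)[of a "Suc a"] an by simp
    then show ?thesis using fix_join[OF an] a by simp
  qed
  moreover have "kvec K = kvec rainbow" by (rule kvec_cong[OF eq])
  ultimately show ?thesis by blast
qed blast

lemma F_kills:
  assumes "i < k" "k \<le> 2 * n - 1" "app (P i) x = x"
  shows "app (tl.F k) x = 0"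
proof -
  have "app (tl.F k) (app (P i) x) = app (tl.F k * P i) x" by simp
  then show ?thesis using tl.F_P[OF assms(1,2)] assms(3) by simp
qed

lemma rank_one: "\<exists>r. app (tl.F (n - 1) * \<pi>) x = r *\<^sub>R app (tl.F (n - 1)) (kvec rainbow)"
proof -
  let ?S = "span {app (tl.F (n - 1)) (kvec rainbow)}"
  have "app (tl.F (n - 1)) (app \<pi> x) \<in> ?S"
  proof (rule linear_image_span_subset[OF linear_app _ range_in_span[of x]])
    fix y assume "y \<in> kvec ` Collect realizable"
    then obtain K where K: "realizable K" "y = kvec K" by auto
    from cup_cases[OF K(1)] show "app (tl.F (n - 1)) y \<in> ?S"
    proof (elim disjE exE conjE)
      fix i assume "i < n - 1" "app (P i) (kvec K) = kvec K"
      then have "app (tl.F (n - 1)) y = 0" unfolding K(2) by (intro F_kills[of i]) auto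
      then show ?thesis by (simp add: span_zero)
    next
      assume "kvec K = kvec rainbow"
      then show ?thesis unfolding K(2) by (simp add: span_base)
    qed
  qed
  then show ?thesis by (auto simp: span_singleton)
qed

lemma top_vanishes: "tl.F (Suc (n - 1)) * \<pi> = 0"
proof (rule endo_eq_on_kernels)
  fix K assume K: "realizable K"
  have "app (tl.F (Suc (n - 1))) (kvec K) = 0"
    using cup_cases[OF K]
  proof (elim disjE exE conjE)
    fix i assume "i < n - 1" "app (P i) (kvec K) = kvec K"
    then show ?thesis by (intro F_kills[of i]) auto
  next
    assume "app (P (n - 1)) (kvec K) = kvec K"
    then show ?thesis using n1 by (intro F_kills[of "n - 1"]) auto
  qed
  moreover have "app \<pi> (kvec K) = kvec K" by (simp add: kvec_def \<pi>_vec)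
  ultimately show "app (tl.F (Suc (n - 1)) * \<pi>) (kvec K) = app 0 (kvec K)" by simp
qed (simp_all add: mult.assoc \<pi>_idem)

lemma endo_eq_on_graphs:
  assumes "\<And>G. half_plane_graph n G \<Longrightarrow> app X (vec G) = app Y (vec G)" "X * \<pi> = X" "Y * \<pi> = Y"
  shows "X = Y"
  by (rule endo_eq_on_kernels) (use assms in \<open>auto simp: realizable_def kvec has_kernel_def\<close>)

lemma op_edge:
  assumes "Suc a < n"
  shows "op (adjoin_edge (Suc a) y) = \<pi> + (y - 1) *\<^sub>R P (Suc (2 * a))"
proof (rule endo_eq_on_graphs)
  fix G assume "half_plane_graph n G"
  then show "app (op (adjoin_edge (Suc a) y)) (vec G) = app (\<pi> + (y - 1) *\<^sub>R P (Suc (2 * a))) (vec G)"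
    using op_adjoin_edge[of G a] assms by (simp add: P_def \<pi>_vec)
qed (simp_all add: distrib_right op_\<pi> P_\<pi> \<pi>_idem)

lemma op_boundary_vertex:
  assumes "a < n"
  shows "op (adjoin_boundary_vertex (Suc a) y) = q *\<^sub>R P (2 * a) + (y - 1) *\<^sub>R \<pi>"
proof (rule endo_eq_on_graphs)
  fix G assume G: "half_plane_graph n G"
  obtain w where "w \<notin> verts G" using ex_new_if_finite[of "verts G"] wf_graphD(1)[OF half_plane_wf[OF G]] by auto
  then show "app (op (adjoin_boundary_vertex (Suc a) y)) (vec G) = app (q *\<^sub>R P (2 * a) + (y - 1) *\<^sub>R \<pi>) (vec G)"
    using op_attach[OF G assms, of w] q4 by (simp add: P_def \<pi>_vec)
qed (simp_all add: distrib_right op_\<pi> P_\<pi> \<pi>_idem)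

end

section \<open>Gaussian elimination by row additions\<close>

definition unit_columns :: "nat \<Rightarrow> nat \<Rightarrow> real mat \<Rightarrow> bool" where
  "unit_columns N k A \<longleftrightarrow> A \<in> carrier_mat N N \<and> (\<forall>i<N. \<forall>j<k. A $$ (i, j) = (if i = j then 1 else 0))"

lemma unit_columns_addrow:
  assumes "unit_columns N k A" "k \<le> l" "l < N" "i < N" "k \<le> N"
  shows "unit_columns N k (mat_addrow a i l A)"
  using assms by (auto simp: unit_columns_def)

text \<open>
  Otherwise the first \<open>k\<close> columns, which are unit vectors, would span column \<open>k\<close>, and the vector \<open>?v\<close> of this
  linear dependence would be in the kernel.
\<close>

lemma nonzero_in_column:
  assumes A: "unit_columns N k A" and k: "k < N" and d: "Determinant.det A \<noteq> 0"
  shows "\<exists>r. k \<le> r \<and> r < N \<and> A $$ (r, k) \<noteq> 0"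
proof (rule ccontr)
  assume neg: "\<not> ?thesis"
  have C: "A \<in> carrier_mat N N" using A by (simp add: unit_columns_def)
  let ?v = "Matrix.vec N (\<lambda>j. if j = k then 1 else if j < k then - A $$ (j, k) else (0::real))"
  have "A *\<^sub>v ?v = 0\<^sub>v N"
  proof (rule eq_vecI)
    fix i assume i: "i < dim_vec (0\<^sub>v N :: real Matrix.vec)"
    then have iN: "i < N" by simp
    have "vec_index (A *\<^sub>v ?v) i = (\<Sum>j\<in>{0..<N}. A $$ (i, j) * (if j = k then 1 else if j < k then - A $$ (j, k) else 0))"
      using C iN by (simp add: scalar_prod_def)
    also have "\<dots> = (\<Sum>j\<in>{0..<N}. (if j = k then A $$ (i, k) else 0) + (if j = i then (if i < k then - A $$ (i, k) else 0) else 0))"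
      by (rule sum.cong) (use A iN in \<open>auto simp: unit_columns_def\<close>)
    also have "\<dots> = A $$ (i, k) + (if i < k then - A $$ (i, k) else 0)"
      using k iN by (simp add: sum.distrib)
    also have "\<dots> = 0" using neg iN by auto
    finally show "vec_index (A *\<^sub>v ?v) i = vec_index (0\<^sub>v N) i" using iN by simp
  qed (use C in auto)
  moreover have "?v \<noteq> 0\<^sub>v N"
  proof
    assume "?v = 0\<^sub>v N"
    then have "vec_index ?v k = vec_index (0\<^sub>v N) k" by simp
    then show False using k by simp
  qed
  ultimately have "Determinant.det A = 0"
    unfolding det_0_iff_vec_prod_zero_field[OF C] by (intro exI[of _ ?v]) simp
  then show False using d by simp
qed

text \<open>
  Determinant one makes scalings unnecessary: columns are cleared from left to right, where a pivot is set to \<open>1\<close> by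
  adding a multiple of another row, and the last pivot is the determinant.
\<close>

theorem row_addition_generates:
  fixes K :: "real mat set"
  assumes one: "1\<^sub>m N \<in> K"
    and closed: "\<And>A a k l. A \<in> K \<Longrightarrow> A \<in> carrier_mat N N \<Longrightarrow> k < N \<Longrightarrow> l < N \<Longrightarrow> k \<noteq> l \<Longrightarrow> mat_addrow a k l A \<in> K"
    and A: "A \<in> carrier_mat N N" "Determinant.det A = 1"
  shows "A \<in> K"
proof -
  have undo: "A \<in> K" if "A \<in> carrier_mat N N" "k < N" "l < N" "k \<noteq> l" "mat_addrow a k l A \<in> K" for A a k l
  proof -
    have "mat_addrow (- a) k l (mat_addrow a k l A) = A"
      using that(1-4) by (intro eq_matI) auto
    moreover have "mat_addrow (- a) k l (mat_addrow a k l A) \<in> K"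
      by (rule closed[OF that(5)]) (use that in auto)
    ultimately show ?thesis by simp
  qed
  have main: "A \<in> K" if "unit_columns N k A" "k \<le> N" "Determinant.det A = 1" for k A
    using that
  proof (induction "N - k" arbitrary: k A)
    case 0
    then have "A = 1\<^sub>m N" by (intro eq_matI) (auto simp: unit_columns_def)
    then show ?case using one by simp
  next
    case (Suc d)
    then have k: "k < N" by simp
    have IH: "B \<in> K" if "unit_columns N (Suc k) B" "Determinant.det B = 1" for B
      using Suc(1)[of "Suc k" B] Suc(2) that k by simp
    have clear: "B \<in> K" if "unit_columns N k B" "B $$ (k, k) = 1" "Determinant.det B = 1" for B
      using that
    proof (induction "card {i. i < N \<and> i \<noteq> k \<and> B $$ (i, k) \<noteq> 0}" arbitrary: B rule: less_induct)
      case less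
      have C: "B \<in> carrier_mat N N" using less.prems by (simp add: unit_columns_def)
      show ?case
      proof (cases "\<exists>i<N. i \<noteq> k \<and> B $$ (i, k) \<noteq> 0")
        case False
        then have "unit_columns N (Suc k) B" using less.prems by (auto simp: unit_columns_def less_Suc_eq)
        then show ?thesis using IH less.prems by simp
      next
        case True
        then obtain i where i: "i < N" "i \<noteq> k" "B $$ (i, k) \<noteq> 0" by blast
        let ?B = "mat_addrow (- B $$ (i, k)) i k B"
        have entry: "?B $$ (j, k) = (if j = i then 0 else B $$ (j, k))" if "j < N" for j
          using that C i k less.prems(2) by auto
        have "{j. j < N \<and> j \<noteq> k \<and> ?B $$ (j, k) \<noteq> 0} \<subset> {j. j < N \<and> j \<noteq> k \<and> B $$ (j, k) \<noteq> 0}"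
        proof (rule psubsetI)
          show "{j. j < N \<and> j \<noteq> k \<and> ?B $$ (j, k) \<noteq> 0} \<subseteq> {j. j < N \<and> j \<noteq> k \<and> B $$ (j, k) \<noteq> 0}"
            by (intro Collect_mono impI, elim conjE) (simp only: entry split: if_splits, simp)
          have "i \<notin> {j. j < N \<and> j \<noteq> k \<and> ?B $$ (j, k) \<noteq> 0}" using entry[OF i(1)] by simp
          then show "{j. j < N \<and> j \<noteq> k \<and> ?B $$ (j, k) \<noteq> 0} \<noteq> {j. j < N \<and> j \<noteq> k \<and> B $$ (j, k) \<noteq> 0}"
            using i by blast
        qed
        then have "card {j. j < N \<and> j \<noteq> k \<and> ?B $$ (j, k) \<noteq> 0} < card {j. j < N \<and> j \<noteq> k \<and> B $$ (j, k) \<noteq> 0}"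
          by (intro psubset_card_mono) auto
        then have "?B \<in> K"
        proof (rule less.hyps)
          show "unit_columns N k ?B" by (rule unit_columns_addrow) (use less.prems i k in auto)
          show "?B $$ (k, k) = 1" using entry[OF k] i less.prems by simp
          show "Determinant.det ?B = 1" using det_addrow[OF k i(2) C] less.prems by simp
        qed
        then show ?thesis by (rule undo[OF C i(1) k i(2)])
      qed
    qed
    have C: "A \<in> carrier_mat N N" using Suc.prems by (simp add: unit_columns_def)
    have below: "B \<in> K" if B: "unit_columns N k B" "Determinant.det B = 1" and r: "k < r" "r < N" "B $$ (r, k) \<noteq> 0" for B r
    proof -
      have CB: "B \<in> carrier_mat N N" using B by (simp add: unit_columns_def)
      let ?B = "mat_addrow ((1 - B $$ (k, k)) / B $$ (r, k)) k r B"
      have "?B \<in> K"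
      proof (rule clear)
        show "unit_columns N k ?B" by (rule unit_columns_addrow) (use B r k in auto)
        show "?B $$ (k, k) = 1" using CB k r by simp
        show "Determinant.det ?B = 1" using det_addrow[OF r(2) _ CB, of k] r B by simp
      qed
      from undo[OF CB k r(2) _ this] show ?thesis using r by simp
    qed
    obtain r where r: "k \<le> r" "r < N" "A $$ (r, k) \<noteq> 0"
      using nonzero_in_column[OF Suc.prems(1) k] Suc.prems by auto
    show ?case
    proof (cases "Suc k < N")
      case False
      then have N: "N = Suc k" using k by simp
      have "upper_triangular A" using Suc.prems(1) N by (auto simp: unit_columns_def)
      then have "Determinant.det A = prod_list (diag_mat A)" by (rule det_upper_triangular[OF _ C])
      also have "\<dots> = (\<Prod>i\<in>{0..<N}. A $$ (i, i))" using C by (simp add: prod_list_diag_prod)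
      also have "\<dots> = (\<Prod>i\<in>{0..<k}. A $$ (i, i)) * A $$ (k, k)" using N by (simp add: prod.atLeast0_lessThan_Suc)
      also have "(\<Prod>i\<in>{0..<k}. A $$ (i, i)) = 1" using Suc.prems(1) k by (intro prod.neutral) (auto simp: unit_columns_def)
      finally show ?thesis using clear[OF Suc.prems(1)] Suc.prems by simp
    next
      case True
      show ?thesis
      proof (cases "A $$ (Suc k, k) = 0 \<and> r = k")
        case False
        then have "A $$ (Suc k, k) \<noteq> 0 \<or> k < r" using r by auto
        then show ?thesis
        proof
          assume "A $$ (Suc k, k) \<noteq> 0"
          from below[OF Suc.prems(1,3) lessI True this] show ?thesis .
        next
          assume "k < r"
          from below[OF Suc.prems(1,3) this r(2,3)] show ?thesis .
        qed
      next
        case h: True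
        let ?B = "mat_addrow 1 (Suc k) k A"
        have "?B \<in> K"
        proof (rule below[of _ "Suc k"])
          show "unit_columns N k ?B" by (rule unit_columns_addrow) (use Suc.prems k True in auto)
          show "Determinant.det ?B = 1" using det_addrow[OF k _ C, of "Suc k"] Suc.prems by simp
          show "?B $$ (Suc k, k) \<noteq> 0" using C k True h r by simp
        qed (use True in auto)
        from undo[OF C True k _ this] show ?thesis by simp
      qed
    qed
  qed
  have "unit_columns N 0 A" using A by (simp add: unit_columns_def)
  then show ?thesis using main[of 0 A] A by simp
qed

lemma leibniz_over_basis:
  assumes b: "bij_betw b {0..<N} B"
  shows "(\<Sum>p | p permutes B. of_int (sign p) * (\<Prod>x\<in>B. h x (p x)))
    = Determinant.det (Matrix.mat N N (\<lambda>(i, j). h (b i) (b j) :: real))"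
proof -
  let ?m = "map_permutation {0..<N} b"
  have inj: "inj_on b {0..<N}" using b by (simp add: bij_betw_def)
  have fin: "finite B" using b bij_betw_finite by blast
  let ?c = "inv_into {0..<N} b"
  have c: "bij_betw ?c B {0..<N}" by (rule bij_betw_inv_into[OF b])
  have bij: "bij_betw ?m {p. p permutes {0..<N}} {p. p permutes B}"
  proof (rule bij_betw_byWitness[where f' = "map_permutation B ?c"])
    show "\<forall>p\<in>{p. p permutes {0..<N}}. map_permutation B ?c (?m p) = p"
      using map_permutation_compose_inv[OF b] bij_betw_inv_into_left[OF b] by simp
    show "\<forall>p\<in>{p. p permutes B}. ?m (map_permutation B ?c p) = p"
      using map_permutation_compose_inv[OF c] bij_betw_inv_into_right[OF b] by simp
    show "?m ` {p. p permutes {0..<N}} \<subseteq> {p. p permutes B}" using map_permutation_permutes[OF b] by auto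
    show "map_permutation B ?c ` {p. p permutes B} \<subseteq> {p. p permutes {0..<N}}" using map_permutation_permutes[OF c] by auto
  qed
  have "(\<Sum>p | p permutes B. of_int (sign p) * (\<Prod>x\<in>B. h x (p x)))
    = (\<Sum>p | p permutes {0..<N}. of_int (sign (?m p)) * (\<Prod>x\<in>B. h x (?m p x)))"
    by (rule sum.reindex_bij_betw[OF bij, symmetric])
  also have "\<dots> = (\<Sum>p | p permutes {0..<N}. signof p * (\<Prod>i=0..<N. Matrix.mat N N (\<lambda>(i, j). h (b i) (b j)) $$ (i, p i)))"
  proof (rule sum.cong[OF refl])
    fix p assume "p \<in> {p. p permutes {0..<N}}"
    then have p: "p permutes {0..<N}" by simp
    have "(\<Prod>x\<in>B. h x (?m p x)) = (\<Prod>i\<in>{0..<N}. h (b i) (?m p (b i)))"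
      by (rule prod.reindex_bij_betw[OF b, symmetric])
    also have "\<dots> = (\<Prod>i=0..<N. Matrix.mat N N (\<lambda>(i, j). h (b i) (b j)) $$ (i, p i))"
      using map_permutation_apply[OF inj] permutes_in_image[OF p] by (intro prod.cong) auto
    moreover have "sign (?m p) = sign p" using sign_map_permutation[OF inj p finite_atLeastLessThan] by simp
    ultimately show "of_int (sign (?m p)) * (\<Prod>x\<in>B. h x (?m p x))
      = signof p * (\<Prod>i=0..<N. Matrix.mat N N (\<lambda>(i, j). h (b i) (b j)) $$ (i, p i))" by simp
  qed
  also have "\<dots> = Determinant.det (Matrix.mat N N (\<lambda>(i, j). h (b i) (b j)))"
    by (rule det_def'[symmetric]) simp
  finally show ?thesis .
qed

section \<open>The projective linear group of a quotient space\<close>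

locale quotient_module =
  fixes W U :: "'v::real_vector set"
  assumes W: "subspace W" and U: "subspace U"
begin

abbreviation V where "V \<equiv> quotient_space W U"

definition cls where "cls x = (+) x ` U"

lemma cls_eq: "cls x = cls y \<longleftrightarrow> x - y \<in> U"
proof
  assume eq: "cls x = cls y"
  have "x + 0 \<in> cls x" unfolding cls_def using subspace_0[OF U] by (rule imageI)
  then obtain u where "u \<in> U" "x = y + u" unfolding eq unfolding cls_def by auto
  then show "x - y \<in> U" by simp
next
  assume d: "x - y \<in> U"
  have "x + u \<in> cls y" if "u \<in> U" for u
  proof -
    have "x + u = y + ((x - y) + u)" by simp
    then show ?thesis unfolding cls_def using subspace_add[OF U d that] by (rule image_eqI)
  qed
  moreover have "y + u \<in> cls x" if "u \<in> U" for u
  proof -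
    have "y + u = x + (u - (x - y))" by simp
    then show ?thesis unfolding cls_def using subspace_diff[OF U that d] by (rule image_eqI)
  qed
  ultimately show "cls x = cls y" unfolding cls_def[of x] cls_def[of y] unfolding cls_def by auto
qed

lemma carrier_V: "carrier V = cls ` W"
  by (simp add: quotient_space_def cls_def)

lemma cls_carrier: "x \<in> W \<Longrightarrow> cls x \<in> carrier V"
  by (simp add: carrier_V)

lemma in_cls: "y \<in> cls x \<longleftrightarrow> y - x \<in> U"
proof
  assume "y - x \<in> U"
  then have "x + (y - x) \<in> cls x" unfolding cls_def by (rule imageI)
  then show "y \<in> cls x" by simp
qed (auto simp: cls_def)

lemma cls_add: "cls x \<oplus>\<^bsub>V\<^esub> cls y = cls (x + y)"
proof -
  have "{a + b |a b. a \<in> cls x \<and> b \<in> cls y} = cls (x + y)"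
  proof (rule equalityI; rule subsetI)
    fix z assume "z \<in> {a + b |a b. a \<in> cls x \<and> b \<in> cls y}"
    then obtain a b where ab: "z = a + b" "a - x \<in> U" "b - y \<in> U" by (auto simp: in_cls)
    have eq: "z - (x + y) = (a - x) + (b - y)" using ab by simp
    show "z \<in> cls (x + y)" unfolding in_cls eq by (rule subspace_add[OF U ab(2,3)])
  next
    fix z assume "z \<in> cls (x + y)"
    then have "x \<in> cls x" "z - x \<in> cls y" using subspace_0[OF U] by (auto simp: in_cls diff_diff_eq)
    then show "z \<in> {a + b |a b. a \<in> cls x \<and> b \<in> cls y}" by (intro CollectI exI[of _ x] exI[of _ "z - x"]) simp
  qed
  then show ?thesis by (simp add: quotient_space_def)
qed

lemma cls_smult: "r \<odot>\<^bsub>V\<^esub> cls x = cls (r *\<^sub>R x)"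
proof -
  have "{r *\<^sub>R a + u |a u. a \<in> cls x \<and> u \<in> U} = cls (r *\<^sub>R x)"
  proof (rule equalityI; rule subsetI)
    fix z assume "z \<in> {r *\<^sub>R a + u |a u. a \<in> cls x \<and> u \<in> U}"
    then obtain a u where ab: "z = r *\<^sub>R a + u" "a - x \<in> U" "u \<in> U" by (auto simp: in_cls)
    have eq: "z - r *\<^sub>R x = r *\<^sub>R (a - x) + u" using ab by (simp add: algebra_simps)
    show "z \<in> cls (r *\<^sub>R x)" unfolding in_cls eq by (rule subspace_add[OF U subspace_scale[OF U ab(2)] ab(3)])
  next
    fix z assume "z \<in> cls (r *\<^sub>R x)"
    then have "x \<in> cls x" "z - r *\<^sub>R x \<in> U" using subspace_0[OF U] by (auto simp: in_cls)
    then show "z \<in> {r *\<^sub>R a + u |a u. a \<in> cls x \<and> u \<in> U}" by (intro CollectI exI[of _ x] exI[of _ "z - r *\<^sub>R x"]) simp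
  qed
  then show ?thesis by (simp add: quotient_space_def)
qed

lemma cls_zero: "\<zero>\<^bsub>V\<^esub> = cls 0"
  by (simp add: quotient_space_def cls_def)

lemma carrierE: assumes "X \<in> carrier V" obtains x where "x \<in> W" "X = cls x"
  using assms by (auto simp: carrier_V)

sublocale V: abelian_group V
proof (rule abelian_groupI)
  fix X Y Z assume "X \<in> carrier V" "Y \<in> carrier V" "Z \<in> carrier V"
  then show "X \<oplus>\<^bsub>V\<^esub> Y \<oplus>\<^bsub>V\<^esub> Z = X \<oplus>\<^bsub>V\<^esub> (Y \<oplus>\<^bsub>V\<^esub> Z)"
    by (auto elim!: carrierE simp: cls_add add.assoc)
next
  fix X assume "X \<in> carrier V"
  then obtain x where x: "x \<in> W" "X = cls x" by (rule carrierE)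
  then have "- x \<in> W" using W by (simp add: subspace_neg)
  then show "\<exists>Y\<in>carrier V. Y \<oplus>\<^bsub>V\<^esub> X = \<zero>\<^bsub>V\<^esub>"
    by (intro bexI[of _ "cls (- x)"] cls_carrier) (auto simp: x cls_add cls_zero)
qed (auto elim!: carrierE simp: cls_add cls_zero add.commute intro!: cls_carrier subspace_add[OF W] subspace_0[OF W])

lemma finsum_cls: "finite B \<Longrightarrow> (\<And>b. b \<in> B \<Longrightarrow> h b \<in> W) \<Longrightarrow> (\<Oplus>\<^bsub>V\<^esub>b\<in>B. cls (h b)) = cls (\<Sum>b\<in>B. h b)"
proof (induction B rule: finite_induct)
  case (insert b B)
  then show ?case by (subst V.finsum_insert) (auto intro!: cls_carrier simp: cls_add)
qed (simp add: cls_zero)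

lemma GL_iff: "f \<in> carrier (GL V) \<longleftrightarrow> f \<in> Bij (carrier V) \<and>
    (\<forall>x\<in>W. \<forall>y\<in>W. f (cls (x + y)) = f (cls x) \<oplus>\<^bsub>V\<^esub> f (cls y)) \<and>
    (\<forall>c. \<forall>x\<in>W. f (cls (c *\<^sub>R x)) = c \<odot>\<^bsub>V\<^esub> f (cls x))"
proof -
  have "f \<in> carrier V \<rightarrow>\<^sub>E carrier V \<and> bij_betw f (carrier V) (carrier V) \<longleftrightarrow> f \<in> Bij (carrier V)"
    unfolding Bij_def PiE_def by (auto dest: bij_betwE)
  then show ?thesis unfolding GL_def by (auto simp: carrier_V cls_add cls_smult)
qed

lemma GL_mult: "f \<otimes>\<^bsub>GL V\<^esub> g = compose (carrier V) f g" and GL_one: "\<one>\<^bsub>GL V\<^esub> = restrict id (carrier V)"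
  by (simp_all add: GL_def)

lemma Bij_in: "f \<in> Bij (carrier V) \<Longrightarrow> X \<in> carrier V \<Longrightarrow> f X \<in> carrier V"
  using Bij_imp_funcset by blast

lemma scale_W: "x \<in> W \<Longrightarrow> r *\<^sub>R x \<in> W" and add_W: "x \<in> W \<Longrightarrow> y \<in> W \<Longrightarrow> x + y \<in> W"
  using W by (auto simp: subspace_scale subspace_add)

lemma group_GL: "group (GL V)"
proof (rule groupI)
  fix f g assume fg: "f \<in> carrier (GL V)" "g \<in> carrier (GL V)"
  show "f \<otimes>\<^bsub>GL V\<^esub> g \<in> carrier (GL V)"
    unfolding GL_mult GL_iff
  proof (intro conjI ballI allI)
    show "compose (carrier V) f g \<in> Bij (carrier V)" using fg by (intro compose_Bij) (auto simp: GL_iff)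
    fix x assume x: "x \<in> W"
    obtain x' where x': "x' \<in> W" "g (cls x) = cls x'" using Bij_in[of g "cls x"] fg x cls_carrier by (auto simp: GL_iff elim!: carrierE)
    { fix y assume y: "y \<in> W"
      obtain y' where y': "y' \<in> W" "g (cls y) = cls y'" using Bij_in[of g "cls y"] fg y cls_carrier by (auto simp: GL_iff elim!: carrierE)
      have "g (cls (x + y)) = cls (x' + y')" using fg x y x' y' by (simp add: GL_iff cls_add)
      then show "compose (carrier V) f g (cls (x + y)) = compose (carrier V) f g (cls x) \<oplus>\<^bsub>V\<^esub> compose (carrier V) f g (cls y)"
        using fg x y x' y' cls_carrier add_W by (simp add: compose_def GL_iff) }
    fix c
    have "g (cls (c *\<^sub>R x)) = cls (c *\<^sub>R x')" using fg x x' by (simp add: GL_iff cls_smult)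
    then show "compose (carrier V) f g (cls (c *\<^sub>R x)) = c \<odot>\<^bsub>V\<^esub> compose (carrier V) f g (cls x)"
      using fg x x' cls_carrier scale_W by (simp add: compose_def GL_iff)
  qed
next
  show "\<one>\<^bsub>GL V\<^esub> \<in> carrier (GL V)"
    using id_Bij[of "carrier V"] by (auto simp: GL_iff GL_one id_def cls_add cls_smult cls_carrier add_W scale_W)
next
  fix f g h assume fgh: "f \<in> carrier (GL V)" "g \<in> carrier (GL V)" "h \<in> carrier (GL V)"
  then have "h \<in> carrier V \<rightarrow> carrier V" using Bij_imp_funcset[of h "carrier V"] by (simp only: GL_iff)
  then show "f \<otimes>\<^bsub>GL V\<^esub> g \<otimes>\<^bsub>GL V\<^esub> h = f \<otimes>\<^bsub>GL V\<^esub> (g \<otimes>\<^bsub>GL V\<^esub> h)"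
    by (simp add: GL_mult compose_assoc[symmetric])
next
  fix f assume f: "f \<in> carrier (GL V)"
  then have fB: "f \<in> Bij (carrier V)" by (simp add: GL_iff)
  then show "\<one>\<^bsub>GL V\<^esub> \<otimes>\<^bsub>GL V\<^esub> f = f"
    unfolding GL_mult GL_one
    by (intro ext) (auto simp: compose_def Bij_def extensional_def dest: bij_betwE)
  let ?g = "\<lambda>x\<in>carrier V. inv_into (carrier V) f x"
  have gB: "?g \<in> Bij (carrier V)" by (rule restrict_inv_into_Bij[OF fB])
  have inj: "inj_on f (carrier V)" and surj: "f ` carrier V = carrier V" using fB by (auto simp: Bij_def bij_betw_def)
  have fg: "f (?g X) = X" if "X \<in> carrier V" for X using that surj by (simp add: f_inv_into_f)
  have gf: "?g (f X) = X" if "X \<in> carrier V" for X using that inj Bij_in[OF fB that] by simp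
  have "?g \<in> carrier (GL V)" unfolding GL_iff
  proof (intro conjI ballI allI gB)
    fix x assume x: "x \<in> W"
    obtain x' where x': "x' \<in> W" "?g (cls x) = cls x'" using Bij_in[OF gB cls_carrier[OF x]] by (rule carrierE)
    have fx: "f (cls x') = cls x" using fg[OF cls_carrier[OF x]] x' by simp
    { fix y assume y: "y \<in> W"
      obtain y' where y': "y' \<in> W" "?g (cls y) = cls y'" using Bij_in[OF gB cls_carrier[OF y]] by (rule carrierE)
      have fy: "f (cls y') = cls y" using fg[OF cls_carrier[OF y]] y' by simp
      have "f (cls (x' + y')) = cls (x + y)" using f x' y' fx fy by (simp add: GL_iff cls_add)
      then have "?g (cls (x + y)) = cls (x' + y')" using gf[OF cls_carrier[OF add_W[OF x'(1) y'(1)]]] by simp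
      then show "?g (cls (x + y)) = ?g (cls x) \<oplus>\<^bsub>V\<^esub> ?g (cls y)" unfolding x' y' by (simp add: cls_add) }
    fix c
    have "f (cls (c *\<^sub>R x')) = cls (c *\<^sub>R x)" using f x' fx by (simp add: GL_iff cls_smult)
    then have "?g (cls (c *\<^sub>R x)) = cls (c *\<^sub>R x')" using gf[OF cls_carrier[OF scale_W[OF x'(1)]]] by metis
    then show "?g (cls (c *\<^sub>R x)) = c \<odot>\<^bsub>V\<^esub> ?g (cls x)" unfolding x' by (simp add: cls_smult)
  qed
  moreover have "?g \<otimes>\<^bsub>GL V\<^esub> f = \<one>\<^bsub>GL V\<^esub>"
    unfolding GL_mult GL_one using Bij_compose_restrict_eq[OF fB] by (simp add: id_def)
  ultimately show "\<exists>g\<in>carrier (GL V). g \<otimes>\<^bsub>GL V\<^esub> f = \<one>\<^bsub>GL V\<^esub>" by blast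
qed

definition scal where "scal c = restrict (\<lambda>v. c \<odot>\<^bsub>V\<^esub> v) (carrier V)"

lemma scal_cls: "x \<in> W \<Longrightarrow> scal c (cls x) = cls (c *\<^sub>R x)"
  by (simp add: scal_def cls_carrier cls_smult)

lemma ext_eqI:
  assumes "f \<in> extensional (carrier V)" "g \<in> extensional (carrier V)" "\<And>x. x \<in> W \<Longrightarrow> f (cls x) = g (cls x)"
  shows "f = g"
  by (rule extensionalityI[OF assms(1,2)]) (auto elim!: carrierE simp: assms(3))

lemma scal_mult: "compose (carrier V) (scal c) (scal d) = scal (c * d)"
  by (rule ext_eqI) (auto simp: compose_def scal_def cls_carrier cls_smult scale_W)

lemma scal_1: "scal 1 = \<one>\<^bsub>GL V\<^esub>"
  unfolding GL_one by (rule ext_eqI) (auto simp: scal_cls cls_carrier, simp add: scal_def)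

lemma scal_GL: assumes "c \<noteq> 0" shows "scal c \<in> carrier (GL V)"
proof -
  have "bij_betw (scal c) (carrier V) (carrier V)"
    by (rule bij_betw_byWitness[where f' = "scal (1 / c)"])
      (use assms in \<open>auto elim!: carrierE simp: scal_cls scale_W cls_carrier\<close>)
  then have "scal c \<in> Bij (carrier V)" by (simp add: Bij_def scal_def)
  then show ?thesis
    by (auto simp: GL_iff scal_cls add_W scale_W cls_add cls_smult scaleR_add_right mult.commute)
qed

lemma scalar_maps_eq: "scalar_maps V = {scal c |c. c \<noteq> 0}"
  by (simp add: scalar_maps_def scal_def)

lemma normal_scalars: "scalar_maps V \<lhd> GL V"
proof -
  interpret G: group "GL V" by (rule group_GL)
  have comm: "f \<otimes>\<^bsub>GL V\<^esub> scal c = scal c \<otimes>\<^bsub>GL V\<^esub> f" if f: "f \<in> carrier (GL V)" "c \<noteq> 0" for f c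
    unfolding GL_mult
  proof (rule ext_eqI)
    fix x assume x: "x \<in> W"
    obtain x' where x': "x' \<in> W" "f (cls x) = cls x'" using Bij_in[of f "cls x"] f x cls_carrier by (auto simp: GL_iff elim!: carrierE)
    show "compose (carrier V) f (scal c) (cls x) = compose (carrier V) (scal c) f (cls x)"
      using x x' f by (simp add: compose_def cls_carrier scal_cls GL_iff cls_smult)
  qed auto
  have inv: "inv\<^bsub>GL V\<^esub> (scal c) = scal (1 / c)" if "c \<noteq> 0" for c
    by (rule G.inv_equality) (use that scal_GL in \<open>auto simp: GL_mult scal_mult scal_1\<close>)
  have "subgroup (scalar_maps V) (GL V)"
  proof (rule G.subgroupI)
    show "scalar_maps V \<subseteq> carrier (GL V)" using scal_GL by (auto simp: scalar_maps_eq)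
    have "scal 1 \<in> scalar_maps V" unfolding scalar_maps_eq by (intro CollectI exI[of _ 1]) simp
    then show "scalar_maps V \<noteq> {}" by blast
  next
    fix f assume "f \<in> scalar_maps V"
    then obtain c where c: "f = scal c" "c \<noteq> 0" by (auto simp: scalar_maps_eq)
    then show "inv\<^bsub>GL V\<^esub> f \<in> scalar_maps V" unfolding scalar_maps_eq c inv[OF c(2)] by (intro CollectI exI[of _ "1 / c"]) simp
  next
    fix f g assume "f \<in> scalar_maps V" "g \<in> scalar_maps V"
    then obtain c d where "f = scal c" "g = scal d" "c \<noteq> 0" "d \<noteq> 0" by (auto simp: scalar_maps_eq)
    then show "f \<otimes>\<^bsub>GL V\<^esub> g \<in> scalar_maps V" unfolding scalar_maps_eq by (intro CollectI exI[of _ "c * d"]) (simp add: GL_mult scal_mult)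
  qed
  moreover have "f \<otimes>\<^bsub>GL V\<^esub> h \<otimes>\<^bsub>GL V\<^esub> inv\<^bsub>GL V\<^esub> f \<in> scalar_maps V" if fh: "f \<in> carrier (GL V)" "h \<in> scalar_maps V" for f h
  proof -
    obtain c where c: "h = scal c" "c \<noteq> 0" using fh by (auto simp: scalar_maps_eq)
    have "f \<otimes>\<^bsub>GL V\<^esub> h \<otimes>\<^bsub>GL V\<^esub> inv\<^bsub>GL V\<^esub> f = h"
      unfolding c(1) comm[OF fh(1) c(2)] using fh(1) scal_GL[OF c(2)] by (simp add: G.m_assoc)
    then show ?thesis using fh by simp
  qed
  ultimately show ?thesis by (simp add: G.normal_inv_iff)
qed

lemma proj_class_mult:
  assumes "f \<in> carrier (GL V)" "g \<in> carrier (GL V)"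
  shows "proj_class V (f \<otimes>\<^bsub>GL V\<^esub> g) = proj_class V f \<otimes>\<^bsub>PGL V\<^esub> proj_class V g"
  unfolding proj_class_def PGL_def FactGroup_def
  using normal.rcos_sum[OF normal_scalars assms] by simp

lemma proj_class_one: "proj_class V \<one>\<^bsub>GL V\<^esub> = \<one>\<^bsub>PGL V\<^esub>"
  unfolding proj_class_def PGL_def FactGroup_def
  using group.coset_mult_one[OF group_GL] normal_imp_subgroup[OF normal_scalars] by (simp add: subgroup.subset)

text \<open>
  This absorbs the scalar factors by which the operators \<open>B\<close> differ from elements \<open>1 + t P i\<close>.
\<close>

lemma proj_class_scalar:
  assumes "c \<noteq> 0" "f \<in> carrier (GL V)"
  shows "proj_class V (scal c \<otimes>\<^bsub>GL V\<^esub> f) = proj_class V f"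
proof -
  interpret G: group "GL V" by (rule group_GL)
  note S = normal_imp_subgroup[OF normal_scalars]
  have m: "scal c \<in> scalar_maps V" using assms(1) by (auto simp: scalar_maps_eq)
  have "scalar_maps V #>\<^bsub>GL V\<^esub> (scal c \<otimes>\<^bsub>GL V\<^esub> f) = scalar_maps V #>\<^bsub>GL V\<^esub> scal c #>\<^bsub>GL V\<^esub> f"
    by (rule G.coset_mult_assoc[symmetric]) (use subgroup.subset[OF S] scal_GL assms in auto)
  also have "scalar_maps V #>\<^bsub>GL V\<^esub> scal c = scalar_maps V" by (rule subgroup.rcos_const[OF S group_GL m])
  finally show ?thesis by (simp add: proj_class_def)
qed

end

section \<open>From the Temperley-Lieb group to the projective group\<close>

text \<open>
  The group generated by the elements \<open>1 + t P i\<close>; it is enough to close under right multiplication, since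
  the inverses of the generators are again of this form.
\<close>

inductive_set edge_group :: "(nat \<Rightarrow> 'a::real_algebra_1) \<Rightarrow> nat \<Rightarrow> 'a set" for P M where
  one: "1 \<in> edge_group P M"
| step: "g \<in> edge_group P M \<Longrightarrow> i < M \<Longrightarrow> t \<noteq> - 1 \<Longrightarrow> g * (1 + t *\<^sub>R P i) \<in> edge_group P M"

lemma edge_group_mult: "h \<in> edge_group P M \<Longrightarrow> g \<in> edge_group P M \<Longrightarrow> g * h \<in> edge_group P M"
  by (induction rule: edge_group.induct) (auto simp: mult.assoc[symmetric] intro: edge_group.intros)

lemma edge_group_gen: "i < M \<Longrightarrow> t \<noteq> - 1 \<Longrightarrow> 1 + t *\<^sub>R P i \<in> edge_group P M"
  using edge_group.step[OF edge_group.one, of i M t P] by simp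

lemma edge_group_inverse:
  assumes "\<And>i. i < M \<Longrightarrow> P i * P i = P i" "g \<in> edge_group P M"
  shows "\<exists>h\<in>edge_group P M. g * h = 1 \<and> h * g = 1"
  using assms(2)
proof (induction rule: edge_group.induct)
  case one
  then show ?case by (intro bexI[of _ 1] edge_group.one) simp
next
  case (step g i t)
  then obtain h where h: "h \<in> edge_group P M" "g * h = 1" "h * g = 1" by blast
  define s where "s = - t / (1 + t)"
  have t1: "1 + t \<noteq> 0" using step by linarith
  have s: "s \<noteq> - 1" using t1 by (simp add: s_def field_simps)
  have ts: "t + s + t * s = 0" using t1 by (simp add: s_def field_simps)
  have exp: "(1 + a *\<^sub>R P i) * (1 + b *\<^sub>R P i) = 1 + (a + b + a * b) *\<^sub>R P i" for a b
    using assms(1)[OF step.hyps(2)] by (simp add: algebra_simps)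
  have 1: "(1 + t *\<^sub>R P i) * (1 + s *\<^sub>R P i) = 1" "(1 + s *\<^sub>R P i) * (1 + t *\<^sub>R P i) = 1"
    unfolding exp using ts by (simp_all add: algebra_simps)
  have 2: "(1 + t *\<^sub>R P i) * ((1 + s *\<^sub>R P i) * x) = x" "h * (g * x) = x" for x
    using 1(1) h(3) by (metis mult.assoc mult_1_left)+
  show ?case
  proof (rule bexI[of _ "(1 + s *\<^sub>R P i) * h"], intro conjI)
    show "(1 + s *\<^sub>R P i) * h \<in> edge_group P M" by (rule edge_group_mult[OF h(1) edge_group_gen[OF step.hyps(2) s]])
    show "g * (1 + t *\<^sub>R P i) * ((1 + s *\<^sub>R P i) * h) = 1" by (simp only: mult.assoc 2 h(2))
    show "(1 + s *\<^sub>R P i) * h * (g * (1 + t *\<^sub>R P i)) = 1" by (simp only: mult.assoc 2 1)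
  qed
qed

context skein_projection
begin

sublocale Q: quotient_module "graph_space n" "relation_space q n"
  by unfold_locales (rule subspace_graph_space subspace_relation_space)+

lemma skein_space_eq: "skein_space q n = Q.V"
  by (simp add: skein_space_def graph_space_def relation_space_def)

text \<open>
  The map of cosets induced by a linear map \<open>g\<close> of the range of \<open>\<pi>\<close>. The chosen representative does not matter, because
  \<open>\<pi>\<close> takes the same value on all of them.
\<close>

definition lift :: "wgraph endo \<Rightarrow> (wgraph \<Rightarrow>\<^sub>0 real) set \<Rightarrow> (wgraph \<Rightarrow>\<^sub>0 real) set" where
  "lift g = (\<lambda>X\<in>carrier Q.V. Q.cls (app g (app \<pi> (SOME x. x \<in> X))))"

lemma \<pi>_some: "app \<pi> (SOME y. y \<in> Q.cls x) = app \<pi> x"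
proof -
  have "x \<in> Q.cls x" by (simp add: Q.in_cls subspace_0[OF Q.U])
  then have "(SOME y. y \<in> Q.cls x) \<in> Q.cls x" by (rule someI)
  then show ?thesis by (intro \<pi>_cong) (simp add: Q.in_cls)
qed

lemma lift_cls: "x \<in> graph_space n \<Longrightarrow> lift g (Q.cls x) = Q.cls (app g (app \<pi> x))"
  by (simp add: lift_def Q.cls_carrier \<pi>_some)

lemma cls_\<pi>: "x \<in> graph_space n \<Longrightarrow> Q.cls (app \<pi> x) = Q.cls x"
  using \<pi>_W by (simp add: Q.cls_eq)

lemma app_\<pi>_\<pi>: "app \<pi> (app \<pi> x) = app \<pi> x"
  using \<pi>_idem by (metis app_times)

lemma commute_range: "g * \<pi> = \<pi> * g \<Longrightarrow> app g (app \<pi> x) = app \<pi> (app g x)"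
  by (metis app_times)

lemma commute_in: "g * \<pi> = \<pi> * g \<Longrightarrow> app g (app \<pi> x) \<in> graph_space n"
  using commute_range \<pi>_range by metis

lemma lift_mult:
  assumes "g * \<pi> = \<pi> * g" "h * \<pi> = \<pi> * h"
  shows "lift (g * h) = compose (carrier Q.V) (lift g) (lift h)"
proof (rule Q.ext_eqI)
  fix x assume x: "x \<in> graph_space n"
  show "lift (g * h) (Q.cls x) = compose (carrier Q.V) (lift g) (lift h) (Q.cls x)"
    using x commute_in[OF assms(2)] by (simp add: compose_def Q.cls_carrier lift_cls commute_range[OF assms(2)] app_\<pi>_\<pi>)
qed (auto simp: lift_def)

lemma lift_1: "lift 1 = \<one>\<^bsub>GL Q.V\<^esub>"
  unfolding Q.GL_one
proof (rule Q.ext_eqI)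
  fix x assume "x \<in> graph_space n"
  then show "lift 1 (Q.cls x) = restrict id (carrier Q.V) (Q.cls x)"
    by (simp add: lift_cls Q.cls_carrier cls_\<pi>)
qed (auto simp: lift_def)

lemma lift_GL:
  assumes g: "g * \<pi> = \<pi> * g" and h: "h * \<pi> = \<pi> * h" and gh: "g * h = 1" "h * g = 1"
  shows "lift g \<in> carrier (GL Q.V)"
proof -
  have cancel: "lift a (lift b X) = X" if "a * \<pi> = \<pi> * a" "b * \<pi> = \<pi> * b" "a * b = 1" "X \<in> carrier Q.V" for a b X
  proof -
    have "compose (carrier Q.V) (lift a) (lift b) X = restrict id (carrier Q.V) X"
      using lift_mult[OF that(1,2)] that(3) lift_1 Q.GL_one by simp
    then show ?thesis using that(4) by (simp add: compose_def)
  qed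
  have maps: "lift a ` carrier Q.V \<subseteq> carrier Q.V" if "a * \<pi> = \<pi> * a" for a
    using commute_in[OF that] by (auto elim!: Q.carrierE simp: lift_cls Q.cls_carrier)
  have "bij_betw (lift g) (carrier Q.V) (carrier Q.V)"
    by (rule bij_betw_byWitness[where f' = "lift h"])
      (use cancel[OF g h gh(1)] cancel[OF h g gh(2)] maps g h in auto)
  then have "lift g \<in> Bij (carrier Q.V)" by (simp add: Bij_def lift_def)
  then show ?thesis
    unfolding Q.GL_iff by (simp add: lift_cls Q.add_W Q.scale_W app_linear Q.cls_add Q.cls_smult)
qed

abbreviation M where "M \<equiv> 2 * n - 1"
abbreviation Gam where "Gam \<equiv> edge_group P M"

lemma Gam_\<pi>: "g \<in> Gam \<Longrightarrow> g * \<pi> = \<pi> * g"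
proof (induction rule: edge_group.induct)
  case (step g i t)
  have 1: "(1 + t *\<^sub>R P i) * \<pi> = \<pi> * (1 + t *\<^sub>R P i)" by (simp add: algebra_simps P_\<pi>)
  show ?case unfolding mult.assoc 1 unfolding mult.assoc[symmetric] step.IH ..
qed simp

lemma Gam_GL: "g \<in> Gam \<Longrightarrow> lift g \<in> carrier (GL Q.V)"
  using edge_group_inverse[of M P g, OF tl.idem] lift_GL Gam_\<pi> by blast

sublocale G: unit_group Gam
proof
  show "\<exists>h\<in>Gam. g * h = 1 \<and> h * g = 1" if "g \<in> Gam" for g
    by (rule edge_group_inverse[OF tl.idem that])
  show "1 \<in> Gam" by (rule edge_group.one)
  show "g * h \<in> Gam" if "g \<in> Gam" "h \<in> Gam" for g h by (rule edge_group_mult[OF that(2,1)])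
qed

sublocale TG: tl_unit_group P q M Gam
  by unfold_locales (rule edge_group_gen)

lemma induced_operator_lift:
  assumes pres: "\<And>r. r \<in> relation_space q n \<Longrightarrow> linear_extension f r \<in> relation_space q n"
    and img: "\<And>x. x \<in> graph_space n \<Longrightarrow> linear_extension f x \<in> graph_space n"
  shows "induced_operator q n f = lift (op f)"
proof -
  have "{linear_extension f y + r |y r. y \<in> Q.cls x \<and> r \<in> relation_space q n} = Q.cls (linear_extension f x)" for x
  proof (rule equalityI; rule subsetI)
    fix z assume "z \<in> {linear_extension f y + r |y r. y \<in> Q.cls x \<and> r \<in> relation_space q n}"
    then obtain y r where h: "z = linear_extension f y + r" "y - x \<in> relation_space q n" "r \<in> relation_space q n"
      by (auto simp: Q.in_cls)
    have eq: "z - linear_extension f x = linear_extension f (y - x) + r"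
      using h(1) by (simp add: linear_diff[OF linear_linear_extension])
    show "z \<in> Q.cls (linear_extension f x)"
      unfolding Q.in_cls eq by (rule subspace_add[OF Q.U pres[OF h(2)] h(3)])
  next
    fix z assume "z \<in> Q.cls (linear_extension f x)"
    then show "z \<in> {linear_extension f y + r |y r. y \<in> Q.cls x \<and> r \<in> relation_space q n}"
      by (intro CollectI exI[of _ x] exI[of _ "z - linear_extension f x"]) (simp add: Q.in_cls subspace_0[OF Q.U])
  qed
  note set_eq = this
  show ?thesis
  proof (rule Q.ext_eqI)
    fix x assume x: "x \<in> graph_space n"
    have "linear_extension f (app \<pi> x - x) \<in> relation_space q n" by (intro pres \<pi>_W x)
    then have "app \<pi> (linear_extension f (app \<pi> x)) = app \<pi> (linear_extension f x)"
      by (intro \<pi>_cong) (simp add: linear_diff[OF linear_linear_extension])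
    then have "app (op f) (app \<pi> x) = app \<pi> (linear_extension f x)"
      by (simp add: op_def app_Endo linear_linear_extension app_\<pi>_\<pi>)
    then show "induced_operator q n f (Q.cls x) = lift (op f) (Q.cls x)"
      using x set_eq[of x] img[OF x]
      by (simp add: induced_operator_def skein_space_eq Q.cls_carrier lift_cls cls_\<pi> relation_space_def[symmetric])
  qed (auto simp: induced_operator_def skein_space_eq lift_def)
qed

lemma extension_in_graph_space:
  assumes "\<And>G. half_plane_graph n G \<Longrightarrow> half_plane_graph n (f G)" "x \<in> graph_space n"
  shows "linear_extension f x \<in> graph_space n"
  unfolding graph_space_def
  by (rule linear_image_span_subset[OF linear_linear_extension _ assms(2)[unfolded graph_space_def]])
    (use assms(1) in \<open>auto intro!: span_base\<close>)

lemma half_plane_adjoin_boundary_vertex: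
  assumes "half_plane_graph n G" "1 \<le> j" "j \<le> n"
  shows "half_plane_graph n (adjoin_boundary_vertex j y G)"
proof -
  let ?w = "LEAST w. w \<notin> verts G"
  have "\<exists>w. w \<notin> verts G" using ex_new_if_finite wf_graphD(1)[OF half_plane_wf[OF assms(1)]] by (metis infinite_UNIV_nat)
  then have "?w \<notin> verts G" by (rule LeastI_ex)
  moreover have "adjoin_boundary_vertex j y G = attach ?w j y G"
    by (simp add: adjoin_boundary_vertex_def attach_def Let_def)
  ultimately show ?thesis using half_plane_attach[OF assms] by simp
qed

lemma lift_on_range: "(\<And>x. app g (app \<pi> x) = app h (app \<pi> x)) \<Longrightarrow> lift g = lift h"
  by (simp add: lift_def)

lemma A_op_lift:
  assumes "Suc a < n"
  shows "A_op q n (Suc a) y = lift (1 + (y - 1) *\<^sub>R P (Suc (2 * a)))"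
proof -
  have "A_op q n (Suc a) y = lift (op (adjoin_edge (Suc a) y))"
    unfolding A_op_def using assms
    by (intro induced_operator_lift adjoin_edge_preserves extension_in_graph_space half_plane_adjoin_edge) auto
  also have "\<dots> = lift (1 + (y - 1) *\<^sub>R P (Suc (2 * a)))"
    unfolding op_edge[OF assms] by (rule lift_on_range) (simp add: app_\<pi>_\<pi>)
  finally show ?thesis .
qed

lemma B_op_lift:
  assumes "a < n" "x \<noteq> 1"
  shows "B_op q n (Suc a) x = compose (carrier Q.V) (Q.scal (q / (x - 1))) (lift (1 + (x - 1) *\<^sub>R P (2 * a)))"
proof -
  let ?g = "1 + (x - 1) *\<^sub>R P (2 * a)"
  have comm: "?g * \<pi> = \<pi> * ?g" by (simp add: algebra_simps P_\<pi>)
  have "q + q / (x - 1) = q * x / (x - 1)" using assms(2) by (simp add: field_simps)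
  then have absorb: "q *\<^sub>R v + (q / (x - 1)) *\<^sub>R v = (q * x / (x - 1)) *\<^sub>R v" for v :: "'b::real_vector"
    by (metis scaleR_add_left)
  have "B_op q n (Suc a) x = lift (op (adjoin_boundary_vertex (Suc a) (1 + q / (x - 1))))"
    unfolding B_op_def using assms
    by (intro induced_operator_lift adjoin_boundary_vertex_preserves extension_in_graph_space half_plane_adjoin_boundary_vertex) auto
  also have "\<dots> = lift ((q / (x - 1)) *\<^sub>R ?g)"
    unfolding op_boundary_vertex[OF assms(1)]
    by (rule lift_on_range) (use assms(2) in \<open>simp add: app_\<pi>_\<pi> algebra_simps absorb\<close>)
  also have "\<dots> = compose (carrier Q.V) (Q.scal (q / (x - 1))) (lift ?g)"
  proof (rule Q.ext_eqI)
    fix v assume v: "v \<in> graph_space n"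
    show "lift ((q / (x - 1)) *\<^sub>R ?g) (Q.cls v) = compose (carrier Q.V) (Q.scal (q / (x - 1))) (lift ?g) (Q.cls v)"
      using v commute_in[OF comm, of v] by (simp add: compose_def Q.cls_carrier lift_cls Q.scal_cls del: app_plus)
  qed (auto simp: lift_def)
  finally show ?thesis .
qed

text \<open>
  Odd generators are the operators \<open>A\<close> of weight \<open>y = 1 + t\<close>, and even ones are, up to the scalar \<open>q / t\<close>, the operators
  \<open>B\<close> of dual weight \<open>x = 1 + t\<close>. The case \<open>t = 0\<close> is the identity, whereas weight \<open>1\<close> is excluded from the edge operators.
\<close>

lemma generator_in:
  assumes i: "i < M" and t: "t \<noteq> - 1"
  shows "proj_class Q.V (lift (1 + t *\<^sub>R P i)) \<in> generate (PGL Q.V) (proj_class Q.V ` edge_operators q n)"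
proof (cases "t = 0")
  case True
  then show ?thesis using generate.one[of "PGL Q.V"] by (simp add: lift_1 Q.proj_class_one)
next
  case False
  have GL: "lift (1 + t *\<^sub>R P i) \<in> carrier (GL Q.V)" by (intro Gam_GL edge_group_gen i t)
  show ?thesis
  proof (rule generator_cases[OF i])
    fix a assume a: "i = Suc (2 * a)" "Suc a < n"
    have "A_op q n (Suc a) (1 + t) = lift (1 + t *\<^sub>R P i)" using A_op_lift[OF a(2), of "1 + t"] a by simp
    then have "lift (1 + t *\<^sub>R P i) \<in> edge_operators q n"
      unfolding edge_operators_def skein_space_eq using GL a False
      by (intro UnI1 CollectI exI[of _ "Suc a"] exI[of _ "1 + t"]) auto
    then show ?thesis by (intro generate.incl imageI)
  next
    fix a assume a: "i = 2 * a" "a < n"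
    have c: "q / t \<noteq> 0" using q4 False by simp
    have B: "B_op q n (Suc a) (1 + t) = Q.scal (q / t) \<otimes>\<^bsub>GL Q.V\<^esub> lift (1 + t *\<^sub>R P i)"
      using B_op_lift[OF a(2), of "1 + t"] a False by (simp add: Q.GL_mult)
    have "B_op q n (Suc a) (1 + t) \<in> carrier (GL Q.V)"
      unfolding B using monoid.m_closed[OF group.is_monoid[OF Q.group_GL] Q.scal_GL[OF c] GL] .
    then have "B_op q n (Suc a) (1 + t) \<in> edge_operators q n"
      unfolding edge_operators_def skein_space_eq using a False
      by (intro UnI2 CollectI exI[of _ "Suc a"] exI[of _ "1 + t"]) auto
    then have "proj_class Q.V (B_op q n (Suc a) (1 + t)) \<in> generate (PGL Q.V) (proj_class Q.V ` edge_operators q n)"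
      by (intro generate.incl imageI)
    then show ?thesis unfolding B Q.proj_class_scalar[OF c GL] .
  qed
qed

lemma Gam_generated:
  "g \<in> Gam \<Longrightarrow> proj_class Q.V (lift g) \<in> generate (PGL Q.V) (proj_class Q.V ` edge_operators q n)"
proof (induction rule: edge_group.induct)
  case one
  then show ?case using generate.one[of "PGL Q.V"] by (simp add: lift_1 Q.proj_class_one)
next
  case (step g i t)
  have h: "1 + t *\<^sub>R P i \<in> Gam" by (intro edge_group_gen step)
  have "lift (g * (1 + t *\<^sub>R P i)) = lift g \<otimes>\<^bsub>GL Q.V\<^esub> lift (1 + t *\<^sub>R P i)"
    unfolding Q.GL_mult by (intro lift_mult Gam_\<pi> step h)
  then show ?case
    using Q.proj_class_mult[OF Gam_GL[OF step.hyps(1)] Gam_GL[OF h]] generate.eng[OF step.IH generator_in[OF step.hyps(2,3)]]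
    by simp
qed

lemma transvection_Gam:
  assumes "\<pi> \<noteq> 0" "app \<pi> y = y" "linear \<phi>" "\<And>x. \<phi> (app \<pi> x) = \<phi> x" "\<phi> y = 0"
  shows "1 + t *\<^sub>R dyad y \<phi> \<in> Gam"
proof -
  interpret R: tl_representation P q M Gam \<pi> "n - 1" "app (tl.F (n - 1)) (kvec rainbow)"
    by unfold_locales
      (use n1 assms(1) \<pi>_idem P_\<pi> Gam_\<pi> rank_one top_vanishes in \<open>auto simp del: jones_wenzl.simps app_times\<close>)
  show ?thesis by (rule R.transvection_mem[OF assms(2-5)])
qed

lemma kvec_finite: "finite (kvec ` Collect realizable)"
proof -
  let ?S = "Pow ({..<n} \<times> {..<n})"
  have "kvec K \<in> (\<lambda>R. kvec (\<lambda>i k. (i, k) \<in> R)) ` ?S" for K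
    by (rule image_eqI[of _ _ "{(i, k). i < n \<and> k < n \<and> K i k}"]) (auto intro!: kvec_cong)
  then have "kvec ` Collect realizable \<subseteq> (\<lambda>R. kvec (\<lambda>i k. (i, k) \<in> R)) ` ?S" by blast
  then show ?thesis by (rule finite_subset) simp
qed

lemma cls_eq_\<pi>: "x \<in> graph_space n \<Longrightarrow> y \<in> graph_space n \<Longrightarrow> Q.cls x = Q.cls y \<longleftrightarrow> app \<pi> x = app \<pi> y"
  using \<pi>_cong[of x y] cls_\<pi> by (metis Q.cls_eq)

lemma basis_exists: "\<exists>B. is_basis Q.V B"
proof -
  obtain Bs where Bs: "Bs \<subseteq> kvec ` Collect realizable" "independent Bs" "kvec ` Collect realizable \<subseteq> span Bs"
    using maximal_independent_subset by blast
  have fin: "finite Bs" using Bs(1) kvec_finite finite_subset by blast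
  have \<pi>b: "app \<pi> b = b" "b \<in> graph_space n" if "b \<in> Bs" for b
  proof -
    show "app \<pi> b = b" using Bs(1) that by (auto simp: kvec_def \<pi>_vec)
    then show "b \<in> graph_space n" using \<pi>_range[of b] by simp
  qed
  have inj: "inj_on Q.cls Bs" by (rule inj_onI) (metis cls_eq_\<pi> \<pi>b)
  have sp: "app \<pi> x \<in> span Bs" for x
    using range_in_span[of x] span_minimal[OF Bs(3) subspace_span] by blast
  have sum: "(\<Oplus>\<^bsub>Q.V\<^esub>X\<in>Q.cls ` Bs. a X \<odot>\<^bsub>Q.V\<^esub> X) = Q.cls (\<Sum>b\<in>Bs. a (Q.cls b) *\<^sub>R b)" for a
  proof -
    let ?r = "inv_into Bs Q.cls"
    have r: "?r (Q.cls b) = b" if "b \<in> Bs" for b using inj that by simp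
    have "(\<Oplus>\<^bsub>Q.V\<^esub>X\<in>Q.cls ` Bs. a X \<odot>\<^bsub>Q.V\<^esub> X) = (\<Oplus>\<^bsub>Q.V\<^esub>X\<in>Q.cls ` Bs. Q.cls (a X *\<^sub>R ?r X))"
    proof (rule Q.V.finsum_cong')
      fix X assume "X \<in> Q.cls ` Bs"
      then obtain b where "b \<in> Bs" "X = Q.cls b" by auto
      then show "a X \<odot>\<^bsub>Q.V\<^esub> X = Q.cls (a X *\<^sub>R ?r X)" by (simp add: r Q.cls_smult \<pi>b)
    qed (auto simp: r \<pi>b intro!: Q.cls_carrier Q.scale_W)
    also have "\<dots> = Q.cls (\<Sum>X\<in>Q.cls ` Bs. a X *\<^sub>R ?r X)"
      by (rule Q.finsum_cls) (use fin \<pi>b in \<open>auto simp: r intro!: Q.scale_W\<close>)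
    also have "(\<Sum>X\<in>Q.cls ` Bs. a X *\<^sub>R ?r X) = (\<Sum>b\<in>Bs. a (Q.cls b) *\<^sub>R b)"
      by (subst sum.reindex[OF inj]) (auto simp: r)
    finally show ?thesis .
  qed
  have \<pi>sum: "app \<pi> (\<Sum>b\<in>Bs. a b *\<^sub>R b) = (\<Sum>b\<in>Bs. a b *\<^sub>R b)" for a
    by (simp add: linear_sum[OF linear_app] app_linear \<pi>b)
  have sumW: "(\<Sum>b\<in>Bs. a b *\<^sub>R b) \<in> graph_space n" for a
    using \<pi>_range[of "\<Sum>b\<in>Bs. a b *\<^sub>R b"] \<pi>sum by simp
  have "is_basis Q.V (Q.cls ` Bs)"
    unfolding is_basis_def sum
  proof (intro conjI ballI)
    fix X assume "X \<in> carrier Q.V"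
    then obtain x where x: "x \<in> graph_space n" "X = Q.cls x" by (rule Q.carrierE)
    have iff: "X = Q.cls (\<Sum>b\<in>Bs. a (Q.cls b) *\<^sub>R b) \<longleftrightarrow> app \<pi> x = (\<Sum>b\<in>Bs. a (Q.cls b) *\<^sub>R b)" for a
      unfolding x(2) cls_eq_\<pi>[OF x(1) sumW] \<pi>sum ..
    let ?c = "representation Bs (app \<pi> x)"
    have c: "(\<Sum>b\<in>Bs. ?c b *\<^sub>R b) = app \<pi> x" by (rule sum_representation_eq[OF Bs(2) sp fin]) simp
    define a0 where "a0 = (\<lambda>X\<in>Q.cls ` Bs. ?c (inv_into Bs Q.cls X))"
    have a0: "(\<Sum>b\<in>Bs. a0 (Q.cls b) *\<^sub>R b) = app \<pi> x"
    proof (rule trans[OF sum.cong c])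
      show "a0 (Q.cls b) *\<^sub>R b = ?c b *\<^sub>R b" if "b \<in> Bs" for b
        using that by (simp add: a0_def inv_into_f_f[OF inj])
    qed simp
    show "\<exists>!a. a \<in> extensional (Q.cls ` Bs) \<and> X = Q.cls (\<Sum>b\<in>Bs. a (Q.cls b) *\<^sub>R b)"
      unfolding iff
    proof (rule ex1I[of _ a0])
      show "a0 \<in> extensional (Q.cls ` Bs) \<and> app \<pi> x = (\<Sum>b\<in>Bs. a0 (Q.cls b) *\<^sub>R b)"
        using a0 by (simp add: a0_def)
      fix a assume a: "a \<in> extensional (Q.cls ` Bs) \<and> app \<pi> x = (\<Sum>b\<in>Bs. a (Q.cls b) *\<^sub>R b)"
      then have "(\<Sum>b\<in>Bs. (a (Q.cls b) - a0 (Q.cls b)) *\<^sub>R b) = 0"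
        using a0 by (simp add: scaleR_diff_left sum_subtractf)
      then have "a (Q.cls b) - a0 (Q.cls b) = 0" if "b \<in> Bs" for b
        using independentD[OF Bs(2) fin subset_refl, of "\<lambda>b. a (Q.cls b) - a0 (Q.cls b)" b] that by blast
      then show "a = a0" using a by (intro extensionalityI[of a "Q.cls ` Bs"]) (auto simp: a0_def)
    qed
  qed (use fin \<pi>b Q.cls_carrier in auto)
  then show ?thesis by blast
qed

text \<open>
  The same choice of basis as in the definition of \<open>endo_det\<close>.
\<close>

definition B where "B = (SOME B. is_basis Q.V B)"

lemma basis_B: "is_basis Q.V B"
  unfolding B_def by (rule someI_ex[OF basis_exists])

definition rep where "rep X = app \<pi> (SOME x. x \<in> X)"

lemma finite_B: "finite B" and B_carrier: "X \<in> B \<Longrightarrow> X \<in> carrier Q.V"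
  using basis_B by (auto simp: is_basis_def)

lemma rep: assumes "X \<in> carrier Q.V" shows "Q.cls (rep X) = X" "rep X \<in> graph_space n" "app \<pi> (rep X) = rep X"
proof -
  obtain x where x: "x \<in> graph_space n" "X = Q.cls x" using assms by (rule Q.carrierE)
  then show "Q.cls (rep X) = X" by (simp add: rep_def \<pi>_some cls_\<pi>)
  show "rep X \<in> graph_space n" "app \<pi> (rep X) = rep X" by (simp_all add: rep_def \<pi>_range app_\<pi>_\<pi>)
qed

lemma sum_B: "(\<Oplus>\<^bsub>Q.V\<^esub>X\<in>B. a X \<odot>\<^bsub>Q.V\<^esub> X) = Q.cls (\<Sum>X\<in>B. a X *\<^sub>R rep X)"
proof -
  have "(\<Oplus>\<^bsub>Q.V\<^esub>X\<in>B. a X \<odot>\<^bsub>Q.V\<^esub> X) = (\<Oplus>\<^bsub>Q.V\<^esub>X\<in>B. Q.cls (a X *\<^sub>R rep X))"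
  proof (rule Q.V.finsum_cong')
    fix X assume "X \<in> B"
    then show "a X \<odot>\<^bsub>Q.V\<^esub> X = Q.cls (a X *\<^sub>R rep X)" using rep[OF B_carrier] by (metis Q.cls_smult)
  qed (auto intro!: Q.cls_carrier Q.scale_W rep(2) simp: B_carrier)
  also have "\<dots> = Q.cls (\<Sum>X\<in>B. a X *\<^sub>R rep X)"
    by (rule Q.finsum_cls[OF finite_B]) (intro Q.scale_W rep B_carrier)
  finally show ?thesis .
qed

lemma \<pi>_sum_B: "app \<pi> (\<Sum>X\<in>B. a X *\<^sub>R rep X) = (\<Sum>X\<in>B. a X *\<^sub>R rep X)"
  by (simp add: linear_sum[OF linear_app] app_linear rep B_carrier)

lemma sum_B_in: "(\<Sum>X\<in>B. a X *\<^sub>R rep X) \<in> graph_space n"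
  using \<pi>_range[of "\<Sum>X\<in>B. a X *\<^sub>R rep X"] \<pi>_sum_B by simp

definition coord where "coord X x = coordinates Q.V B (Q.cls (app \<pi> x)) X"

lemma coord_ex1:
  "\<exists>!a. a \<in> extensional B \<and> app \<pi> x = (\<Sum>X\<in>B. a X *\<^sub>R rep X)"
  "(\<lambda>a. a \<in> extensional B \<and> Q.cls (app \<pi> x) = (\<Oplus>\<^bsub>Q.V\<^esub>b\<in>B. a b \<odot>\<^bsub>Q.V\<^esub> b)) =
   (\<lambda>a. a \<in> extensional B \<and> app \<pi> x = (\<Sum>X\<in>B. a X *\<^sub>R rep X))"
proof -
  have iff: "Q.cls (app \<pi> x) = (\<Oplus>\<^bsub>Q.V\<^esub>b\<in>B. a b \<odot>\<^bsub>Q.V\<^esub> b) \<longleftrightarrow> app \<pi> x = (\<Sum>X\<in>B. a X *\<^sub>R rep X)" for a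
    unfolding sum_B cls_eq_\<pi>[OF \<pi>_range sum_B_in] \<pi>_sum_B app_\<pi>_\<pi> ..
  show "(\<lambda>a. a \<in> extensional B \<and> Q.cls (app \<pi> x) = (\<Oplus>\<^bsub>Q.V\<^esub>b\<in>B. a b \<odot>\<^bsub>Q.V\<^esub> b)) =
   (\<lambda>a. a \<in> extensional B \<and> app \<pi> x = (\<Sum>X\<in>B. a X *\<^sub>R rep X))" unfolding iff ..
  show "\<exists>!a. a \<in> extensional B \<and> app \<pi> x = (\<Sum>X\<in>B. a X *\<^sub>R rep X)"
    unfolding iff[symmetric] using basis_B Q.cls_carrier[OF \<pi>_range[of x]] by (simp add: is_basis_def)
qed

lemma coord_sum: "app \<pi> x = (\<Sum>X\<in>B. coord X x *\<^sub>R rep X)"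
  using theI'[OF coord_ex1(1)[of x]] unfolding coord_def coordinates_def coord_ex1(2) by blast

lemma coord_unique:
  assumes "app \<pi> x = (\<Sum>X\<in>B. a X *\<^sub>R rep X)" "X \<in> B"
  shows "coord X x = a X"
proof -
  have "app \<pi> x = (\<Sum>X\<in>B. restrict a B X *\<^sub>R rep X)" using assms(1) by simp
  then have "(THE a. a \<in> extensional B \<and> app \<pi> x = (\<Sum>X\<in>B. a X *\<^sub>R rep X)) = restrict a B"
    by (intro the1_equality[OF coord_ex1(1)]) simp
  then show ?thesis unfolding coord_def coordinates_def coord_ex1(2) using assms(2) by simp
qed

lemma linear_coord: "X \<in> B \<Longrightarrow> linear (coord X)"
proof (rule linearI)
  fix x y r assume X: "X \<in> B"
  show "coord X (x + y) = coord X x + coord X y"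
    by (rule coord_unique[OF _ X]) (simp add: app_linear coord_sum[of x] coord_sum[of y] scaleR_add_left sum.distrib)
  show "coord X (r *\<^sub>R x) = r *\<^sub>R coord X x"
    by (simp, rule coord_unique[OF _ X]) (simp add: app_linear coord_sum[of x] scaleR_sum_right)
qed

lemma coord_\<pi>: "coord X (app \<pi> x) = coord X x"
  by (simp add: coord_def app_\<pi>_\<pi>)

lemma coord_rep: "X \<in> B \<Longrightarrow> Y \<in> B \<Longrightarrow> coord X (rep Y) = (if X = Y then 1 else 0)"
proof (rule coord_unique)
  assume "Y \<in> B"
  then show "app \<pi> (rep Y) = (\<Sum>X\<in>B. (if X = Y then 1 else 0) *\<^sub>R rep X)"
    using finite_B by (simp add: rep B_carrier if_distrib[where f = "\<lambda>c. c *\<^sub>R _"] cong: if_cong)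
qed

text \<open>
  Composing \<open>g\<close> with a transvection between two basis vectors adds a multiple of one row of the coordinate matrix of
  \<open>g\<close> to another, so the matrices realised by the group are closed under row additions.
\<close>

lemma SL_in_Gam:
  assumes f: "f \<in> SL Q.V"
  shows "\<exists>g\<in>Gam. f = lift g"
proof -
  have fGL: "f \<in> carrier (GL Q.V)" and det: "endo_det Q.V f = 1" using f by (auto simp: SL_def)
  have fB: "f \<in> Bij (carrier Q.V)" using fGL by (simp add: Q.GL_iff)
  obtain b where b: "bij_betw b {0..<card B} B" using ex_bij_betw_nat_finite[OF finite_B] by blast
  let ?N = "card B"
  have bB: "b i \<in> B" if "i < ?N" for i using b that by (auto dest: bij_betwE)
  have binj: "b i = b k \<longleftrightarrow> i = k" if "i < ?N" "k < ?N" for i k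
    using b that by (auto simp: bij_betw_def dest: inj_onD)
  define h where "h X Y = coordinates Q.V B (f X) Y" for X Y
  let ?A = "Matrix.mat ?N ?N (\<lambda>(i, j). h (b i) (b j))"
  have "endo_det Q.V f = (\<Sum>p | p permutes B. of_int (sign p) * (\<Prod>x\<in>B. h x (p x)))"
    by (simp add: endo_det_def Let_def h_def B_def)
  then have detA: "Determinant.det ?A = 1" using det leibniz_over_basis[OF b, of h] by simp
  let ?K = "{A. \<exists>g\<in>Gam. \<forall>i<?N. app g (rep (b i)) = (\<Sum>j<?N. A $$ (i, j) *\<^sub>R rep (b j))}"
  have "?A \<in> ?K"
  proof (rule row_addition_generates[OF _ _ _ detA])
    show "1\<^sub>m ?N \<in> ?K"
      by (intro CollectI bexI[of _ 1] edge_group.one)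
        (simp add: if_distrib[where f = "\<lambda>c. c *\<^sub>R _"] cong: if_cong)
  next
    fix A :: "real mat" and a k l
    assume A: "A \<in> ?K" "A \<in> carrier_mat ?N ?N" and kl: "k < ?N" "l < ?N" "k \<noteq> l"
    obtain g where g: "g \<in> Gam" "\<And>i. i < ?N \<Longrightarrow> app g (rep (b i)) = (\<Sum>j<?N. A $$ (i, j) *\<^sub>R rep (b j))" using A(1) by auto
    let ?d = "dyad (rep (b l)) (coord (b k))"
    have lin: "linear (coord (b k))" by (rule linear_coord[OF bB[OF kl(1)]])
    have c: "coord (b k) (rep (b i)) = (if i = k then 1 else 0)" if "i < ?N" for i
      using coord_rep[OF bB[OF kl(1)] bB[OF that]] binj[OF kl(1) that] by auto
    have "\<pi> \<noteq> 0"
    proof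
      assume "\<pi> = 0"
      then have "rep (b k) = 0" unfolding rep_def by simp
      then show False using c[OF kl(1)] linear_0[OF lin] by simp
    qed
    then have "1 + a *\<^sub>R ?d \<in> Gam"
      by (rule transvection_Gam) (use rep B_carrier bB kl lin coord_\<pi> c in auto)
    then have mem: "g * (1 + a *\<^sub>R ?d) \<in> Gam" by (rule edge_group_mult[OF _ g(1)])
    show "mat_addrow a k l A \<in> ?K"
    proof (intro CollectI bexI[OF _ mem] allI impI)
      fix i assume i: "i < ?N"
      show "app (g * (1 + a *\<^sub>R ?d)) (rep (b i)) = (\<Sum>j<?N. mat_addrow a k l A $$ (i, j) *\<^sub>R rep (b j))"
        using A(2) i kl c[OF i] g(2)[OF i] g(2)[OF kl(2)]
        by (simp add: lin app_linear scaleR_add_left sum.distrib scaleR_sum_right add.commute)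
    qed
  qed simp
  then obtain g where g: "g \<in> Gam" "\<And>i. i < ?N \<Longrightarrow> app g (rep (b i)) = (\<Sum>j<?N. ?A $$ (i, j) *\<^sub>R rep (b j))" by auto
  have gX: "app g (rep X) = (\<Sum>Y\<in>B. h X Y *\<^sub>R rep Y)" if X: "X \<in> B" for X
  proof -
    have "X \<in> b ` {0..<?N}" using b X by (simp add: bij_betw_def)
    then obtain i where i: "i < ?N" "X = b i" by auto
    have "app g (rep X) = (\<Sum>j\<in>{0..<?N}. h X (b j) *\<^sub>R rep (b j))"
      unfolding i(2) g(2)[OF i(1)] using i(1) by (intro sum.cong) auto
    also have "\<dots> = (\<Sum>Y\<in>B. h X Y *\<^sub>R rep Y)" by (rule sum.reindex_bij_betw[OF b])
    finally show ?thesis .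
  qed
  have fX: "f X = Q.cls (app g (rep X))" if X: "X \<in> B" for X
  proof -
    have c: "f X \<in> carrier Q.V" by (rule Q.Bij_in[OF fB B_carrier[OF X]])
    have "coord Y (rep (f X)) = h X Y" for Y using rep[OF c] by (simp add: coord_def h_def)
    then have "rep (f X) = (\<Sum>Y\<in>B. h X Y *\<^sub>R rep Y)" using coord_sum[of "rep (f X)"] rep[OF c] by simp
    then show ?thesis using gX[OF X] rep(1)[OF c] by simp
  qed
  note comm = Gam_\<pi>[OF g(1)]
  have lin_f: "f (Q.cls (\<Sum>X\<in>S. a X *\<^sub>R rep X)) = Q.cls (\<Sum>X\<in>S. a X *\<^sub>R app g (rep X))" if "S \<subseteq> B" for S a
    using finite_subset[OF that finite_B] that
  proof (induction S rule: finite_induct)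
    case empty
    have "f (Q.cls (0 *\<^sub>R 0)) = 0 \<odot>\<^bsub>Q.V\<^esub> f (Q.cls 0)" using fGL subspace_0[OF Q.W] by (simp only: Q.GL_iff)
    moreover obtain y where "f (Q.cls 0) = Q.cls y" using Q.Bij_in[OF fB Q.cls_carrier[OF subspace_0[OF Q.W]]] by (rule Q.carrierE)
    ultimately show ?case by (simp add: Q.cls_smult)
  next
    case (insert X S)
    have X: "X \<in> B" using insert by simp
    have in_W: "a X *\<^sub>R rep X \<in> graph_space n" "(\<Sum>X\<in>S. a X *\<^sub>R rep X) \<in> graph_space n"
      using insert.prems by (auto intro!: Q.scale_W rep B_carrier subspace_sum[OF Q.W])
    have "f (Q.cls (a X *\<^sub>R rep X + (\<Sum>X\<in>S. a X *\<^sub>R rep X))) = f (Q.cls (a X *\<^sub>R rep X)) \<oplus>\<^bsub>Q.V\<^esub> f (Q.cls (\<Sum>X\<in>S. a X *\<^sub>R rep X))"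
      using fGL in_W by (simp add: Q.GL_iff)
    also have "f (Q.cls (a X *\<^sub>R rep X)) = a X \<odot>\<^bsub>Q.V\<^esub> f X"
      using fGL rep[OF B_carrier[OF X]] by (simp add: Q.GL_iff)
    finally show ?case using insert fX[OF X] by (simp add: Q.cls_add Q.cls_smult)
  qed
  have "f = lift g"
  proof (rule Q.ext_eqI)
    show "f \<in> extensional (carrier Q.V)" using fB by (simp add: Bij_def)
    fix x assume x: "x \<in> graph_space n"
    have "f (Q.cls x) = f (Q.cls (\<Sum>X\<in>B. coord X x *\<^sub>R rep X))"
      using cls_\<pi>[OF x] coord_sum[of x] by simp
    also have "\<dots> = Q.cls (\<Sum>X\<in>B. coord X x *\<^sub>R app g (rep X))" by (rule lin_f) simp
    also have "(\<Sum>X\<in>B. coord X x *\<^sub>R app g (rep X)) = app g (app \<pi> x)"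
      unfolding coord_sum[of x] by (simp add: linear_sum[OF linear_app] app_linear)
    finally show "f (Q.cls x) = lift g (Q.cls x)" by (simp add: lift_cls[OF x])
  qed (simp add: lift_def)
  then show ?thesis using g(1) by blast
qed

lemma PSL_generated: "PSL (skein_space q n)
    \<subseteq> generate (PGL (skein_space q n)) (proj_class (skein_space q n) ` edge_operators q n)"
proof
  fix X assume "X \<in> PSL (skein_space q n)"
  then obtain f where f: "f \<in> SL Q.V" "X = proj_class Q.V f" by (auto simp: PSL_def skein_space_eq)
  then obtain g where "g \<in> Gam" "f = lift g" using SL_in_Gam by blast
  then show "X \<in> generate (PGL (skein_space q n)) (proj_class (skein_space q n) ` edge_operators q n)"
    using Gam_generated f(2) by (simp add: skein_space_eq)
qed

end

text \<open>
  Extend a basis of the relations to one of the graph space; send the former to \<open>0\<close> and fix the additional vectors.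
\<close>

lemma skein_projection_exists:
  assumes "q \<ge> 4" "n \<ge> 1"
  obtains \<pi> where "skein_projection q n \<pi>"
proof -
  let ?U = "relation_space q n" and ?W = "graph_space n"
  obtain BU where BU: "BU \<subseteq> ?U" "independent BU" "?U \<subseteq> span BU" using maximal_independent_subset by blast
  obtain BW where BW: "BU \<subseteq> BW" "BW \<subseteq> ?W" "independent BW" "?W \<subseteq> span BW"
    using maximal_independent_subset_extend[of BU ?W] BU relation_subset_graph[of q n] by blast
  let ?f = "\<lambda>b. if b \<in> BU then 0 else b"
  from linear_independent_extend_subspace[OF BW(3), of ?f]
  obtain g where g: "linear g" "\<forall>x\<in>BW. g x = ?f x" "range g = span (?f ` BW)"
    by (elim exE conjE)
  have U: "g x = 0" if "x \<in> ?U" for x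
    by (rule linear_eq_0_on_span[OF g(1), of BU]) (use g(2) BW(1) BU(3) that in auto)
  have W: "g x - x \<in> ?U" if "x \<in> ?W" for x
  proof -
    have "linear (\<lambda>x. g x - x)" using g(1) by (intro linear_compose_sub linear_ident)
    moreover have "g b - b \<in> span BU" if "b \<in> BW" for b
      using g(2) that by (auto intro: span_base span_neg span_zero)
    ultimately have "g x - x \<in> span BU"
      by (rule linear_image_span_subset) (use BW(4) that in auto)
    then show ?thesis using span_minimal[OF BU(1) subspace_relation_space] by blast
  qed
  have R: "g x \<in> ?W" for x
  proof -
    have "?f ` BW \<subseteq> ?W" using BW(2) subspace_0[OF subspace_graph_space] by auto
    then show ?thesis using g(3) span_minimal[OF _ subspace_graph_space] by blast
  qed
  have "skein_projection q n (Endo g)"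
  proof
    show "Endo g * Endo g = Endo g"
    proof (rule endo_eqI)
      fix x
        have "g (g x) = g x"
      proof -
        have "g (g b) = g b" if "b \<in> BW" for b using g(2) that linear_0[OF g(1)] by auto
        then have "g y = y" if "y \<in> span (?f ` BW)" for y
          by (intro linear_eq_on_span[OF g(1) linear_ident _ that]) (use g(2) linear_0[OF g(1)] in auto)
        then show ?thesis using g(3) by blast
      qed
      then show "app (Endo g * Endo g) x = app (Endo g) x" by (simp add: app_Endo[OF g(1)])
    qed
  qed (use assms U W R in \<open>simp_all add: app_Endo[OF g(1)]\<close>)
  then show thesis by (rule that)
qed

theorem corollary1p5:
  fixes q :: real and n :: nat
  assumes "q \<ge> 4" and "n \<ge> 1"
  shows "PSL (skein_space q n)
    \<subseteq> generate (PGL (skein_space q n)) (proj_class (skein_space q n) ` edge_operators q n)"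
proof -
  obtain \<pi> where "skein_projection q n \<pi>" by (rule skein_projection_exists[OF assms])
  then show ?thesis by (rule skein_projection.PSL_generated)
qed

end
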